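(* Let $K$ be a field of characteristic zero and let $\mathfrak{M}$ be one of the following varieties of algebras over $K$: (1) a Nielsen-Schreier variety of algebras; (2) the variety of all associative algebras; (3) the variety of all associative and commutative algebras; (4) the variety of all metabelian Lie algebras. Let $A=K_{\mathfrak{M}}\langle x_1,\ldots,x_n\rangle$ be the free algebra of $\mathfrak{M}$ on $x_1,\ldots,x_n$. Let $\mathfrak{N}$ be any subvariety of $\mathfrak{M}$ and let $I\subseteq A$ be the ideal of all identities of $\mathfrak{N}$ in $\mathfrak{M}$ in $n$ variables. Suppose that an endomorphism $\epsilon\in\mathrm{IE}(A,i)\setminus\mathrm{IE}(A,i+1)$, for some $i\ge1$, induces an automorphism $\phi$ of $B=A/I$, and that the ideal $I$ does not contain (nonzero) elements of degree $\le i+1$. If $\mathrm{div}(T(\epsilon))\ne0$, then $\phi$ is absolutely wild.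
   Context: A variety of algebras is Nielsen-Schreier if every subalgebra of any free algebra of the variety is free. A Lie algebra is metabelian if it satisfies $[[x,y],[z,t]]=0$. If $\mathfrak{M}$ is a unitary variety, its free algebras are taken with identity $1$. $B=A/I$ is the free algebra of $\mathfrak{N}$ of rank $n$ on the images $z_1,\ldots,z_n$ of $x_1,\ldots,x_n$. Grading: a free algebra $A$ is graded by degree, $A=A_0\oplus A_1\oplus\cdots$, $A_k$ the linear span of monomials of degree $k$ ($A_0=K\cdot1$ if unital, $A_0=0$ otherwise); the same notation is used for $B$. $(f_1,\ldots,f_n)$ denotes the endomorphism $x_j\mapsto f_j$. For $F=(f_1,\ldots,f_n)\in A^n$, $D_F=f_1\partial_1+\cdots+f_n\partial_n$ is the unique derivation with $x_j\mapsto f_j$. $\mathrm{IE}(A,i)$ is the monoid of endomorphisms of $A$ inducing the identity on $A/(A_{i+1}+A_{i+2}+\cdots)$, i.e. $\epsilon(x_j)-x_j\in A_{i+1}+A_{i+2}+\cdots$ for all $j$. If $\epsilon\in\mathrm{IE}(A,i)\setminus\mathrm{IE}(A,i+1)$ and $\epsilon(x_j)=x_j+f_j+F_j$ with $f_j\in A_{i+1}$, $F_j\in A_{i+2}+A_{i+3}+\cdots$, then $T(\epsilon)=f_1\partial_1+\cdots+f_n\partial_n$. Divergence: regard $A$ as the subalgebra generated by $x_1,\ldots,x_n$ in the free algebra $C=K_{\mathfrak{M}}\langle x_1,\ldots,x_n,y_1,\ldots,y_n\rangle$, and let $\Omega_A$ be the set of elements of $C$ homogeneous of degree $1$ in the set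 of variables $y_1,\ldots,y_n$. $U=U(A)$ is the associative algebra with identity generated by all operators $L_a,R_a:\Omega_A\to\Omega_A$, $L_a(w)=aw$, $R_a(w)=wa$, $a\in A$. $\Omega_A=Uy_1\oplus\cdots\oplus Uy_n$ is a free left $U$-module. The universal derivation $\mathcal{D}:A\to\Omega_A$ is the linear map with $\mathcal{D}(x_j)=y_j$ and $\mathcal{D}(ab)=L_a\mathcal{D}(b)+R_b\mathcal{D}(a)$; writing $\mathcal{D}(a)=\sum_ju_jy_j$ with unique $u_j\in U$, set $\frac{\partial a}{\partial x_j}=u_j$. The divergence $\mathrm{div}(D_F)$ is the image of $\frac{\partial f_1}{\partial x_1}+\cdots+\frac{\partial f_n}{\partial x_n}$ in $U/([U,U]+R)$, where $[U,U]$ is the linear span of commutators and $R=\mathrm{Rad}(U)$ is the Jacobson radical of $U$. Tame and wild: for the free algebra $B$ on $z_1,\ldots,z_n$, an automorphism $(z_1,\ldots,z_{j-1},\alpha z_j+f,z_{j+1},\ldots,z_n)$ with $0\ne\alpha\in K$ and $f$ in the subalgebra generated by the $z_l$, $l\ne j$, is called elementary; tame automorphisms are the elements of the subgroup of $\mathrm{Aut}(B)$ generated by elementary automorphisms. For $k\ge1$, $\mathrm{IA}(B,k)$ is the group of automorphisms $\phi$ of $B$ with $\phi(z_j)-z_j\in B_{k+1}+B_{k+2}+\cdots$ for all $j$. $\phi\in\mathrm{Aut}(B)$ is approximately tame if there is a sequence of tame automorphisms $\psi_k$ of $B$ with $\phi\psi_k^{-1}\in\mathrm{IA}(B,k)$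 for all $k$, and absolutely wild if it is not approximately tame. *)

theory Defs
  imports "HOL-Algebra.Module" "HOL-Algebra.QuotRing" "HOL-Algebra.Bij"
    "HOL-Algebra.Generated_Groups"
begin

section \<open>Nonassociative algebras\<close>

text \<open>
  Algebras over a field \<open>K\<close> are HOL-Algebra module records: the fields inherited from rings provide
  the product and \<open>one\<close>. The flag \<open>u\<close> fixes the signature: for \<open>u = True\<close> algebras have an
  identity element, which subalgebras contain and homomorphisms preserve; for \<open>u = False\<close> the
  record field \<open>one\<close> is irrelevant.
\<close>

definition char_zero :: "'k ring \<Rightarrow> bool" where
  "char_zero K \<longleftrightarrow> (\<forall>m::nat. 0 < m \<longrightarrow> [m] \<cdot>\<^bsub>K\<^esub> \<one>\<^bsub>K\<^esub> \<noteq> \<zero>\<^bsub>K\<^esub>)"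

locale nonassoc_algebra = module K A for K :: "'k ring" and A :: "('k, 'a) module" +
  assumes m_closed: "\<lbrakk>x \<in> carrier A; y \<in> carrier A\<rbrakk> \<Longrightarrow> x \<otimes>\<^bsub>A\<^esub> y \<in> carrier A"
    and l_distr: "\<lbrakk>x \<in> carrier A; y \<in> carrier A; z \<in> carrier A\<rbrakk> \<Longrightarrow>
      (x \<oplus>\<^bsub>A\<^esub> y) \<otimes>\<^bsub>A\<^esub> z = (x \<otimes>\<^bsub>A\<^esub> z) \<oplus>\<^bsub>A\<^esub> (y \<otimes>\<^bsub>A\<^esub> z)"
    and r_distr: "\<lbrakk>x \<in> carrier A; y \<in> carrier A; z \<in> carrier A\<rbrakk> \<Longrightarrow>
      z \<otimes>\<^bsub>A\<^esub> (x \<oplus>\<^bsub>A\<^esub> y) = (z \<otimes>\<^bsub>A\<^esub> x) \<oplus>\<^bsub>A\<^esub> (z \<otimes>\<^bsub>A\<^esub> y)"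
    and smult_l: "\<lbrakk>c \<in> carrier K; x \<in> carrier A; y \<in> carrier A\<rbrakk> \<Longrightarrow>
      (c \<odot>\<^bsub>A\<^esub> x) \<otimes>\<^bsub>A\<^esub> y = c \<odot>\<^bsub>A\<^esub> (x \<otimes>\<^bsub>A\<^esub> y)"
    and smult_r: "\<lbrakk>c \<in> carrier K; x \<in> carrier A; y \<in> carrier A\<rbrakk> \<Longrightarrow>
      x \<otimes>\<^bsub>A\<^esub> (c \<odot>\<^bsub>A\<^esub> y) = c \<odot>\<^bsub>A\<^esub> (x \<otimes>\<^bsub>A\<^esub> y)"

definition has_identity :: "('k, 'a) module \<Rightarrow> bool" where
  "has_identity A \<longleftrightarrow> \<one>\<^bsub>A\<^esub> \<in> carrier A \<and>
     (\<forall>a\<in>carrier A. \<one>\<^bsub>A\<^esub> \<otimes>\<^bsub>A\<^esub> a = a \<and> a \<otimes>\<^bsub>A\<^esub> \<one>\<^bsub>A\<^esub> = a)"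

definition algebras :: "'k ring \<Rightarrow> bool \<Rightarrow> ('k, 'a) module set" where
  "algebras K u = {A. nonassoc_algebra K A \<and> (u \<longrightarrow> has_identity A)}"

definition lin_span :: "'k ring \<Rightarrow> ('k, 'a) module \<Rightarrow> 'a set \<Rightarrow> 'a set" where
  "lin_span K A S = \<Inter>{H. submodule H K A \<and> S \<subseteq> H}"

definition subalgebra :: "'k ring \<Rightarrow> bool \<Rightarrow> ('k, 'a) module \<Rightarrow> 'a set \<Rightarrow> bool" where
  "subalgebra K u A H \<longleftrightarrow> submodule H K A \<and> (\<forall>a\<in>H. \<forall>b\<in>H. a \<otimes>\<^bsub>A\<^esub> b \<in> H) \<and> (u \<longrightarrow> \<one>\<^bsub>A\<^esub> \<in> H)"

definition gen_subalgebra :: "'k ring \<Rightarrow> bool \<Rightarrow> ('k, 'a) module \<Rightarrow> 'a set \<Rightarrow> 'a set" where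
  "gen_subalgebra K u A S = \<Inter>{H. subalgebra K u A H \<and> S \<subseteq> H}"

definition linear_maps :: "'k ring \<Rightarrow> ('k, 'a) module \<Rightarrow> ('k, 'b) module \<Rightarrow> ('a \<Rightarrow> 'b) set" where
  "linear_maps K A B = {h \<in> carrier A \<rightarrow>\<^sub>E carrier B.
     (\<forall>a\<in>carrier A. \<forall>b\<in>carrier A. h (a \<oplus>\<^bsub>A\<^esub> b) = h a \<oplus>\<^bsub>B\<^esub> h b) \<and>
     (\<forall>c\<in>carrier K. \<forall>a\<in>carrier A. h (c \<odot>\<^bsub>A\<^esub> a) = c \<odot>\<^bsub>B\<^esub> h a)}"

definition alg_hom :: "'k ring \<Rightarrow> bool \<Rightarrow> ('k, 'a) module \<Rightarrow> ('k, 'b) module \<Rightarrow> ('a \<Rightarrow> 'b) set" where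
  "alg_hom K u A B = {h \<in> linear_maps K A B.
     (\<forall>a\<in>carrier A. \<forall>b\<in>carrier A. h (a \<otimes>\<^bsub>A\<^esub> b) = h a \<otimes>\<^bsub>B\<^esub> h b) \<and>
     (u \<longrightarrow> h \<one>\<^bsub>A\<^esub> = \<one>\<^bsub>B\<^esub>)}"

definition alg_isomorphic :: "'k ring \<Rightarrow> bool \<Rightarrow> ('k, 'a) module \<Rightarrow> ('k, 'b) module \<Rightarrow> bool" where
  "alg_isomorphic K u A B \<longleftrightarrow> (\<exists>h\<in>alg_hom K u A B. bij_betw h (carrier A) (carrier B))"

definition alg_aut :: "'k ring \<Rightarrow> bool \<Rightarrow> ('k, 'a) module \<Rightarrow> ('a \<Rightarrow> 'a) set" where
  "alg_aut K u A = alg_hom K u A A \<inter> Bij (carrier A)"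

definition derivations :: "'k ring \<Rightarrow> ('k, 'a) module \<Rightarrow> ('a \<Rightarrow> 'a) set" where
  "derivations K A = {D \<in> linear_maps K A A.
     \<forall>a\<in>carrier A. \<forall>b\<in>carrier A. D (a \<otimes>\<^bsub>A\<^esub> b) = (D a \<otimes>\<^bsub>A\<^esub> b) \<oplus>\<^bsub>A\<^esub> (a \<otimes>\<^bsub>A\<^esub> D b)}"

definition quot_algebra :: "('k, 'a) module \<Rightarrow> 'a set \<Rightarrow> ('k, 'a set) module" where
  "quot_algebra A I =
    \<lparr>carrier = carrier (A Quot I), mult = mult (A Quot I), one = one (A Quot I),
     zero = zero (A Quot I), add = add (A Quot I),
     smult = (\<lambda>c X. \<Union>a\<in>X. I +>\<^bsub>A\<^esub> (c \<odot>\<^bsub>A\<^esub> a))\<rparr>"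


section \<open>Identities and varieties\<close>

text \<open>Terms present (not necessarily associative) polynomials in the variables \<open>'v\<close>.\<close>

datatype ('k, 'v) aterm =
    TVar 'v
  | TZero
  | TOne
  | TAdd "('k, 'v) aterm" "('k, 'v) aterm"
  | TScale 'k "('k, 'v) aterm"
  | TMult "('k, 'v) aterm" "('k, 'v) aterm"

inductive_set terms :: "'k ring \<Rightarrow> bool \<Rightarrow> 'v set \<Rightarrow> ('k, 'v) aterm set"
  for K :: "'k ring" and u :: bool and X :: "'v set" where
    "x \<in> X \<Longrightarrow> TVar x \<in> terms K u X"
  | "TZero \<in> terms K u X"
  | "u \<Longrightarrow> TOne \<in> terms K u X"
  | "\<lbrakk>s \<in> terms K u X; t \<in> terms K u X\<rbrakk> \<Longrightarrow> TAdd s t \<in> terms K u X"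
  | "\<lbrakk>c \<in> carrier K; t \<in> terms K u X\<rbrakk> \<Longrightarrow> TScale c t \<in> terms K u X"
  | "\<lbrakk>s \<in> terms K u X; t \<in> terms K u X\<rbrakk> \<Longrightarrow> TMult s t \<in> terms K u X"

primrec teval :: "('k, 'a) module \<Rightarrow> ('v \<Rightarrow> 'a) \<Rightarrow> ('k, 'v) aterm \<Rightarrow> 'a" where
  "teval A \<rho> (TVar x) = \<rho> x"
| "teval A \<rho> TZero = \<zero>\<^bsub>A\<^esub>"
| "teval A \<rho> TOne = \<one>\<^bsub>A\<^esub>"
| "teval A \<rho> (TAdd s t) = teval A \<rho> s \<oplus>\<^bsub>A\<^esub> teval A \<rho> t"
| "teval A \<rho> (TScale c t) = c \<odot>\<^bsub>A\<^esub> teval A \<rho> t"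
| "teval A \<rho> (TMult s t) = teval A \<rho> s \<otimes>\<^bsub>A\<^esub> teval A \<rho> t"

definition satisfies :: "('k, 'a) module \<Rightarrow> ('k, 'v) aterm \<Rightarrow> bool" where
  "satisfies A t \<longleftrightarrow> (\<forall>\<rho> \<in> UNIV \<rightarrow> carrier A. teval A \<rho> t = \<zero>\<^bsub>A\<^esub>)"

text \<open>
  A variety is the class of all algebras that satisfy a given set of identities. Here this class
  consists of algebras whose carriers are subsets of the type \<open>'a\<close>; no information is lost if
  \<open>'a\<close> has at least the cardinality of the (infinite) field \<open>K\<close>, because every algebra generated
  by countably many elements then has an isomorphic copy in \<open>'a\<close>.
\<close>

definition variety :: "'k ring \<Rightarrow> bool \<Rightarrow> ('k, 'a) module set \<Rightarrow> bool" where
  "variety K u M \<longleftrightarrow>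
     (\<exists>E \<subseteq> terms K u (UNIV :: nat set). M = {A \<in> algebras K u. \<forall>t\<in>E. satisfies A t})"

definition associative_algebras :: "'k ring \<Rightarrow> bool \<Rightarrow> ('k, 'a) module set" where
  "associative_algebras K u = {A \<in> algebras K u.
     \<forall>x\<in>carrier A. \<forall>y\<in>carrier A. \<forall>z\<in>carrier A.
       (x \<otimes>\<^bsub>A\<^esub> y) \<otimes>\<^bsub>A\<^esub> z = x \<otimes>\<^bsub>A\<^esub> (y \<otimes>\<^bsub>A\<^esub> z)}"

definition comm_associative_algebras :: "'k ring \<Rightarrow> bool \<Rightarrow> ('k, 'a) module set" where
  "comm_associative_algebras K u = {A \<in> associative_algebras K u.
     \<forall>x\<in>carrier A. \<forall>y\<in>carrier A. x \<otimes>\<^bsub>A\<^esub> y = y \<otimes>\<^bsub>A\<^esub> x}"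

definition lie_algebras :: "'k ring \<Rightarrow> bool \<Rightarrow> ('k, 'a) module set" where
  "lie_algebras K u = {A \<in> algebras K u.
     (\<forall>x\<in>carrier A. x \<otimes>\<^bsub>A\<^esub> x = \<zero>\<^bsub>A\<^esub>) \<and>
     (\<forall>x\<in>carrier A. \<forall>y\<in>carrier A. \<forall>z\<in>carrier A.
       ((x \<otimes>\<^bsub>A\<^esub> y) \<otimes>\<^bsub>A\<^esub> z) \<oplus>\<^bsub>A\<^esub> ((y \<otimes>\<^bsub>A\<^esub> z) \<otimes>\<^bsub>A\<^esub> x) \<oplus>\<^bsub>A\<^esub> ((z \<otimes>\<^bsub>A\<^esub> x) \<otimes>\<^bsub>A\<^esub> y) = \<zero>\<^bsub>A\<^esub>)}"

definition metabelian_lie_algebras :: "'k ring \<Rightarrow> bool \<Rightarrow> ('k, 'a) module set" where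
  "metabelian_lie_algebras K u = {A \<in> lie_algebras K u.
     \<forall>x\<in>carrier A. \<forall>y\<in>carrier A. \<forall>z\<in>carrier A. \<forall>t\<in>carrier A.
       (x \<otimes>\<^bsub>A\<^esub> y) \<otimes>\<^bsub>A\<^esub> (z \<otimes>\<^bsub>A\<^esub> t) = \<zero>\<^bsub>A\<^esub>}"


section \<open>Free algebras of a variety\<close>

definition term_class ::
  "'k ring \<Rightarrow> bool \<Rightarrow> ('k, 'a) module set \<Rightarrow> ('k, 'v) aterm \<Rightarrow> ('k, 'v) aterm set" where
  "term_class K u M t = {s \<in> terms K u UNIV.
     \<forall>A\<in>M. \<forall>\<rho> \<in> UNIV \<rightarrow> carrier A. teval A \<rho> s = teval A \<rho> t}"

text \<open>
  The free algebra of \<open>M\<close> on \<open>X\<close>: polynomials in \<open>X\<close> modulo the identities of \<open>M\<close>. Classes are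
  formed among the terms in all variables of type \<open>'v\<close>, so that for \<open>X \<subseteq> Y\<close> the free algebra on
  \<open>X\<close> literally is the subalgebra generated by \<open>X\<close> in the free algebra on \<open>Y\<close>.
\<close>

definition free_algebra ::
  "'k ring \<Rightarrow> bool \<Rightarrow> ('k, 'a) module set \<Rightarrow> 'v set \<Rightarrow> ('k, ('k, 'v) aterm set) module" where
  "free_algebra K u M X =
    \<lparr>carrier = term_class K u M ` terms K u X,
     mult = (\<lambda>a b. \<Union>s\<in>a. \<Union>t\<in>b. term_class K u M (TMult s t)),
     one = term_class K u M TOne,
     zero = term_class K u M TZero,
     add = (\<lambda>a b. \<Union>s\<in>a. \<Union>t\<in>b. term_class K u M (TAdd s t)),
     smult = (\<lambda>c a. \<Union>t\<in>a. term_class K u M (TScale c t))\<rparr>"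

text \<open>A basis of \<open>S\<close> is a subset of \<open>S\<close>, so it suffices to let \<open>Y\<close> range over sets of elements.\<close>

definition is_free_in ::
  "'k ring \<Rightarrow> bool \<Rightarrow> ('k, 'a) module set \<Rightarrow> ('k, 's) module \<Rightarrow> bool" where
  "is_free_in K u M S \<longleftrightarrow> (\<exists>Y :: 's set. alg_isomorphic K u S (free_algebra K u M Y))"

definition nielsen_schreier ::
  "'v itself \<Rightarrow> 'k ring \<Rightarrow> bool \<Rightarrow> ('k, 'a) module set \<Rightarrow> bool" where
  "nielsen_schreier _ K u M \<longleftrightarrow> (\<forall>(X :: 'v set) H.
     subalgebra K u (free_algebra K u M X) H \<longrightarrow>
     is_free_in K u M ((free_algebra K u M X)\<lparr>carrier := H\<rparr>))"


section \<open>Gradings\<close>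

primrec is_monomial :: "('k, 'v) aterm \<Rightarrow> bool" where
  "is_monomial (TVar x) = True"
| "is_monomial TZero = False"
| "is_monomial TOne = False"
| "is_monomial (TAdd s t) = False"
| "is_monomial (TScale c t) = False"
| "is_monomial (TMult s t) = (is_monomial s \<and> is_monomial t)"

primrec weight :: "('v \<Rightarrow> nat) \<Rightarrow> ('k, 'v) aterm \<Rightarrow> nat" where
  "weight w (TVar x) = w x"
| "weight w TZero = 0"
| "weight w TOne = 0"
| "weight w (TAdd s t) = 0"
| "weight w (TScale c t) = 0"
| "weight w (TMult s t) = weight w s + weight w t"

text \<open>
  The span of the monomials of weight \<open>k\<close> in the elements \<open>g x\<close>, \<open>x \<in> X\<close>, the factor \<open>g x\<close>
  having weight \<open>w x\<close>.
\<close>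

definition weight_part :: "'k ring \<Rightarrow> bool \<Rightarrow> ('k, 'a) module \<Rightarrow> 'v set \<Rightarrow> ('v \<Rightarrow> 'a) \<Rightarrow>
    ('v \<Rightarrow> nat) \<Rightarrow> nat \<Rightarrow> 'a set" where
  "weight_part K u A X g w k = lin_span K A
     ({teval A g t | t. t \<in> terms K u X \<and> is_monomial t \<and> weight w t = k} \<union>
      (if u \<and> k = 0 then {\<one>\<^bsub>A\<^esub>} else {}))"

definition degree_part ::
  "'k ring \<Rightarrow> bool \<Rightarrow> ('k, 'a) module \<Rightarrow> nat \<Rightarrow> (nat \<Rightarrow> 'a) \<Rightarrow> nat \<Rightarrow> 'a set" where
  "degree_part K u A n g k = weight_part K u A {..<n} g (\<lambda>_. 1) k"

definition degree_ge ::
  "'k ring \<Rightarrow> bool \<Rightarrow> ('k, 'a) module \<Rightarrow> nat \<Rightarrow> (nat \<Rightarrow> 'a) \<Rightarrow> nat \<Rightarrow> 'a set" where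
  "degree_ge K u A n g k = lin_span K A (\<Union>m\<in>{k..}. degree_part K u A n g m)"

definition degree_le ::
  "'k ring \<Rightarrow> bool \<Rightarrow> ('k, 'a) module \<Rightarrow> nat \<Rightarrow> (nat \<Rightarrow> 'a) \<Rightarrow> nat \<Rightarrow> 'a set" where
  "degree_le K u A n g k = lin_span K A (\<Union>m\<in>{..k}. degree_part K u A n g m)"


section \<open>Tame and absolutely wild automorphisms\<close>

text \<open>Below, \<open>B\<close> is a free algebra of rank \<open>n\<close> with free generators \<open>z 0, \<dots>, z (n - 1)\<close>.\<close>

definition elementary_auts ::
  "'k ring \<Rightarrow> bool \<Rightarrow> ('k, 'b) module \<Rightarrow> nat \<Rightarrow> (nat \<Rightarrow> 'b) \<Rightarrow> ('b \<Rightarrow> 'b) set" where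
  "elementary_auts K u B n z = {\<phi> \<in> alg_aut K u B.
     \<exists>j<n. \<exists>\<alpha>\<in>carrier K - {\<zero>\<^bsub>K\<^esub>}. \<exists>f\<in>gen_subalgebra K u B (z ` ({..<n} - {j})).
       \<phi> (z j) = (\<alpha> \<odot>\<^bsub>B\<^esub> z j) \<oplus>\<^bsub>B\<^esub> f \<and> (\<forall>l\<in>{..<n} - {j}. \<phi> (z l) = z l)}"

definition tame_auts ::
  "'k ring \<Rightarrow> bool \<Rightarrow> ('k, 'b) module \<Rightarrow> nat \<Rightarrow> (nat \<Rightarrow> 'b) \<Rightarrow> ('b \<Rightarrow> 'b) set" where
  "tame_auts K u B n z = generate (BijGroup (carrier B)) (elementary_auts K u B n z)"

definition IA ::
  "'k ring \<Rightarrow> bool \<Rightarrow> ('k, 'b) module \<Rightarrow> nat \<Rightarrow> (nat \<Rightarrow> 'b) \<Rightarrow> nat \<Rightarrow> ('b \<Rightarrow> 'b) set" where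
  "IA K u B n z k = {\<phi> \<in> alg_aut K u B. \<forall>j<n. \<phi> (z j) \<ominus>\<^bsub>B\<^esub> z j \<in> degree_ge K u B n z (k + 1)}"

definition approximately_tame ::
  "'k ring \<Rightarrow> bool \<Rightarrow> ('k, 'b) module \<Rightarrow> nat \<Rightarrow> (nat \<Rightarrow> 'b) \<Rightarrow> ('b \<Rightarrow> 'b) \<Rightarrow> bool" where
  "approximately_tame K u B n z \<phi> \<longleftrightarrow>
     (\<exists>\<psi> :: nat \<Rightarrow> 'b \<Rightarrow> 'b. \<forall>k\<ge>1. \<psi> k \<in> tame_auts K u B n z \<and>
        \<phi> \<otimes>\<^bsub>BijGroup (carrier B)\<^esub> inv\<^bsub>BijGroup (carrier B)\<^esub> (\<psi> k) \<in> IA K u B n z k)"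

definition absolutely_wild ::
  "'k ring \<Rightarrow> bool \<Rightarrow> ('k, 'b) module \<Rightarrow> nat \<Rightarrow> (nat \<Rightarrow> 'b) \<Rightarrow> ('b \<Rightarrow> 'b) \<Rightarrow> bool" where
  "absolutely_wild K u B n z \<phi> \<longleftrightarrow> \<phi> \<in> alg_aut K u B \<and> \<not> approximately_tame K u B n z \<phi>"


section \<open>The algebras A, B and C\<close>

text \<open>
  \<open>XVar j\<close> and \<open>YVar j\<close> with \<open>j < n\<close> stand for the generators indexed by \<open>j + 1\<close> in the usual
  numbering from \<open>1\<close>.
\<close>

datatype gen = XVar nat | YVar nat

type_synonym 'k elem = "('k, gen) aterm set"

definition gen_x :: "'k ring \<Rightarrow> bool \<Rightarrow> ('k, 'a) module set \<Rightarrow> nat \<Rightarrow> 'k elem" where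
  "gen_x K u M j = term_class K u M (TVar (XVar j))"

definition gen_y :: "'k ring \<Rightarrow> bool \<Rightarrow> ('k, 'a) module set \<Rightarrow> nat \<Rightarrow> 'k elem" where
  "gen_y K u M j = term_class K u M (TVar (YVar j))"

definition alg_A :: "'k ring \<Rightarrow> bool \<Rightarrow> ('k, 'a) module set \<Rightarrow> nat \<Rightarrow> ('k, 'k elem) module" where
  "alg_A K u M n = free_algebra K u M (XVar ` {..<n})"

definition alg_C :: "'k ring \<Rightarrow> bool \<Rightarrow> ('k, 'a) module set \<Rightarrow> nat \<Rightarrow> ('k, 'k elem) module" where
  "alg_C K u M n = free_algebra K u M (XVar ` {..<n} \<union> YVar ` {..<n})"

definition ideal_I :: "'k ring \<Rightarrow> bool \<Rightarrow> ('k, 'a) module set \<Rightarrow> ('k, 'a) module set \<Rightarrow> nat \<Rightarrow>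
    'k elem set" where
  "ideal_I K u M N n = {term_class K u M t | t.
     t \<in> terms K u (XVar ` {..<n}) \<and> (\<forall>S\<in>N. satisfies S t)}"

definition alg_B :: "'k ring \<Rightarrow> bool \<Rightarrow> ('k, 'a) module set \<Rightarrow> ('k, 'a) module set \<Rightarrow> nat \<Rightarrow>
    ('k, 'k elem set) module" where
  "alg_B K u M N n = quot_algebra (alg_A K u M n) (ideal_I K u M N n)"

definition to_B :: "'k ring \<Rightarrow> bool \<Rightarrow> ('k, 'a) module set \<Rightarrow> ('k, 'a) module set \<Rightarrow> nat \<Rightarrow>
    'k elem \<Rightarrow> 'k elem set" where
  "to_B K u M N n a = ideal_I K u M N n +>\<^bsub>alg_A K u M n\<^esub> a"

definition gen_z :: "'k ring \<Rightarrow> bool \<Rightarrow> ('k, 'a) module set \<Rightarrow> ('k, 'a) module set \<Rightarrow> nat \<Rightarrow>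
    nat \<Rightarrow> 'k elem set" where
  "gen_z K u M N n j = to_B K u M N n (gen_x K u M j)"


section \<open>Endomorphisms inducing the identity modulo high degrees\<close>

definition IE :: "'k ring \<Rightarrow> bool \<Rightarrow> ('k, 'a) module set \<Rightarrow> nat \<Rightarrow> nat \<Rightarrow>
    ('k elem \<Rightarrow> 'k elem) set" where
  "IE K u M n i = {\<epsilon> \<in> alg_hom K u (alg_A K u M n) (alg_A K u M n).
     \<forall>j<n. \<epsilon> (gen_x K u M j) \<ominus>\<^bsub>alg_A K u M n\<^esub> gen_x K u M j
       \<in> degree_ge K u (alg_A K u M n) n (gen_x K u M) (i + 1)}"

definition leading_part :: "'k ring \<Rightarrow> bool \<Rightarrow> ('k, 'a) module set \<Rightarrow> nat \<Rightarrow> nat \<Rightarrow>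
    ('k elem \<Rightarrow> 'k elem) \<Rightarrow> nat \<Rightarrow> 'k elem" where
  "leading_part K u M n i \<epsilon> j =
     (THE f. f \<in> degree_part K u (alg_A K u M n) n (gen_x K u M) (i + 1) \<and>
        (\<exists>F \<in> degree_ge K u (alg_A K u M n) n (gen_x K u M) (i + 2).
           \<epsilon> (gen_x K u M j) = gen_x K u M j \<oplus>\<^bsub>alg_A K u M n\<^esub> f \<oplus>\<^bsub>alg_A K u M n\<^esub> F))"

text \<open>The derivation \<open>f\<^sub>1 \<partial>\<^sub>1 + \<dots> + f\<^sub>n \<partial>\<^sub>n\<close>.\<close>

definition der_of :: "'k ring \<Rightarrow> bool \<Rightarrow> ('k, 'a) module set \<Rightarrow> nat \<Rightarrow> (nat \<Rightarrow> 'k elem) \<Rightarrow>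
    'k elem \<Rightarrow> 'k elem" where
  "der_of K u M n f =
     (THE D. D \<in> derivations K (alg_A K u M n) \<and> (\<forall>j<n. D (gen_x K u M j) = f j))"

definition T_der :: "'k ring \<Rightarrow> bool \<Rightarrow> ('k, 'a) module set \<Rightarrow> nat \<Rightarrow> nat \<Rightarrow>
    ('k elem \<Rightarrow> 'k elem) \<Rightarrow> 'k elem \<Rightarrow> 'k elem" where
  "T_der K u M n i \<epsilon> = der_of K u M n (leading_part K u M n i \<epsilon>)"


section \<open>Divergence\<close>

definition gen_xy :: "'k ring \<Rightarrow> bool \<Rightarrow> ('k, 'a) module set \<Rightarrow> gen \<Rightarrow> 'k elem" where
  "gen_xy K u M v = term_class K u M (TVar v)"

text \<open>The elements of \<open>C\<close> that are homogeneous of degree \<open>1\<close> in the variables \<open>y\<close>.\<close>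

definition Omega :: "'k ring \<Rightarrow> bool \<Rightarrow> ('k, 'a) module set \<Rightarrow> nat \<Rightarrow> 'k elem set" where
  "Omega K u M n = weight_part K u (alg_C K u M n) (XVar ` {..<n} \<union> YVar ` {..<n}) (gen_xy K u M)
     (\<lambda>v. case v of XVar j \<Rightarrow> 0 | YVar j \<Rightarrow> 1) 1"

abbreviation Omega_mod :: "'k ring \<Rightarrow> bool \<Rightarrow> ('k, 'a) module set \<Rightarrow> nat \<Rightarrow> ('k, 'k elem) module" where
  "Omega_mod K u M n \<equiv> (alg_C K u M n)\<lparr>carrier := Omega K u M n\<rparr>"

definition endo_algebra :: "'k ring \<Rightarrow> ('k, 'w) module \<Rightarrow> ('k, 'w \<Rightarrow> 'w) module" where
  "endo_algebra K W =
    \<lparr>carrier = linear_maps K W W,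
     mult = (\<lambda>f g. compose (carrier W) f g),
     one = (\<lambda>w\<in>carrier W. w),
     zero = (\<lambda>w\<in>carrier W. \<zero>\<^bsub>W\<^esub>),
     add = (\<lambda>f g. \<lambda>w\<in>carrier W. f w \<oplus>\<^bsub>W\<^esub> g w),
     smult = (\<lambda>c f. \<lambda>w\<in>carrier W. c \<odot>\<^bsub>W\<^esub> f w)\<rparr>"

definition L_op :: "'k ring \<Rightarrow> bool \<Rightarrow> ('k, 'a) module set \<Rightarrow> nat \<Rightarrow> 'k elem \<Rightarrow>
    'k elem \<Rightarrow> 'k elem" where
  "L_op K u M n a = (\<lambda>w\<in>Omega K u M n. a \<otimes>\<^bsub>alg_C K u M n\<^esub> w)"

definition R_op :: "'k ring \<Rightarrow> bool \<Rightarrow> ('k, 'a) module set \<Rightarrow> nat \<Rightarrow> 'k elem \<Rightarrow>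
    'k elem \<Rightarrow> 'k elem" where
  "R_op K u M n a = (\<lambda>w\<in>Omega K u M n. w \<otimes>\<^bsub>alg_C K u M n\<^esub> a)"

text \<open>The algebra \<open>U(A)\<close>, which always has an identity.\<close>

definition alg_U :: "'k ring \<Rightarrow> bool \<Rightarrow> ('k, 'a) module set \<Rightarrow> nat \<Rightarrow>
    ('k, 'k elem \<Rightarrow> 'k elem) module" where
  "alg_U K u M n = (endo_algebra K (Omega_mod K u M n))
     \<lparr>carrier := gen_subalgebra K True (endo_algebra K (Omega_mod K u M n))
        (L_op K u M n ` carrier (alg_A K u M n) \<union> R_op K u M n ` carrier (alg_A K u M n))\<rparr>"

definition univ_der :: "'k ring \<Rightarrow> bool \<Rightarrow> ('k, 'a) module set \<Rightarrow> nat \<Rightarrow> 'k elem \<Rightarrow> 'k elem" where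
  "univ_der K u M n = (THE D. D \<in> linear_maps K (alg_A K u M n) (Omega_mod K u M n) \<and>
     (\<forall>j<n. D (gen_x K u M j) = gen_y K u M j) \<and>
     (\<forall>a\<in>carrier (alg_A K u M n). \<forall>b\<in>carrier (alg_A K u M n).
        D (a \<otimes>\<^bsub>alg_A K u M n\<^esub> b)
          = L_op K u M n a (D b) \<oplus>\<^bsub>alg_C K u M n\<^esub> R_op K u M n b (D a)))"

text \<open>\<open>fox_der K u M n a j\<close> is the partial derivative of \<open>a\<close> with respect to the \<open>j\<close>-th variable.\<close>

definition fox_der :: "'k ring \<Rightarrow> bool \<Rightarrow> ('k, 'a) module set \<Rightarrow> nat \<Rightarrow> 'k elem \<Rightarrow>
    nat \<Rightarrow> 'k elem \<Rightarrow> 'k elem" where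
  "fox_der K u M n a = (THE v. v \<in> {..<n} \<rightarrow>\<^sub>E carrier (alg_U K u M n) \<and>
     univ_der K u M n a = (\<Oplus>\<^bsub>alg_C K u M n\<^esub>j\<in>{..<n}. v j (gen_y K u M j)))"

definition left_ideal :: "'r set \<Rightarrow> ('r, 'm) ring_scheme \<Rightarrow> bool" where
  "left_ideal J R \<longleftrightarrow> additive_subgroup J R \<and> (\<forall>r\<in>carrier R. \<forall>a\<in>J. r \<otimes>\<^bsub>R\<^esub> a \<in> J)"

definition maximal_left_ideal :: "'r set \<Rightarrow> ('r, 'm) ring_scheme \<Rightarrow> bool" where
  "maximal_left_ideal J R \<longleftrightarrow> left_ideal J R \<and> J \<noteq> carrier R \<and>
     (\<forall>J'. left_ideal J' R \<and> J \<subseteq> J' \<and> J' \<noteq> carrier R \<longrightarrow> J' = J)"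

definition jacobson_radical :: "('r, 'm) ring_scheme \<Rightarrow> 'r set" where
  "jacobson_radical R = {a \<in> carrier R. \<forall>J. maximal_left_ideal J R \<longrightarrow> a \<in> J}"

definition commutator_span :: "'k ring \<Rightarrow> ('k, 'r) module \<Rightarrow> 'r set" where
  "commutator_span K R = lin_span K R
     {(a \<otimes>\<^bsub>R\<^esub> b) \<ominus>\<^bsub>R\<^esub> (b \<otimes>\<^bsub>R\<^esub> a) | a b. a \<in> carrier R \<and> b \<in> carrier R}"

definition div_kernel :: "'k ring \<Rightarrow> bool \<Rightarrow> ('k, 'a) module set \<Rightarrow> nat \<Rightarrow>
    ('k elem \<Rightarrow> 'k elem) set" where
  "div_kernel K u M n =
     commutator_span K (alg_U K u M n) <+>\<^bsub>alg_U K u M n\<^esub> jacobson_radical (alg_U K u M n)"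

text \<open>
  The divergence of a derivation, an element of \<open>U/([U,U] + R)\<close>, that is, a coset; the zero
  element of this quotient is the coset \<open>div_kernel K u M n\<close>.
\<close>

definition divergence :: "'k ring \<Rightarrow> bool \<Rightarrow> ('k, 'a) module set \<Rightarrow> nat \<Rightarrow>
    ('k elem \<Rightarrow> 'k elem) \<Rightarrow> ('k elem \<Rightarrow> 'k elem) set" where
  "divergence K u M n D = div_kernel K u M n +>\<^bsub>alg_U K u M n\<^esub>
     (\<Oplus>\<^bsub>alg_U K u M n\<^esub>j\<in>{..<n}. fox_der K u M n (D (gen_x K u M j)) j)"

end

theory Submission
  imports Defs
begin

text \<open>
  Let \<open>E\<close> be the Euler derivation of \<open>C\<close> for the degree in the variables \<open>x\<close>, and let
  \<open>\<delta> = [E, -]\<close> be the induced derivation of \<open>U\<close>. For a basis of the free \<open>U\<close>-module \<open>\<Omega>\<close> with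
  transition matrix \<open>P\<close> from the basis \<open>y\<close>, the trace of \<open>P\<^sup>-\<^sup>1 \<delta>(P)\<close> modulo \<open>[U,U]\<close> is additive in
  \<open>P\<close> and vanishes for elementary matrices and constant diagonal matrices.

  The images of the generators under a tame automorphism of \<open>B\<close> lift to a tuple in \<open>A\<close> obtained from
  \<open>x\<close> by elementary transformations. The universal derivation maps this tuple to a basis of \<open>\<Omega>\<close>
  reached from \<open>y\<close> by elementary basis changes, so that its logarithmic trace lies in \<open>[U,U]\<close>.
  If \<open>\<phi>\<close> is approximately tame, the tuple can be taken to be \<open>x\<^sub>j + f\<^sub>j\<close> plus terms of higher degree,
  where \<open>f\<^sub>j\<close> is the leading part of \<open>\<epsilon>(x\<^sub>j) - x\<^sub>j\<close>, since \<open>I\<close> is homogeneous and starts in degree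
  at least \<open>i + 2\<close>. The component of lowest degree of the logarithmic trace is then \<open>i\<close> times the
  divergence. As \<open>[U,U]\<close> is \<open>\<delta>\<close>-invariant, it contains this component, and the characteristic is zero.
\<close>

text \<open>Over a commutative ring the quotient of \<open>delta (det P)\<close> by
  \<open>det P\<close> is the trace of \<open>P^-1 delta(P)\<close>. The noncommutative algebra
  \<open>U\<close> offers no determinant, but this trace still makes sense modulo
  \<open>[U,U]\<close>. Hence a logarithmic derivative takes the place of a Jacobian determinant.
  Degrees are handled through eigenvalues. The graded parts are defined as spans of monomials, which
  says nothing about their independence. Independence, homogeneity of \<open>I\<close> and the
  passage to a component of lowest degree all rest on \<open>eigen_component\<close>: from a sum
  lying in an invariant subspace it isolates the eigenvector of lowest degree. It is applied to an
  endomorphism of a free algebra, to the Euler derivation of \<open>A\<close> and to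
  \<open>delta\<close> on \<open>U\<close>. Derivations need a separate argument. The universal
  property of a relatively free algebra yields homomorphisms; that the formal derivative of an
  identity is again an identity holds because characteristic zero separates the parts of different
  degree of an identity. The same fact, used for the subvariety, makes \<open>I\<close> stable under
  the Euler derivation.\<close>

definition nat_scalar :: "'k ring \<Rightarrow> nat \<Rightarrow> 'k" where
  "nat_scalar K m = [m] \<cdot>\<^bsub>K\<^esub> \<one>\<^bsub>K\<^esub>"

lemma (in cring) nat_scalar_ops:
  fixes a b m :: nat
  shows "[m] \<cdot> \<one> \<in> carrier R" "[(a + b)] \<cdot> \<one> = [a] \<cdot> \<one> \<oplus> [b] \<cdot> \<one>" "[(a * b)] \<cdot> \<one> = ([a] \<cdot> \<one>) \<otimes> ([b] \<cdot> \<one>)"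
proof -
  show "[m] \<cdot> \<one> \<in> carrier R" by simp
  show "[(a + b)] \<cdot> \<one> = [a] \<cdot> \<one> \<oplus> [b] \<cdot> \<one>" by (simp add: add.nat_pow_mult)
  have "([a] \<cdot> \<one>) \<otimes> ([b] \<cdot> \<one>) = [a] \<cdot> (\<one> \<otimes> ([b] \<cdot> \<one>))" by (rule add_pow_ldistr) auto
  also have "\<dots> = [a] \<cdot> ([b] \<cdot> \<one>)" by simp
  also have "\<dots> = [(b * a)] \<cdot> \<one>" by (rule add.nat_pow_pow) simp
  finally show "[(a * b)] \<cdot> \<one> = ([a] \<cdot> \<one>) \<otimes> ([b] \<cdot> \<one>)" by (simp add: mult.commute)
qed

lemma (in abelian_group) minus_eq_iff:
  assumes "x \<in> carrier G" "y \<in> carrier G" "z \<in> carrier G"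
  shows "x \<ominus> y = z \<longleftrightarrow> x = z \<oplus> y"
proof -
  have "x \<ominus> y \<oplus> y = x" "z \<oplus> y \<ominus> y = z"
    using assms by (simp_all add: a_minus_def a_assoc l_neg r_neg)
  thus ?thesis by metis
qed

lemma (in abelian_group) minus_eq_zero_iff:
  assumes "x \<in> carrier G" "y \<in> carrier G"
  shows "x \<ominus> y = \<zero> \<longleftrightarrow> x = y"
  using minus_eq_iff[OF assms zero_closed] assms l_zero by metis

section \<open>The integers inside a field of characteristic zero\<close>

locale char_zero_field = field K for K :: "'k ring" +
  assumes char_zero: "char_zero K"
begin

lemma nat_scalar_closed [simp]: "nat_scalar K m \<in> carrier K"
  by (simp add: nat_scalar_def)

lemma nat_scalar_0 [simp]: "nat_scalar K 0 = \<zero>\<^bsub>K\<^esub>"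
  by (simp add: nat_scalar_def)

lemma nat_scalar_1 [simp]: "nat_scalar K 1 = \<one>\<^bsub>K\<^esub>" "nat_scalar K (Suc 0) = \<one>\<^bsub>K\<^esub>"
  by (simp_all add: nat_scalar_def)

lemma nat_scalar_add: "nat_scalar K (a + b) = nat_scalar K a \<oplus>\<^bsub>K\<^esub> nat_scalar K b"
  unfolding nat_scalar_def by (rule nat_scalar_ops)

lemma nat_scalar_mult: "nat_scalar K (a * b) = nat_scalar K a \<otimes>\<^bsub>K\<^esub> nat_scalar K b"
  unfolding nat_scalar_def by (rule nat_scalar_ops)

text \<open>All uses of characteristic zero pass through here: distinct degrees give distinct
  eigenvalues, and a positive degree gives an invertible scalar. \<open>char_zero\<close> speaks
  about zero only, so for \<open>a < b\<close> the difference \<open>b - a\<close> is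
  considered.\<close>

lemma nat_scalar_inj: "nat_scalar K a = nat_scalar K b \<longleftrightarrow> a = b"
proof -
  have *: "nat_scalar K a \<noteq> nat_scalar K b" if "a < b" for a b
  proof
    assume eq: "nat_scalar K a = nat_scalar K b"
    from that obtain d where d: "b = a + d" "0 < d" by (metis less_imp_add_positive)
    have "nat_scalar K a \<oplus>\<^bsub>K\<^esub> nat_scalar K d = nat_scalar K a \<oplus>\<^bsub>K\<^esub> \<zero>\<^bsub>K\<^esub>"
      using eq d by (simp add: nat_scalar_add)
    hence "nat_scalar K d = \<zero>\<^bsub>K\<^esub>" by (metis add.r_cancel_one nat_scalar_closed zero_closed add.m_comm r_zero l_zero)
    thus False using char_zero d unfolding char_zero_def nat_scalar_def by blast
  qed
  show ?thesis using *[of a b] *[of b a] by (metis linorder_neqE_nat)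
qed

lemma inverse_ex:
  assumes "c \<in> carrier K" "c \<noteq> \<zero>\<^bsub>K\<^esub>"
  obtains d where "d \<in> carrier K" "d \<noteq> \<zero>\<^bsub>K\<^esub>" "d \<otimes>\<^bsub>K\<^esub> c = \<one>\<^bsub>K\<^esub>" "c \<otimes>\<^bsub>K\<^esub> d = \<one>\<^bsub>K\<^esub>"
proof
  have "c \<in> Units K" using assms field_Units by blast
  thus "inv\<^bsub>K\<^esub> c \<in> carrier K" "inv\<^bsub>K\<^esub> c \<otimes>\<^bsub>K\<^esub> c = \<one>\<^bsub>K\<^esub>" "c \<otimes>\<^bsub>K\<^esub> inv\<^bsub>K\<^esub> c = \<one>\<^bsub>K\<^esub>" by auto
  thus "inv\<^bsub>K\<^esub> c \<noteq> \<zero>\<^bsub>K\<^esub>" using assms by fastforce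
qed

end

section \<open>Linear spans and eigenvectors\<close>

locale lin_space = module K W for K :: "'k ring" and W :: "('k, 'a) module"
begin

lemma minus_eq_smult: "x \<in> carrier W \<Longrightarrow> \<ominus>\<^bsub>W\<^esub> x = (\<ominus>\<^bsub>K\<^esub> \<one>\<^bsub>K\<^esub>) \<odot>\<^bsub>W\<^esub> x"
  by (simp add: smult_l_minus)

text \<open>Negation is multiplication by the scalar -1, so closure under it follows from closure
  under scalars.\<close>

lemma submodule_criterion:
  assumes "H \<subseteq> carrier W" "\<zero>\<^bsub>W\<^esub> \<in> H" "\<And>a b. \<lbrakk>a \<in> H; b \<in> H\<rbrakk> \<Longrightarrow> a \<oplus>\<^bsub>W\<^esub> b \<in> H"
    "\<And>c x. \<lbrakk>c \<in> carrier K; x \<in> H\<rbrakk> \<Longrightarrow> c \<odot>\<^bsub>W\<^esub> x \<in> H"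
  shows "submodule H K W"
  using assms minus_eq_smult by (intro submoduleI) (auto simp: subset_iff)

lemma submodule_zero: "submodule H K W \<Longrightarrow> \<zero>\<^bsub>W\<^esub> \<in> H"
  by (metis submoduleE(1,2,3,5) all_not_in_conv r_neg subsetD)

lemma submodule_minus_closed:
  assumes "submodule H K W" "a \<in> H" "b \<in> H" shows "a \<ominus>\<^bsub>W\<^esub> b \<in> H"
  using submoduleE[OF assms(1)] assms(2,3) by (simp add: a_minus_def)

lemma submodule_Inter:
  assumes "\<And>H. H \<in> \<H> \<Longrightarrow> submodule H K W" "\<H> \<noteq> {}"
  shows "submodule (\<Inter>\<H>) K W"
proof (rule submodule_criterion)
  obtain H where H: "H \<in> \<H>" using assms(2) by auto
  from H have "\<Inter>\<H> \<subseteq> H" by auto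
  with submoduleE(1)[OF assms(1)[OF H]] show "\<Inter>\<H> \<subseteq> carrier W" by (rule order_trans[rotated])
  show "\<zero>\<^bsub>W\<^esub> \<in> \<Inter>\<H>" by (intro InterI submodule_zero assms(1))
  show "a \<oplus>\<^bsub>W\<^esub> b \<in> \<Inter>\<H>" if "a \<in> \<Inter>\<H>" "b \<in> \<Inter>\<H>" for a b
    using that by (intro InterI submoduleE(5)[OF assms(1)]) auto
  show "c \<odot>\<^bsub>W\<^esub> x \<in> \<Inter>\<H>" if "c \<in> carrier K" "x \<in> \<Inter>\<H>" for c x
    using that by (intro InterI submoduleE(4)[OF assms(1)]) auto
qed

lemma lin_span_submodule:
  assumes "S \<subseteq> carrier W" shows "submodule (lin_span K W S) K W"
  unfolding lin_span_def using assms carrier_is_submodule by (intro submodule_Inter) blast+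

lemma lin_span_incl: "x \<in> S \<Longrightarrow> x \<in> lin_span K W S"
  unfolding lin_span_def by auto

lemma lin_span_minimal: "\<lbrakk>submodule H K W; S \<subseteq> H\<rbrakk> \<Longrightarrow> lin_span K W S \<subseteq> H"
  unfolding lin_span_def by auto

lemma lin_span_carrier: "S \<subseteq> carrier W \<Longrightarrow> lin_span K W S \<subseteq> carrier W"
  by (rule lin_span_minimal[OF carrier_is_submodule])

lemma lin_span_mono:
  assumes "S \<subseteq> lin_span K W T" "T \<subseteq> carrier W" shows "lin_span K W S \<subseteq> lin_span K W T"
  using assms lin_span_submodule lin_span_minimal by blast

lemma lin_span_induct [consumes 2, case_names base zero add smult]:
  assumes "x \<in> lin_span K W S" "S \<subseteq> carrier W" "\<And>x. x \<in> S \<Longrightarrow> P x" "P \<zero>\<^bsub>W\<^esub>"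
    "\<And>x y. \<lbrakk>x \<in> carrier W; y \<in> carrier W; P x; P y\<rbrakk> \<Longrightarrow> P (x \<oplus>\<^bsub>W\<^esub> y)"
    "\<And>c x. \<lbrakk>c \<in> carrier K; x \<in> carrier W; P x\<rbrakk> \<Longrightarrow> P (c \<odot>\<^bsub>W\<^esub> x)"
  shows "P x"
proof -
  have "submodule {x \<in> carrier W. P x} K W"
    by (rule submodule_criterion) (use assms in auto)
  from lin_span_minimal[OF this, of S] assms show ?thesis by blast
qed

lemma submodule_sum:
  assumes "submodule H K W" "submodule J K W"
  shows "submodule {a \<oplus>\<^bsub>W\<^esub> b | a b. a \<in> H \<and> b \<in> J} K W"
proof (rule submodule_criterion)
  note H = submoduleE[OF assms(1)] note J = submoduleE[OF assms(2)]
  show "{a \<oplus>\<^bsub>W\<^esub> b | a b. a \<in> H \<and> b \<in> J} \<subseteq> carrier W" using H(1) J(1) by auto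
  have "\<zero>\<^bsub>W\<^esub> = \<zero>\<^bsub>W\<^esub> \<oplus>\<^bsub>W\<^esub> \<zero>\<^bsub>W\<^esub>" by simp
  thus "\<zero>\<^bsub>W\<^esub> \<in> {a \<oplus>\<^bsub>W\<^esub> b | a b. a \<in> H \<and> b \<in> J}"
    using submodule_zero[OF assms(1)] submodule_zero[OF assms(2)] by blast
next
  note H = submoduleE[OF assms(1)] note J = submoduleE[OF assms(2)]
  fix x y assume "x \<in> {a \<oplus>\<^bsub>W\<^esub> b | a b. a \<in> H \<and> b \<in> J}" "y \<in> {a \<oplus>\<^bsub>W\<^esub> b | a b. a \<in> H \<and> b \<in> J}"
  then obtain a b a' b' where *: "a \<in> H" "b \<in> J" "x = a \<oplus>\<^bsub>W\<^esub> b" "a' \<in> H" "b' \<in> J" "y = a' \<oplus>\<^bsub>W\<^esub> b'"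
    by blast
  have "a \<in> carrier W" "b \<in> carrier W" "a' \<in> carrier W" "b' \<in> carrier W" using * H(1) J(1) by auto
  hence "x \<oplus>\<^bsub>W\<^esub> y = (a \<oplus>\<^bsub>W\<^esub> a') \<oplus>\<^bsub>W\<^esub> (b \<oplus>\<^bsub>W\<^esub> b')"
    using * by (simp add: M.a_ac)
  moreover have "a \<oplus>\<^bsub>W\<^esub> a' \<in> H" "b \<oplus>\<^bsub>W\<^esub> b' \<in> J" using * H(5) J(5) by auto
  ultimately show "x \<oplus>\<^bsub>W\<^esub> y \<in> {a \<oplus>\<^bsub>W\<^esub> b | a b. a \<in> H \<and> b \<in> J}" by blast
next
  note H = submoduleE[OF assms(1)] note J = submoduleE[OF assms(2)]
  fix c x assume c: "c \<in> carrier K" and "x \<in> {a \<oplus>\<^bsub>W\<^esub> b | a b. a \<in> H \<and> b \<in> J}"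
  then obtain a b where *: "a \<in> H" "b \<in> J" "x = a \<oplus>\<^bsub>W\<^esub> b" by blast
  hence "a \<in> carrier W" "b \<in> carrier W" using H(1) J(1) by auto
  hence "c \<odot>\<^bsub>W\<^esub> x = c \<odot>\<^bsub>W\<^esub> a \<oplus>\<^bsub>W\<^esub> c \<odot>\<^bsub>W\<^esub> b" using * c by (simp add: smult_r_distr)
  moreover have "c \<odot>\<^bsub>W\<^esub> a \<in> H" "c \<odot>\<^bsub>W\<^esub> b \<in> J" using * H(4) J(4) c by auto
  ultimately show "c \<odot>\<^bsub>W\<^esub> x \<in> {a \<oplus>\<^bsub>W\<^esub> b | a b. a \<in> H \<and> b \<in> J}" by blast
qed

lemma lin_span_Un:
  assumes "S \<subseteq> carrier W" "T \<subseteq> carrier W" "x \<in> lin_span K W (S \<union> T)"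
  obtains a b where "a \<in> lin_span K W S" "b \<in> lin_span K W T" "x = a \<oplus>\<^bsub>W\<^esub> b"
proof -
  define H where "H = {a \<oplus>\<^bsub>W\<^esub> b | a b. a \<in> lin_span K W S \<and> b \<in> lin_span K W T}"
  have HI: "a \<oplus>\<^bsub>W\<^esub> b \<in> H" if "a \<in> lin_span K W S" "b \<in> lin_span K W T" for a b
    using that unfolding H_def by auto
  have z: "\<zero>\<^bsub>W\<^esub> \<in> lin_span K W S" "\<zero>\<^bsub>W\<^esub> \<in> lin_span K W T"
    using assms(1,2) submodule_zero lin_span_submodule by auto
  have "s \<in> H" if "s \<in> S" for s
    using HI[OF lin_span_incl[OF that] z(2)] that assms(1) by (simp add: subset_iff)
  moreover have "t \<in> H" if "t \<in> T" for t
    using HI[OF z(1) lin_span_incl[OF that]] that assms(2) by (simp add: subset_iff)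
  ultimately have "S \<union> T \<subseteq> H" by auto
  moreover have "submodule H K W" unfolding H_def
    by (rule submodule_sum[OF lin_span_submodule[OF assms(1)] lin_span_submodule[OF assms(2)]])
  ultimately have "x \<in> H" using assms(3) lin_span_minimal[of H "S \<union> T"] by auto
  thus ?thesis using that unfolding H_def by auto
qed

end

text \<open>Linearity without the extensionality that \<open>linear_maps\<close> demands. One
  function, such as the Euler derivation of \<open>C\<close>, can then be treated as a linear map of
  \<open>C\<close> and of \<open>A\<close> without being restricted anew.\<close>

definition linear_on :: "'k ring \<Rightarrow> ('k, 'a) module \<Rightarrow> ('k, 'b) module \<Rightarrow> ('a \<Rightarrow> 'b) \<Rightarrow> bool" where
  "linear_on K A B h \<longleftrightarrow> h \<in> carrier A \<rightarrow> carrier B \<and>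
     (\<forall>a\<in>carrier A. \<forall>b\<in>carrier A. h (a \<oplus>\<^bsub>A\<^esub> b) = h a \<oplus>\<^bsub>B\<^esub> h b) \<and>
     (\<forall>c\<in>carrier K. \<forall>a\<in>carrier A. h (c \<odot>\<^bsub>A\<^esub> a) = c \<odot>\<^bsub>B\<^esub> h a)"

lemma linear_onD:
  assumes "linear_on K A B h"
  shows "a \<in> carrier A \<Longrightarrow> h a \<in> carrier B"
    "\<lbrakk>a \<in> carrier A; b \<in> carrier A\<rbrakk> \<Longrightarrow> h (a \<oplus>\<^bsub>A\<^esub> b) = h a \<oplus>\<^bsub>B\<^esub> h b"
    "\<lbrakk>c \<in> carrier K; a \<in> carrier A\<rbrakk> \<Longrightarrow> h (c \<odot>\<^bsub>A\<^esub> a) = c \<odot>\<^bsub>B\<^esub> h a"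
  using assms unfolding linear_on_def by auto

lemma linear_on_iff: "h \<in> linear_maps K A B \<longleftrightarrow> linear_on K A B h \<and> h \<in> extensional (carrier A)"
  unfolding linear_maps_def linear_on_def PiE_def by blast

lemma linear_mapsD:
  assumes "h \<in> linear_maps K A B"
  shows "a \<in> carrier A \<Longrightarrow> h a \<in> carrier B"
    "\<lbrakk>a \<in> carrier A; b \<in> carrier A\<rbrakk> \<Longrightarrow> h (a \<oplus>\<^bsub>A\<^esub> b) = h a \<oplus>\<^bsub>B\<^esub> h b"
    "\<lbrakk>c \<in> carrier K; a \<in> carrier A\<rbrakk> \<Longrightarrow> h (c \<odot>\<^bsub>A\<^esub> a) = c \<odot>\<^bsub>B\<^esub> h a"
    "h \<in> extensional (carrier A)"
  using assms unfolding linear_maps_def PiE_def by auto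

lemma linear_on_zero:
  assumes "module K A" "module K B" "linear_on K A B h"
  shows "h \<zero>\<^bsub>A\<^esub> = \<zero>\<^bsub>B\<^esub>"
proof -
  interpret A: module K A by fact
  interpret B: module K B by fact
  have "h \<zero>\<^bsub>A\<^esub> = h (\<zero>\<^bsub>K\<^esub> \<odot>\<^bsub>A\<^esub> \<zero>\<^bsub>A\<^esub>)" by simp
  also have "\<dots> = \<zero>\<^bsub>B\<^esub>" using linear_onD[OF assms(3)] by (metis A.R.zero_closed A.M.zero_closed B.smult_l_null)
  finally show ?thesis .
qed

lemma linear_on_uminus:
  assumes "module K A" "module K B" "linear_on K A B h" "a \<in> carrier A"
  shows "h (\<ominus>\<^bsub>A\<^esub> a) = \<ominus>\<^bsub>B\<^esub> h a"
proof -
  interpret A: lin_space K A using assms by (simp add: lin_space_def)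
  interpret B: lin_space K B using assms by (simp add: lin_space_def)
  show ?thesis using linear_onD[OF assms(3)] assms(4) A.minus_eq_smult B.minus_eq_smult by simp
qed

lemma linear_on_minus:
  assumes "module K A" "module K B" "linear_on K A B h" "a \<in> carrier A" "b \<in> carrier A"
  shows "h (a \<ominus>\<^bsub>A\<^esub> b) = h a \<ominus>\<^bsub>B\<^esub> h b"
proof -
  interpret A: module K A by fact
  interpret B: module K B by fact
  show ?thesis using linear_onD[OF assms(3)] linear_on_uminus[OF assms(1-3)] assms(4,5)
    by (simp add: a_minus_def)
qed

lemma linear_on_finsum:
  assumes "module K A" "module K B" "linear_on K A B h" "finite I" "f \<in> I \<rightarrow> carrier A"
  shows "h (\<Oplus>\<^bsub>A\<^esub>i\<in>I. f i) = (\<Oplus>\<^bsub>B\<^esub>i\<in>I. h (f i))"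
proof -
  interpret A: module K A by fact
  interpret B: module K B by fact
  show ?thesis using assms(4,5)
  proof (induction I)
    case empty
    then show ?case using linear_on_zero[OF assms(1-3)] by simp
  next
    case (insert x F)
    have f: "\<And>i. i \<in> F \<Longrightarrow> f i \<in> carrier A" using insert by auto
    have "(\<lambda>i. h (f i)) \<in> F \<rightarrow> carrier B" "h (f x) \<in> carrier B"
      using insert linear_onD(1)[OF assms(3)] f by auto
    then show ?case using insert linear_onD[OF assms(3)] by (simp add: Pi_iff)
  qed
qed

text \<open>A descending filtration in which degree k means eigenvalue \<open>lam k\<close>. It
  serves for a substitution endomorphism with \<open>lam k\<close> equal to the k-th power of 2 and,
  with \<open>lam k\<close> equal to k, for the Euler derivation on \<open>A\<close> and for
  \<open>delta\<close> on \<open>U\<close>.\<close>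

definition eig_span :: "'k ring \<Rightarrow> ('k, 'a) module \<Rightarrow> ('a \<Rightarrow> 'a) \<Rightarrow> (nat \<Rightarrow> 'k) \<Rightarrow> nat \<Rightarrow> 'a set" where
  "eig_span K W T lam m = lin_span K W {w \<in> carrier W. \<exists>k\<ge>m. T w = lam k \<odot>\<^bsub>W\<^esub> w}"

text \<open>Applying \<open>(T - lam (i+1)) \<dots> (T - lam d)\<close> kills the higher components and multiplies
  the component of eigenvalue \<open>lam i\<close> by a nonzero scalar.\<close>

lemma eigen_component:
  fixes K :: "'k ring" and W :: "('k, 'a) module" and lam :: "nat \<Rightarrow> 'k"
  assumes W: "module K W" and K: "char_zero_field K" and T: "linear_on K W W T"
    and lam: "\<And>k. lam k \<in> carrier K" and dist: "\<And>k. k > i \<Longrightarrow> lam k \<noteq> lam i"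
    and S: "submodule S K W" and TS: "\<And>s. s \<in> S \<Longrightarrow> T s \<in> S"
    and v: "v \<in> carrier W" "T v = lam i \<odot>\<^bsub>W\<^esub> v"
    and v': "v' \<in> eig_span K W T lam (Suc i)"
    and sum: "v \<oplus>\<^bsub>W\<^esub> v' \<in> S"
  shows "v \<in> S"
proof -
  interpret W: lin_space K W using W by (simp add: lin_space_def)
  interpret K: char_zero_field K by fact
  define g where "g = rec_nat (\<lambda>w. w) (\<lambda>d f w. T (f w) \<ominus>\<^bsub>W\<^esub> lam (Suc (i + d)) \<odot>\<^bsub>W\<^esub> f w)"
  have g0: "g 0 w = w" and gS: "g (Suc d) w = T (g d w) \<ominus>\<^bsub>W\<^esub> lam (Suc (i + d)) \<odot>\<^bsub>W\<^esub> g d w" for w d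
    by (simp_all add: g_def)
  note Tl = linear_onD[OF T]
  have gc: "g d w \<in> carrier W" if "w \<in> carrier W" for d w
    by (induction d) (use that Tl lam in \<open>auto simp: g0 gS\<close>)
  have gadd: "g d (a \<oplus>\<^bsub>W\<^esub> b) = g d a \<oplus>\<^bsub>W\<^esub> g d b" if "a \<in> carrier W" "b \<in> carrier W" for a b d
  proof (induction d)
    case (Suc d)
    show ?case using that lam Tl gc Suc
      by (simp add: gS a_minus_def W.smult_r_distr W.minus_add W.a_ac)
  qed (simp add: g0)
  have gsm: "g d (c \<odot>\<^bsub>W\<^esub> a) = c \<odot>\<^bsub>W\<^esub> g d a" if "a \<in> carrier W" "c \<in> carrier K" for a c d
  proof (induction d)
    case (Suc d)
    have "lam (Suc (i + d)) \<odot>\<^bsub>W\<^esub> (c \<odot>\<^bsub>W\<^esub> g d a) = c \<odot>\<^bsub>W\<^esub> (lam (Suc (i + d)) \<odot>\<^bsub>W\<^esub> g d a)"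
      using that lam gc by (metis W.smult_assoc1 W.R.m_comm)
    then show ?case using that lam Tl gc Suc
      by (simp add: gS a_minus_def W.smult_r_distr W.smult_r_minus)
  qed (simp add: g0)
  have gSin: "g d s \<in> S" if "s \<in> S" for s d
  proof (induction d)
    case (Suc d)
    then show ?case using TS W.submoduleE(4)[OF S lam] W.submodule_minus_closed[OF S] by (simp add: gS)
  qed (simp add: g0 that)
  \<comment> \<open>On an eigenvector of index k the map \<open>g d\<close> is a scalar, the product
    of all \<open>lam k - lam (i + j + 1)\<close> with j < d. The clause on vanishing disposes of
    \<open>v'\<close>, the clause on not vanishing keeps \<open>v\<close>.\<close>
  have geig: "\<exists>c\<in>carrier K. g d w = c \<odot>\<^bsub>W\<^esub> w \<and> ((\<forall>j<d. lam k \<noteq> lam (Suc (i + j))) \<longrightarrow> c \<noteq> \<zero>\<^bsub>K\<^esub>)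
      \<and> ((\<exists>j<d. k = Suc (i + j)) \<longrightarrow> c = \<zero>\<^bsub>K\<^esub>)"
    if w: "w \<in> carrier W" "T w = lam k \<odot>\<^bsub>W\<^esub> w" for w k d
  proof (induction d)
    case 0
    show ?case using w by (intro bexI[of _ "\<one>\<^bsub>K\<^esub>"]) (auto simp: g0)
  next
    case (Suc d)
    then obtain c where c: "c \<in> carrier K" "g d w = c \<odot>\<^bsub>W\<^esub> w"
      "(\<forall>j<d. lam k \<noteq> lam (Suc (i + j))) \<Longrightarrow> c \<noteq> \<zero>\<^bsub>K\<^esub>"
      "(\<exists>j<d. k = Suc (i + j)) \<Longrightarrow> c = \<zero>\<^bsub>K\<^esub>" by auto
    let ?c = "c \<otimes>\<^bsub>K\<^esub> (lam k \<ominus>\<^bsub>K\<^esub> lam (Suc (i + d)))"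
    have cl: "?c \<in> carrier K" using c lam by auto
    have "g (Suc d) w = c \<odot>\<^bsub>W\<^esub> (lam k \<odot>\<^bsub>W\<^esub> w) \<ominus>\<^bsub>W\<^esub> lam (Suc (i + d)) \<odot>\<^bsub>W\<^esub> (c \<odot>\<^bsub>W\<^esub> w)"
      using c w by (simp add: gS Tl)
    also have "lam (Suc (i + d)) \<odot>\<^bsub>W\<^esub> (c \<odot>\<^bsub>W\<^esub> w) = c \<odot>\<^bsub>W\<^esub> (lam (Suc (i + d)) \<odot>\<^bsub>W\<^esub> w)"
      using w(1) c(1) lam by (metis W.smult_assoc1 W.R.m_comm)
    also have "c \<odot>\<^bsub>W\<^esub> (lam k \<odot>\<^bsub>W\<^esub> w) \<ominus>\<^bsub>W\<^esub> c \<odot>\<^bsub>W\<^esub> (lam (Suc (i + d)) \<odot>\<^bsub>W\<^esub> w) = ?c \<odot>\<^bsub>W\<^esub> w"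
      using w(1) c(1) lam
      by (simp add: a_minus_def W.smult_assoc1 W.smult_l_distr W.smult_r_distr W.smult_l_minus W.smult_r_minus)
    finally have eq: "g (Suc d) w = ?c \<odot>\<^bsub>W\<^esub> w" .
    have "?c \<noteq> \<zero>\<^bsub>K\<^esub>" if h: "\<forall>j<Suc d. lam k \<noteq> lam (Suc (i + j))"
    proof -
      have "lam k \<ominus>\<^bsub>K\<^esub> lam (Suc (i + d)) \<noteq> \<zero>\<^bsub>K\<^esub>"
        using h lam W.R.minus_eq_zero_iff[of "lam k" "lam (Suc (i + d))"] by (meson lessI)
      moreover have "c \<noteq> \<zero>\<^bsub>K\<^esub>" using h c(3) by auto
      ultimately show ?thesis using c(1) lam K.integral by blast
    qed
    moreover have "?c = \<zero>\<^bsub>K\<^esub>" if h: "\<exists>j<Suc d. k = Suc (i + j)"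
    proof (cases "k = Suc (i + d)")
      case True thus ?thesis using lam c by (simp add: a_minus_def W.R.r_neg)
    next
      case False
      hence "c = \<zero>\<^bsub>K\<^esub>" using c(4) h less_Suc_eq by blast
      thus ?thesis using lam by simp
    qed
    ultimately show ?case using eq cl by blast
  qed
  have sub: "{w \<in> carrier W. \<exists>k\<ge>Suc i. T w = lam k \<odot>\<^bsub>W\<^esub> w} \<subseteq> carrier W" by auto
  \<comment> \<open>How many factors are needed depends on the vector. Asking for vanishing at all
    large d makes the property stable under sums, where the maximum of two bounds is taken.\<close>
  have "\<exists>d0. \<forall>d\<ge>d0. g d v' = \<zero>\<^bsub>W\<^esub>" using v' sub unfolding eig_span_def
  proof (induction rule: W.lin_span_induct)
    case (base w)
    then obtain k where k: "w \<in> carrier W" "k \<ge> Suc i" "T w = lam k \<odot>\<^bsub>W\<^esub> w" by auto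
    have "g d w = \<zero>\<^bsub>W\<^esub>" if "d \<ge> Suc (k - Suc i)" for d
    proof -
      have "\<exists>j<d. k = Suc (i + j)" by (rule exI[of _ "k - Suc i"]) (use k that in auto)
      thus ?thesis using geig[OF k(1,3), of d] k(1) by auto
    qed
    thus ?case by blast
  next
    case zero
    have "g d \<zero>\<^bsub>W\<^esub> = \<zero>\<^bsub>W\<^esub>" for d using gsm[of "\<zero>\<^bsub>W\<^esub>" "\<zero>\<^bsub>K\<^esub>" d] gc[of "\<zero>\<^bsub>W\<^esub>" d] by simp
    thus ?case by blast
  next
    case (add x y)
    then obtain d1 d2 where "\<forall>d\<ge>d1. g d x = \<zero>\<^bsub>W\<^esub>" "\<forall>d\<ge>d2. g d y = \<zero>\<^bsub>W\<^esub>" by blast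
    hence "\<forall>d\<ge>max d1 d2. g d (x \<oplus>\<^bsub>W\<^esub> y) = \<zero>\<^bsub>W\<^esub>" using add gadd by simp
    thus ?case by blast
  next
    case (smult c x)
    then obtain d0 where "\<forall>d\<ge>d0. g d x = \<zero>\<^bsub>W\<^esub>" by blast
    hence "\<forall>d\<ge>d0. g d (c \<odot>\<^bsub>W\<^esub> x) = \<zero>\<^bsub>W\<^esub>" using smult gsm by simp
    thus ?case by blast
  qed
  then obtain d where d: "g d v' = \<zero>\<^bsub>W\<^esub>" by blast
  have v'c: "v' \<in> carrier W" using v' W.lin_span_carrier[OF sub] unfolding eig_span_def by blast
  obtain c where c: "c \<in> carrier K" "g d v = c \<odot>\<^bsub>W\<^esub> v" "c \<noteq> \<zero>\<^bsub>K\<^esub>"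
    using geig[OF v, of d] dist by (metis less_add_Suc1)
  have "g d (v \<oplus>\<^bsub>W\<^esub> v') = c \<odot>\<^bsub>W\<^esub> v" using gadd[OF v(1) v'c] d c v by simp
  hence "c \<odot>\<^bsub>W\<^esub> v \<in> S" using gSin[OF sum] by metis
  moreover obtain e where e: "e \<in> carrier K" "e \<otimes>\<^bsub>K\<^esub> c = \<one>\<^bsub>K\<^esub>" using K.inverse_ex[OF c(1,3)] by blast
  ultimately have "e \<odot>\<^bsub>W\<^esub> (c \<odot>\<^bsub>W\<^esub> v) \<in> S" using W.submoduleE(4)[OF S] by blast
  thus ?thesis using e c v by (metis W.smult_assoc1 W.smult_one)
qed

section \<open>Nonassociative algebras\<close>

lemma (in abelian_group) minus_add_minus:
  "\<lbrakk>x \<in> carrier G; y \<in> carrier G; z \<in> carrier G\<rbrakk> \<Longrightarrow> (x \<ominus> y) \<oplus> (y \<ominus> z) = x \<ominus> z"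
  by (simp add: a_minus_def a_assoc r_neg1)

sublocale nonassoc_algebra \<subseteq> lin_space K A by unfold_locales

definition mult_on :: "('k, 'a) module \<Rightarrow> ('k, 'b) module \<Rightarrow> ('a \<Rightarrow> 'b) \<Rightarrow> bool" where
  "mult_on A B h \<longleftrightarrow> (\<forall>a\<in>carrier A. \<forall>b\<in>carrier A. h (a \<otimes>\<^bsub>A\<^esub> b) = h a \<otimes>\<^bsub>B\<^esub> h b)"

definition leibniz_on :: "('k, 'a) module \<Rightarrow> ('a \<Rightarrow> 'a) \<Rightarrow> bool" where
  "leibniz_on A D \<longleftrightarrow> (\<forall>a\<in>carrier A. \<forall>b\<in>carrier A.
     D (a \<otimes>\<^bsub>A\<^esub> b) = (D a \<otimes>\<^bsub>A\<^esub> b) \<oplus>\<^bsub>A\<^esub> (a \<otimes>\<^bsub>A\<^esub> D b))"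

lemma alg_hom_iff: "h \<in> alg_hom K u A B \<longleftrightarrow>
   linear_on K A B h \<and> mult_on A B h \<and> (u \<longrightarrow> h \<one>\<^bsub>A\<^esub> = \<one>\<^bsub>B\<^esub>) \<and> h \<in> extensional (carrier A)"
  unfolding alg_hom_def linear_on_iff mult_on_def by auto

lemma derivations_iff: "D \<in> derivations K A \<longleftrightarrow>
   linear_on K A A D \<and> leibniz_on A D \<and> D \<in> extensional (carrier A)"
  unfolding derivations_def linear_on_iff leibniz_on_def by auto

lemma mult_onD: "\<lbrakk>mult_on A B h; a \<in> carrier A; b \<in> carrier A\<rbrakk> \<Longrightarrow> h (a \<otimes>\<^bsub>A\<^esub> b) = h a \<otimes>\<^bsub>B\<^esub> h b"
  unfolding mult_on_def by auto

lemma leibniz_onD: "\<lbrakk>leibniz_on A D; a \<in> carrier A; b \<in> carrier A\<rbrakk>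
    \<Longrightarrow> D (a \<otimes>\<^bsub>A\<^esub> b) = (D a \<otimes>\<^bsub>A\<^esub> b) \<oplus>\<^bsub>A\<^esub> (a \<otimes>\<^bsub>A\<^esub> D b)"
  unfolding leibniz_on_def by auto

lemma terms_simps [simp]:
  "TVar x \<in> terms K u X \<longleftrightarrow> x \<in> X"
  "TZero \<in> terms K u X"
  "TOne \<in> terms K u X \<longleftrightarrow> u"
  "TAdd s t \<in> terms K u X \<longleftrightarrow> s \<in> terms K u X \<and> t \<in> terms K u X"
  "TScale c t \<in> terms K u X \<longleftrightarrow> c \<in> carrier K \<and> t \<in> terms K u X"
  "TMult s t \<in> terms K u X \<longleftrightarrow> s \<in> terms K u X \<and> t \<in> terms K u X"
  by (auto intro: terms.intros elim: terms.cases)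

lemma terms_mono: "X \<subseteq> Y \<Longrightarrow> terms K u X \<subseteq> terms K u Y"
proof
  fix t assume XY: "X \<subseteq> Y" and "t \<in> terms K u X"
  from this(2) show "t \<in> terms K u Y" by (induction) (use XY in auto)
qed

context nonassoc_algebra
begin

lemma l_zero_mult [simp]: "x \<in> carrier A \<Longrightarrow> \<zero>\<^bsub>A\<^esub> \<otimes>\<^bsub>A\<^esub> x = \<zero>\<^bsub>A\<^esub>"
  using smult_l[of "\<zero>\<^bsub>K\<^esub>" "\<zero>\<^bsub>A\<^esub>" x] m_closed by simp

lemma r_zero_mult [simp]: "x \<in> carrier A \<Longrightarrow> x \<otimes>\<^bsub>A\<^esub> \<zero>\<^bsub>A\<^esub> = \<zero>\<^bsub>A\<^esub>"
  using smult_r[of "\<zero>\<^bsub>K\<^esub>" x "\<zero>\<^bsub>A\<^esub>"] m_closed by simp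

lemma minus_mult:
  assumes "x \<in> carrier A" "y \<in> carrier A"
  shows "(\<ominus>\<^bsub>A\<^esub> x) \<otimes>\<^bsub>A\<^esub> y = \<ominus>\<^bsub>A\<^esub> (x \<otimes>\<^bsub>A\<^esub> y)" "x \<otimes>\<^bsub>A\<^esub> (\<ominus>\<^bsub>A\<^esub> y) = \<ominus>\<^bsub>A\<^esub> (x \<otimes>\<^bsub>A\<^esub> y)"
  using assms m_closed by (simp_all add: minus_eq_smult smult_l smult_r)

lemma teval_closed:
  assumes "t \<in> terms K u X" "u \<Longrightarrow> has_identity A" "\<And>x. x \<in> X \<Longrightarrow> g x \<in> carrier A"
  shows "teval A g t \<in> carrier A"
  using assms(1) by induction (use assms m_closed in \<open>auto simp: has_identity_def\<close>)

lemma lin_span_mult: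
  assumes "a \<in> lin_span K A S" "b \<in> lin_span K A T" "S \<subseteq> carrier A" "T \<subseteq> carrier A" "R \<subseteq> carrier A"
    and ST: "\<And>s t. \<lbrakk>s \<in> S; t \<in> T\<rbrakk> \<Longrightarrow> s \<otimes>\<^bsub>A\<^esub> t \<in> lin_span K A R"
  shows "a \<otimes>\<^bsub>A\<^esub> b \<in> lin_span K A R"
proof -
  note R = submoduleE[OF lin_span_submodule[OF assms(5)]] submodule_zero[OF lin_span_submodule[OF assms(5)]]
  have 1: "s \<otimes>\<^bsub>A\<^esub> b \<in> lin_span K A R" if "s \<in> S" for s
    using assms(2,4)
  proof (induction rule: lin_span_induct)
    case zero
    have "s \<otimes>\<^bsub>A\<^esub> \<zero>\<^bsub>A\<^esub> = \<zero>\<^bsub>A\<^esub>" using that assms(3) by auto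
    then show ?case using R by simp
  next
    case (add x y)
    have "s \<otimes>\<^bsub>A\<^esub> (x \<oplus>\<^bsub>A\<^esub> y) = s \<otimes>\<^bsub>A\<^esub> x \<oplus>\<^bsub>A\<^esub> s \<otimes>\<^bsub>A\<^esub> y" using add that assms(3) r_distr by auto
    then show ?case using R add by simp
  next
    case (smult c x)
    have "s \<otimes>\<^bsub>A\<^esub> (c \<odot>\<^bsub>A\<^esub> x) = c \<odot>\<^bsub>A\<^esub> (s \<otimes>\<^bsub>A\<^esub> x)" using smult that assms(3) smult_r by auto
    then show ?case using R smult by simp
  qed (use ST that in auto)
  have b: "b \<in> carrier A" using assms(2) lin_span_carrier[OF assms(4)] by auto
  show ?thesis using assms(1,3)
  proof (induction rule: lin_span_induct)
    case zero
    then show ?case using R b by simp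
  next
    case (add x y)
    have "(x \<oplus>\<^bsub>A\<^esub> y) \<otimes>\<^bsub>A\<^esub> b = x \<otimes>\<^bsub>A\<^esub> b \<oplus>\<^bsub>A\<^esub> y \<otimes>\<^bsub>A\<^esub> b" using add b l_distr by auto
    then show ?case using R add by simp
  next
    case (smult c x)
    have "(c \<odot>\<^bsub>A\<^esub> x) \<otimes>\<^bsub>A\<^esub> b = c \<odot>\<^bsub>A\<^esub> (x \<otimes>\<^bsub>A\<^esub> b)" using smult b smult_l by auto
    then show ?case using R smult by simp
  qed (use 1 in auto)
qed

text \<open>The assumption on T fits two situations: a derivation, where \<open>lam\<close> turns
  sums of indices into sums of scalars, and an endomorphism, where it turns them into
  products.\<close>

lemma eig_span_mult:
  assumes "a \<in> eig_span K A T lam j" "b \<in> eig_span K A T lam k"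
    and T: "\<And>a b j k. \<lbrakk>a \<in> carrier A; b \<in> carrier A; T a = lam j \<odot>\<^bsub>A\<^esub> a; T b = lam k \<odot>\<^bsub>A\<^esub> b\<rbrakk>
        \<Longrightarrow> T (a \<otimes>\<^bsub>A\<^esub> b) = lam (j + k) \<odot>\<^bsub>A\<^esub> (a \<otimes>\<^bsub>A\<^esub> b)"
  shows "a \<otimes>\<^bsub>A\<^esub> b \<in> eig_span K A T lam (j + k)"
  using assms(1,2) unfolding eig_span_def
proof (rule lin_span_mult)
  fix s t assume "s \<in> {w \<in> carrier A. \<exists>k\<ge>j. T w = lam k \<odot>\<^bsub>A\<^esub> w}" "t \<in> {w \<in> carrier A. \<exists>ka\<ge>k. T w = lam ka \<odot>\<^bsub>A\<^esub> w}"
  then obtain j' k' where "s \<in> carrier A" "t \<in> carrier A" "j' \<ge> j" "k' \<ge> k"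
    "T s = lam j' \<odot>\<^bsub>A\<^esub> s" "T t = lam k' \<odot>\<^bsub>A\<^esub> t" by auto
  hence "s \<otimes>\<^bsub>A\<^esub> t \<in> carrier A \<and> (\<exists>l\<ge>j + k. T (s \<otimes>\<^bsub>A\<^esub> t) = lam l \<odot>\<^bsub>A\<^esub> (s \<otimes>\<^bsub>A\<^esub> t))"
    using T[of s t j' k'] m_closed by (intro conjI exI[of _ "j' + k'"]) auto
  thus "s \<otimes>\<^bsub>A\<^esub> t \<in> lin_span K A {w \<in> carrier A. \<exists>ka\<ge>j + k. T w = lam ka \<odot>\<^bsub>A\<^esub> w}"
    by (intro lin_span_incl) auto
qed auto

lemma subalgebra_Inter:
  assumes "\<And>H. H \<in> \<H> \<Longrightarrow> subalgebra K u A H" "\<H> \<noteq> {}"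
  shows "subalgebra K u A (\<Inter>\<H>)"
proof -
  have "submodule (\<Inter>\<H>) K A"
    by (rule submodule_Inter) (use assms in \<open>auto simp: subalgebra_def\<close>)
  moreover have "a \<otimes>\<^bsub>A\<^esub> b \<in> \<Inter>\<H>" if "a \<in> \<Inter>\<H>" "b \<in> \<Inter>\<H>" for a b
    using that assms(1) unfolding subalgebra_def by (intro InterI) auto
  moreover have "\<one>\<^bsub>A\<^esub> \<in> \<Inter>\<H>" if u
    using that assms(1) unfolding subalgebra_def by (intro InterI) auto
  ultimately show ?thesis unfolding subalgebra_def by auto
qed

lemma subalgebra_carrier: "(u \<Longrightarrow> has_identity A) \<Longrightarrow> subalgebra K u A (carrier A)"
  unfolding subalgebra_def using carrier_is_submodule m_closed by (auto simp: has_identity_def)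

lemma subalgebraI:
  assumes "H \<subseteq> carrier A" "\<zero>\<^bsub>A\<^esub> \<in> H" "\<And>a b. \<lbrakk>a \<in> H; b \<in> H\<rbrakk> \<Longrightarrow> a \<oplus>\<^bsub>A\<^esub> b \<in> H"
    "\<And>c x. \<lbrakk>c \<in> carrier K; x \<in> H\<rbrakk> \<Longrightarrow> c \<odot>\<^bsub>A\<^esub> x \<in> H"
    "\<And>a b. \<lbrakk>a \<in> H; b \<in> H\<rbrakk> \<Longrightarrow> a \<otimes>\<^bsub>A\<^esub> b \<in> H" "u \<Longrightarrow> \<one>\<^bsub>A\<^esub> \<in> H"
  shows "subalgebra K u A H"
  unfolding subalgebra_def using assms submodule_criterion[of H] by auto

lemma gen_subalgebra_subalgebra:
  assumes "S \<subseteq> carrier A" "u \<Longrightarrow> has_identity A" shows "subalgebra K u A (gen_subalgebra K u A S)"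
  unfolding gen_subalgebra_def using assms subalgebra_carrier by (intro subalgebra_Inter) auto

lemma gen_subalgebra_incl: "x \<in> S \<Longrightarrow> x \<in> gen_subalgebra K u A S"
  unfolding gen_subalgebra_def by auto

lemma gen_subalgebra_minimal: "\<lbrakk>subalgebra K u A H; S \<subseteq> H\<rbrakk> \<Longrightarrow> gen_subalgebra K u A S \<subseteq> H"
  unfolding gen_subalgebra_def by auto

lemma gen_subalgebra_closed:
  assumes "S \<subseteq> carrier A" "u \<Longrightarrow> has_identity A"
  shows "gen_subalgebra K u A S \<subseteq> carrier A"
  by (rule gen_subalgebra_minimal[OF subalgebra_carrier]) (use assms in auto)

lemma gen_subalgebra_induct [consumes 3, case_names base zero one add smult mult]:
  assumes "x \<in> gen_subalgebra K u A S" "u \<longrightarrow> has_identity A" "S \<subseteq> carrier A"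
    "\<And>x. x \<in> S \<Longrightarrow> P x" "P \<zero>\<^bsub>A\<^esub>" "u \<Longrightarrow> P \<one>\<^bsub>A\<^esub>"
    "\<And>x y. \<lbrakk>x \<in> carrier A; y \<in> carrier A; P x; P y\<rbrakk> \<Longrightarrow> P (x \<oplus>\<^bsub>A\<^esub> y)"
    "\<And>c x. \<lbrakk>c \<in> carrier K; x \<in> carrier A; P x\<rbrakk> \<Longrightarrow> P (c \<odot>\<^bsub>A\<^esub> x)"
    "\<And>x y. \<lbrakk>x \<in> carrier A; y \<in> carrier A; P x; P y\<rbrakk> \<Longrightarrow> P (x \<otimes>\<^bsub>A\<^esub> y)"
  shows "P x"
proof -
  have "subalgebra K u A {x \<in> carrier A. P x}"
    by (rule subalgebraI) (use assms m_closed in \<open>auto simp: has_identity_def\<close>)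
  from gen_subalgebra_minimal[OF this, of S] assms(1,3,4) show ?thesis by auto
qed

lemma subalgebra_algebra:
  assumes "subalgebra K u A H"
  shows "nonassoc_algebra K (A\<lparr>carrier := H\<rparr>)" "u \<Longrightarrow> has_identity A \<Longrightarrow> has_identity (A\<lparr>carrier := H\<rparr>)"
proof -
  have H: "submodule H K A" using assms unfolding subalgebra_def by simp
  note Hs = submoduleE[OF H]
  interpret H: module K "A\<lparr>carrier := H\<rparr>" by (rule submodule.submodule_is_module[OF H]) unfold_locales
  show "nonassoc_algebra K (A\<lparr>carrier := H\<rparr>)"
    by unfold_locales (use assms Hs(1) l_distr r_distr smult_l smult_r in \<open>auto simp: subalgebra_def subset_iff\<close>)
  show "has_identity (A\<lparr>carrier := H\<rparr>)" if u "has_identity A"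
    using that assms Hs(1) by (auto simp: has_identity_def subalgebra_def)
qed

lemma derivation_one:
  assumes "has_identity A" "leibniz_on A D" "D \<in> carrier A \<rightarrow> carrier A"
  shows "D \<one>\<^bsub>A\<^esub> = \<zero>\<^bsub>A\<^esub>"
proof -
  have 1: "\<one>\<^bsub>A\<^esub> \<in> carrier A" "D \<one>\<^bsub>A\<^esub> \<in> carrier A" using assms by (auto simp: has_identity_def)
  have "D \<one>\<^bsub>A\<^esub> = D \<one>\<^bsub>A\<^esub> \<oplus>\<^bsub>A\<^esub> D \<one>\<^bsub>A\<^esub>"
    using leibniz_onD[OF assms(2) 1(1) 1(1)] assms(1) 1 by (simp add: has_identity_def)
  thus ?thesis using 1 by (metis add.r_cancel_one')
qed

text \<open>By the Leibniz rule the eigenvalues of two factors add up, which is why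
  \<open>lam\<close> has to be additive. The identity is not the value of a monomial term and is
  added in \<open>weight_part_derivation\<close>.\<close>

lemma teval_derivation:
  assumes "t \<in> terms K u X" "is_monomial t" and g: "\<And>x. x \<in> X \<Longrightarrow> g x \<in> carrier A"
    and D: "linear_on K A A D" "leibniz_on A D"
    and lam: "\<And>x. x \<in> X \<Longrightarrow> D (g x) = lam (w x) \<odot>\<^bsub>A\<^esub> g x"
    and lam_add: "\<And>a b. lam (a + b) = lam a \<oplus>\<^bsub>K\<^esub> lam b" "\<And>a. lam a \<in> carrier K"
  shows "teval A g t \<in> carrier A \<and> D (teval A g t) = lam (weight w t) \<odot>\<^bsub>A\<^esub> teval A g t"
  using assms(1,2)
proof induction
  case (6 s t)
  hence c: "teval A g s \<in> carrier A" "teval A g t \<in> carrier A" by auto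
  have "D (teval A g (TMult s t)) =
      (lam (weight w s) \<odot>\<^bsub>A\<^esub> teval A g s) \<otimes>\<^bsub>A\<^esub> teval A g t \<oplus>\<^bsub>A\<^esub> teval A g s \<otimes>\<^bsub>A\<^esub> (lam (weight w t) \<odot>\<^bsub>A\<^esub> teval A g t)"
    using leibniz_onD[OF D(2) c] 6 by simp
  thus ?case using c lam_add m_closed[OF c] by (simp add: smult_l smult_r smult_l_distr)
qed (use g lam in auto)

text \<open>The axioms are equations, so they pass along any surjection compatible with the
  operations. This spares a verification coset by coset for the quotient \<open>A/I\<close>.\<close>

lemma alg_image:
  fixes B :: "('k, 'b) module"
  assumes im: "carrier B = h ` carrier A"
    and add: "\<And>a b. \<lbrakk>a \<in> carrier A; b \<in> carrier A\<rbrakk> \<Longrightarrow> h (a \<oplus>\<^bsub>A\<^esub> b) = h a \<oplus>\<^bsub>B\<^esub> h b"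
    and sm: "\<And>c a. \<lbrakk>c \<in> carrier K; a \<in> carrier A\<rbrakk> \<Longrightarrow> h (c \<odot>\<^bsub>A\<^esub> a) = c \<odot>\<^bsub>B\<^esub> h a"
    and mu: "\<And>a b. \<lbrakk>a \<in> carrier A; b \<in> carrier A\<rbrakk> \<Longrightarrow> h (a \<otimes>\<^bsub>A\<^esub> b) = h a \<otimes>\<^bsub>B\<^esub> h b"
    and ze: "h \<zero>\<^bsub>A\<^esub> = \<zero>\<^bsub>B\<^esub>"
  shows "nonassoc_algebra K B"
proof -
  have ag: "abelian_group B"
  proof (rule abelian_groupI)
    fix x assume "x \<in> carrier B"
    then obtain a where a: "a \<in> carrier A" "x = h a" using im by auto
    have "h (\<ominus>\<^bsub>A\<^esub> a) \<oplus>\<^bsub>B\<^esub> x = \<zero>\<^bsub>B\<^esub>" using a add[of "\<ominus>\<^bsub>A\<^esub> a" a] ze by (simp add: M.l_neg)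
    thus "\<exists>y\<in>carrier B. y \<oplus>\<^bsub>B\<^esub> x = \<zero>\<^bsub>B\<^esub>" using im a by blast
  next
    fix x y assume "x \<in> carrier B" "y \<in> carrier B"
    thus "x \<oplus>\<^bsub>B\<^esub> y = y \<oplus>\<^bsub>B\<^esub> x" using im M.a_comm by (auto simp: add[symmetric])
  qed (use im in \<open>auto simp: add[symmetric] ze[symmetric] M.a_assoc\<close>)
  show ?thesis
  proof (intro nonassoc_algebra.intro nonassoc_algebra_axioms.intro)
    show "module K B"
      by (rule moduleI) (use im ag in \<open>auto simp: sm[symmetric] add[symmetric] smult_l_distr smult_r_distr
          smult_assoc1 R.is_cring\<close>)
  qed (use im in \<open>auto simp: sm[symmetric] add[symmetric] mu[symmetric] m_closed l_distr r_distr smult_l smult_r\<close>)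
qed

end

subsection \<open>Weights and degrees\<close>

definition weight_gens :: "bool \<Rightarrow> 'k ring \<Rightarrow> ('k, 'a) module \<Rightarrow> 'v set \<Rightarrow> ('v \<Rightarrow> 'a) \<Rightarrow>
    ('v \<Rightarrow> nat) \<Rightarrow> nat \<Rightarrow> 'a set" where
  "weight_gens u K A X g w k = {teval A g t | t. t \<in> terms K u X \<and> is_monomial t \<and> weight w t = k} \<union>
      (if u \<and> k = 0 then {\<one>\<^bsub>A\<^esub>} else {})"

lemma weight_part_eq: "weight_part K u A X g w k = lin_span K A (weight_gens u K A X g w k)"
  unfolding weight_part_def weight_gens_def by simp

text \<open>One frame for two gradings: the degree on \<open>A\<close> and \<open>B\<close>, where
  every generator has weight 1, and the degree in the variables y on \<open>C\<close>, where the x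
  have weight 0. Generation itself is added only in \<open>degree_algebra\<close>.\<close>

locale generated_algebra = nonassoc_algebra K A for K :: "'k ring" and A :: "('k, 'a) module" +
  fixes u :: bool and X :: "'v set" and g :: "'v \<Rightarrow> 'a" and w :: "'v \<Rightarrow> nat"
  assumes ident: "u \<Longrightarrow> has_identity A" and gens: "\<And>x. x \<in> X \<Longrightarrow> g x \<in> carrier A"
begin

lemma weight_gens_closed: "weight_gens u K A X g w k \<subseteq> carrier A"
  unfolding weight_gens_def using teval_closed[OF _ ident gens] ident by (auto simp: has_identity_def)

lemma weight_part_submodule: "submodule (weight_part K u A X g w k) K A"
  unfolding weight_part_eq using lin_span_submodule weight_gens_closed by blast

lemma weight_part_closed: "weight_part K u A X g w k \<subseteq> carrier A"
  using submoduleE(1)[OF weight_part_submodule] .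

lemma weight_part_gen: "x \<in> X \<Longrightarrow> g x \<in> weight_part K u A X g w (w x)"
proof -
  assume "x \<in> X"
  hence "teval A g (TVar x) \<in> weight_gens u K A X g w (w x)"
    unfolding weight_gens_def by (intro UnI1 CollectI exI[of _ "TVar x"]) auto
  thus ?thesis unfolding weight_part_eq by (intro lin_span_incl) auto
qed

lemma weight_part_one: "u \<Longrightarrow> \<one>\<^bsub>A\<^esub> \<in> weight_part K u A X g w 0"
  unfolding weight_part_eq weight_gens_def by (intro lin_span_incl) auto

lemma weight_part_mult:
  assumes "a \<in> weight_part K u A X g w j" "b \<in> weight_part K u A X g w k"
  shows "a \<otimes>\<^bsub>A\<^esub> b \<in> weight_part K u A X g w (j + k)"
  using assms unfolding weight_part_eq
proof (rule lin_span_mult[OF _ _ weight_gens_closed weight_gens_closed weight_gens_closed])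
  fix s t assume s: "s \<in> weight_gens u K A X g w j" and t: "t \<in> weight_gens u K A X g w k"
  note c = weight_gens_closed[THEN subsetD, OF s] weight_gens_closed[THEN subsetD, OF t]
  have "s \<otimes>\<^bsub>A\<^esub> t \<in> weight_gens u K A X g w (j + k)"
  \<comment> \<open>In the unital case the identity is a spanning element of weight 0 that is not
    given by a monomial term, so products with it are treated apart from the product of two
    terms.\<close>
  proof (cases "(u \<and> j = 0 \<and> s = \<one>\<^bsub>A\<^esub>) \<or> (u \<and> k = 0 \<and> t = \<one>\<^bsub>A\<^esub>)")
    case True
    thus ?thesis using s t c ident by (auto simp: has_identity_def)
  next
    case False
    then obtain s' t' where "s' \<in> terms K u X" "is_monomial s'" "weight w s' = j" "s = teval A g s'"
      "t' \<in> terms K u X" "is_monomial t'" "weight w t' = k" "t = teval A g t'"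
      using s t unfolding weight_gens_def by (auto split: if_splits)
    thus ?thesis unfolding weight_gens_def by (intro UnI1 CollectI exI[of _ "TMult s' t'"]) auto
  qed
  thus "s \<otimes>\<^bsub>A\<^esub> t \<in> lin_span K A (weight_gens u K A X g w (j + k))" by (rule lin_span_incl)
qed

lemma weight_part_derivation:
  assumes "a \<in> weight_part K u A X g w k"
    and D: "linear_on K A A D" "leibniz_on A D"
    and lam: "\<And>x. x \<in> X \<Longrightarrow> D (g x) = lam (w x) \<odot>\<^bsub>A\<^esub> g x"
    and lam_add: "\<And>a b. lam (a + b) = lam a \<oplus>\<^bsub>K\<^esub> lam b" "\<And>a. lam a \<in> carrier K"
  shows "D a = lam k \<odot>\<^bsub>A\<^esub> a"
  using assms(1) weight_gens_closed unfolding weight_part_eq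
proof (induction rule: lin_span_induct)
  case (base x)
  show ?case
  proof (cases "u \<and> k = 0 \<and> x = \<one>\<^bsub>A\<^esub>")
    case True
    \<comment> \<open>A derivation kills the identity, whose weight is 0, so \<open>lam 0\<close>
      must vanish; additivity of \<open>lam\<close> forces this.\<close>
    have "lam 0 \<oplus>\<^bsub>K\<^esub> lam 0 = lam 0" using lam_add(1)[of 0 0] by simp
    hence "lam 0 = \<zero>\<^bsub>K\<^esub>" using lam_add(2)[of 0] by (metis R.add.r_cancel_one')
    moreover have "D \<in> carrier A \<rightarrow> carrier A" using D(1) unfolding linear_on_def by simp
    ultimately show ?thesis using True derivation_one[OF ident D(2)] ident by (simp add: has_identity_def)
  next
    case False
    then obtain t where "t \<in> terms K u X" "is_monomial t" "weight w t = k" "x = teval A g t"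
      using base unfolding weight_gens_def by (auto split: if_splits)
    thus ?thesis using teval_derivation[where w = w, OF _ _ gens D lam lam_add] by metis
  qed
next
  case zero
  then show ?case using linear_on_zero[OF module_axioms module_axioms D(1)] lam_add by simp
next
  case (add x y)
  then show ?case using linear_onD[OF D(1)] lam_add by (simp add: smult_r_distr)
next
  case (smult c x)
  have "c \<odot>\<^bsub>A\<^esub> (lam k \<odot>\<^bsub>A\<^esub> x) = lam k \<odot>\<^bsub>A\<^esub> (c \<odot>\<^bsub>A\<^esub> x)"
    using smult lam_add by (metis smult_assoc1 R.m_comm)
  then show ?case using linear_onD[OF D(1)] smult by simp
qed

end

text \<open>Generation without freeness, so that it covers \<open>A\<close> with the generators x as
  well as the quotient \<open>B\<close> with their images z.\<close>

locale degree_algebra = generated_algebra K A u "{..<n}" g "\<lambda>_. 1::nat"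
  for K :: "'k ring" and A :: "('k, 'a) module" and u n and g :: "nat \<Rightarrow> 'a" +
  assumes generated: "gen_subalgebra K u A (g ` {..<n}) = carrier A"
begin

lemma degree_part_submodule: "submodule (degree_part K u A n g k) K A"
  unfolding degree_part_def by (rule weight_part_submodule)

lemma degree_part_closed: "degree_part K u A n g k \<subseteq> carrier A"
  unfolding degree_part_def by (rule weight_part_closed)

lemma Un_degree_part_closed: "(\<Union>m\<in>{k..}. degree_part K u A n g m) \<subseteq> carrier A"
  using degree_part_closed by auto

lemma degree_ge_submodule: "submodule (degree_ge K u A n g k) K A"
  unfolding degree_ge_def by (rule lin_span_submodule[OF Un_degree_part_closed])

lemma degree_ge_closed: "degree_ge K u A n g k \<subseteq> carrier A"
  using submoduleE(1)[OF degree_ge_submodule] .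

lemma degree_part_ge: "k \<le> m \<Longrightarrow> degree_part K u A n g m \<subseteq> degree_ge K u A n g k"
  unfolding degree_ge_def by (intro subsetI lin_span_incl) auto

lemma degree_ge_mult:
  assumes "a \<in> degree_ge K u A n g j" "b \<in> degree_ge K u A n g k"
  shows "a \<otimes>\<^bsub>A\<^esub> b \<in> degree_ge K u A n g (j + k)"
  using assms unfolding degree_ge_def
proof (rule lin_span_mult[OF _ _ Un_degree_part_closed Un_degree_part_closed Un_degree_part_closed])
  fix s t assume "s \<in> (\<Union>m\<in>{j..}. degree_part K u A n g m)" "t \<in> (\<Union>m\<in>{k..}. degree_part K u A n g m)"
  then obtain j' k' where "j' \<ge> j" "k' \<ge> k" "s \<in> degree_part K u A n g j'" "t \<in> degree_part K u A n g k'" by auto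
  hence "s \<otimes>\<^bsub>A\<^esub> t \<in> degree_part K u A n g (j' + k')" "j' + k' \<ge> j + k"
    using weight_part_mult unfolding degree_part_def by auto
  thus "s \<otimes>\<^bsub>A\<^esub> t \<in> lin_span K A (\<Union>m\<in>{j + k..}. degree_part K u A n g m)"
    by (intro lin_span_incl) auto
qed

text \<open>The span of all homogeneous parts is a subalgebra containing the generators.\<close>

lemma degree_ge_0: "degree_ge K u A n g 0 = carrier A"
proof
  have "subalgebra K u A (degree_ge K u A n g 0)"
    unfolding subalgebra_def using degree_ge_submodule degree_ge_mult[of _ 0 _ 0]
      weight_part_one degree_part_ge[of 0 0] unfolding degree_part_def by auto
  moreover have "g ` {..<n} \<subseteq> degree_ge K u A n g 0"
    using weight_part_gen degree_part_ge[of 0 1] unfolding degree_part_def by auto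
  ultimately show "carrier A \<subseteq> degree_ge K u A n g 0"
    unfolding generated[symmetric] by (rule gen_subalgebra_minimal)
qed (rule degree_ge_closed)

lemma degree_ge_ideal:
  assumes "a \<in> degree_ge K u A n g m" "b \<in> carrier A"
  shows "a \<otimes>\<^bsub>A\<^esub> b \<in> degree_ge K u A n g m" "b \<otimes>\<^bsub>A\<^esub> a \<in> degree_ge K u A n g m"
  using degree_ge_mult[OF assms(1), of b 0] degree_ge_mult[of b 0, OF _ assms(1)] assms(2) degree_ge_0 by auto

text \<open>This gives existence of the splitting only. That the summands are determined is a matter
  of Euler eigenvalues and comes for \<open>A\<close> with \<open>component_in\<close>.\<close>

lemma degree_ge_split:
  assumes "x \<in> degree_ge K u A n g m"
  obtains a b where "a \<in> degree_part K u A n g m" "b \<in> degree_ge K u A n g (Suc m)" "x = a \<oplus>\<^bsub>A\<^esub> b"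
proof -
  have eq: "(\<Union>k\<in>{m..}. degree_part K u A n g k) =
      degree_part K u A n g m \<union> (\<Union>k\<in>{Suc m..}. degree_part K u A n g k)"
  proof -
    have "{m..} = insert m {Suc m..}" by auto
    thus ?thesis by simp
  qed
  have "lin_span K A (degree_part K u A n g m) = degree_part K u A n g m"
    using lin_span_minimal[OF degree_part_submodule, of "degree_part K u A n g m" m]
      lin_span_incl[of _ "degree_part K u A n g m"] by auto
  thus ?thesis using lin_span_Un[OF degree_part_closed Un_degree_part_closed, of x m "Suc m"] assms that
    unfolding degree_ge_def eq by auto
qed

text \<open>The elements of degree at least m form an ideal, so congruence to the identity map on
  generators spreads to all elements. The product case rests on
  \<open>h(x)h(y) - xy = (h(x) - x)h(y) + x(h(y) - y)\<close>.\<close>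

lemma hom_diff_degree_ge:
  assumes h: "linear_on K A A h" "mult_on A A h" "u \<Longrightarrow> h \<one>\<^bsub>A\<^esub> = \<one>\<^bsub>A\<^esub>"
    and diff: "\<And>j. j < n \<Longrightarrow> h (g j) \<ominus>\<^bsub>A\<^esub> g j \<in> degree_ge K u A n g m" and a: "a \<in> carrier A"
  shows "h a \<ominus>\<^bsub>A\<^esub> a \<in> degree_ge K u A n g m"
proof -
  let ?J = "degree_ge K u A n g m"
  note J = submoduleE[OF degree_ge_submodule[of m]] submodule_zero[OF degree_ge_submodule[of m]]
  note hl = linear_onD[OF h(1)]
  have gs: "g ` {..<n} \<subseteq> carrier A" using gens by auto
  have "a \<in> gen_subalgebra K u A (g ` {..<n})" using a generated by simp
  moreover have "u \<longrightarrow> has_identity A" using ident by simp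
  ultimately show ?thesis using gs
  proof (induction rule: gen_subalgebra_induct)
    case zero
    show ?case using linear_on_zero[OF module_axioms module_axioms h(1)] J by (simp add: a_minus_def)
  next
    case one
    thus ?case using h(3) J ident by (simp add: has_identity_def a_minus_def M.r_neg)
  next
    case (add x y)
    have "h (x \<oplus>\<^bsub>A\<^esub> y) \<ominus>\<^bsub>A\<^esub> (x \<oplus>\<^bsub>A\<^esub> y) = (h x \<ominus>\<^bsub>A\<^esub> x) \<oplus>\<^bsub>A\<^esub> (h y \<ominus>\<^bsub>A\<^esub> y)"
      using add hl by (simp add: a_minus_def M.minus_add M.a_ac)
    thus ?case using add J by simp
  next
    case (smult c x)
    have "h (c \<odot>\<^bsub>A\<^esub> x) \<ominus>\<^bsub>A\<^esub> (c \<odot>\<^bsub>A\<^esub> x) = c \<odot>\<^bsub>A\<^esub> (h x \<ominus>\<^bsub>A\<^esub> x)"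
      using smult hl by (simp add: a_minus_def smult_r_distr smult_r_minus)
    thus ?case using smult J by simp
  next
    case (mult x y)
    have "h (x \<otimes>\<^bsub>A\<^esub> y) \<ominus>\<^bsub>A\<^esub> (x \<otimes>\<^bsub>A\<^esub> y) = (h x \<ominus>\<^bsub>A\<^esub> x) \<otimes>\<^bsub>A\<^esub> h y \<oplus>\<^bsub>A\<^esub> x \<otimes>\<^bsub>A\<^esub> (h y \<ominus>\<^bsub>A\<^esub> y)"
    proof -
      have c: "h x \<otimes>\<^bsub>A\<^esub> h y \<in> carrier A" "x \<otimes>\<^bsub>A\<^esub> h y \<in> carrier A" "x \<otimes>\<^bsub>A\<^esub> y \<in> carrier A"
        using mult hl m_closed by auto
      have "(h x \<ominus>\<^bsub>A\<^esub> x) \<otimes>\<^bsub>A\<^esub> h y \<oplus>\<^bsub>A\<^esub> x \<otimes>\<^bsub>A\<^esub> (h y \<ominus>\<^bsub>A\<^esub> y)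
        = (h x \<otimes>\<^bsub>A\<^esub> h y \<ominus>\<^bsub>A\<^esub> x \<otimes>\<^bsub>A\<^esub> h y) \<oplus>\<^bsub>A\<^esub> (x \<otimes>\<^bsub>A\<^esub> h y \<ominus>\<^bsub>A\<^esub> x \<otimes>\<^bsub>A\<^esub> y)"
        using mult hl by (simp add: a_minus_def l_distr r_distr minus_mult)
      also have "\<dots> = h x \<otimes>\<^bsub>A\<^esub> h y \<ominus>\<^bsub>A\<^esub> x \<otimes>\<^bsub>A\<^esub> y"
        using c by (rule M.minus_add_minus)
      finally show ?thesis using mult mult_onD[OF h(2)] by simp
    qed
    thus ?case using mult J degree_ge_ideal hl by simp
  qed (use diff in auto)
qed

end

section \<open>Relatively free algebras\<close>

definition term_equiv :: "('k, 'a) module set \<Rightarrow> ('k, 'v) aterm \<Rightarrow> ('k, 'v) aterm \<Rightarrow> bool" where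
  "term_equiv M s t \<longleftrightarrow> (\<forall>A\<in>M. \<forall>\<rho> \<in> UNIV \<rightarrow> carrier A. teval A \<rho> s = teval A \<rho> t)"

primrec tsubst :: "('v \<Rightarrow> ('k, 'w) aterm) \<Rightarrow> ('k, 'v) aterm \<Rightarrow> ('k, 'w) aterm" where
  "tsubst \<sigma> (TVar x) = \<sigma> x"
| "tsubst \<sigma> TZero = TZero"
| "tsubst \<sigma> TOne = TOne"
| "tsubst \<sigma> (TAdd s t) = TAdd (tsubst \<sigma> s) (tsubst \<sigma> t)"
| "tsubst \<sigma> (TScale c t) = TScale c (tsubst \<sigma> t)"
| "tsubst \<sigma> (TMult s t) = TMult (tsubst \<sigma> s) (tsubst \<sigma> t)"

text \<open>The derivation along the homomorphism \<open>tsubst \<tau>\<close> with values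
  \<open>\<sigma> x\<close> on the variables. Keeping the two substitutions apart allows the
  derivative to live in a larger set of variables, namely with \<open>\<tau>\<close> the old
  variables and \<open>\<sigma>\<close> the increments.\<close>

primrec tderiv :: "('v \<Rightarrow> ('k, 'w) aterm) \<Rightarrow> ('v \<Rightarrow> ('k, 'w) aterm) \<Rightarrow> ('k, 'v) aterm \<Rightarrow> ('k, 'w) aterm" where
  "tderiv \<tau> \<sigma> (TVar x) = \<sigma> x"
| "tderiv \<tau> \<sigma> TZero = TZero"
| "tderiv \<tau> \<sigma> TOne = TZero"
| "tderiv \<tau> \<sigma> (TAdd s t) = TAdd (tderiv \<tau> \<sigma> s) (tderiv \<tau> \<sigma> t)"
| "tderiv \<tau> \<sigma> (TScale c t) = TScale c (tderiv \<tau> \<sigma> t)"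
| "tderiv \<tau> \<sigma> (TMult s t) = TAdd (TMult (tderiv \<tau> \<sigma> s) (tsubst \<tau> t)) (TMult (tsubst \<tau> s) (tderiv \<tau> \<sigma> t))"

lemma tsubst_TVar: "tsubst TVar t = t"
  by (induction t) auto

lemma tsubst_tsubst: "tsubst \<sigma> (tsubst \<tau> t) = tsubst (\<lambda>x. tsubst \<sigma> (\<tau> x)) t"
  by (induction t) auto

lemma tsubst_tderiv:
  "tsubst \<theta> (tderiv \<tau> \<sigma> t) = tderiv (\<lambda>x. tsubst \<theta> (\<tau> x)) (\<lambda>x. tsubst \<theta> (\<sigma> x)) t"
  by (induction t) (auto simp: tsubst_tsubst)

lemma teval_tsubst: "teval A \<rho> (tsubst \<sigma> t) = teval A (\<lambda>x. teval A \<rho> (\<sigma> x)) t"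
  by (induction t) auto

lemma tsubst_terms: "t \<in> terms K u X \<Longrightarrow> (\<And>x. x \<in> X \<Longrightarrow> \<sigma> x \<in> terms K u Y) \<Longrightarrow> tsubst \<sigma> t \<in> terms K u Y"
  by (induction rule: terms.induct) auto

lemma tderiv_terms: "t \<in> terms K u X \<Longrightarrow> (\<And>x. x \<in> X \<Longrightarrow> \<sigma> x \<in> terms K u Y) \<Longrightarrow>
   (\<And>x. x \<in> X \<Longrightarrow> \<tau> x \<in> terms K u Y) \<Longrightarrow> tderiv \<tau> \<sigma> t \<in> terms K u Y"
  by (induction rule: terms.induct) (auto intro: tsubst_terms)

lemma terms_UNIV: "t \<in> terms K u X \<Longrightarrow> t \<in> terms K u UNIV"
  using terms_mono[of X UNIV] by auto

lemma free_algebra_carrier: "carrier (free_algebra K u M X) = term_class K u M ` terms K u X"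
  by (simp add: free_algebra_def)

lemma free_algebra_consts:
  "\<zero>\<^bsub>free_algebra K u M X\<^esub> = term_class K u M TZero" "\<one>\<^bsub>free_algebra K u M X\<^esub> = term_class K u M TOne"
  by (simp_all add: free_algebra_def)

lemma free_algebra_class_closed: "t \<in> terms K u X \<Longrightarrow> term_class K u M t \<in> carrier (free_algebra K u M X)"
  by (simp add: free_algebra_def)

lemma term_equiv_refl [simp]: "term_equiv M t t"
  by (simp add: term_equiv_def)

lemma term_class_cong: "term_equiv M s t \<Longrightarrow> term_class K u M s = term_class K u M t"
  by (auto simp: term_class_def term_equiv_def)

lemma mem_term_class: "s \<in> term_class K u M t \<longleftrightarrow> s \<in> terms K u UNIV \<and> term_equiv M s t"
  by (auto simp: term_class_def term_equiv_def)

locale relatively_free = char_zero_field K for K :: "'k ring" +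
  fixes u :: bool and M :: "('k, 'a) module set"
  assumes algs: "M \<subseteq> algebras K u"
begin

abbreviation "cls \<equiv> term_class K u M"
abbreviation "F \<equiv> free_algebra K u M"

lemma class_eq_iff:
  assumes "s \<in> terms K u UNIV" shows "cls s = cls t \<longleftrightarrow> term_equiv M s t"
  using assms term_class_cong[of M s t] mem_term_class[of s K u M] by (metis term_equiv_refl)

lemma algsD: "A \<in> M \<Longrightarrow> nonassoc_algebra K A" "A \<in> M \<Longrightarrow> u \<Longrightarrow> has_identity A"
  using algs by (auto simp: algebras_def)

lemma teval_M: "\<lbrakk>A \<in> M; \<rho> \<in> UNIV \<rightarrow> carrier A; t \<in> terms K u UNIV\<rbrakk> \<Longrightarrow> teval A \<rho> t \<in> carrier A"
  using nonassoc_algebra.teval_closed[OF algsD(1), of A t u UNIV \<rho>] algsD(2) by (auto simp: Pi_iff)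

text \<open>The operations of \<open>free_algebra\<close> are unions over all representatives.
  Equivalent representatives yield the same class, so the union is over a constant family;
  \<open>free_add_mult\<close> follows the same pattern.\<close>

lemma free_smult:
  assumes "t \<in> terms K u UNIV" "c \<in> carrier K"
  shows "c \<odot>\<^bsub>F X\<^esub> cls t = cls (TScale c t)"
proof -
  have mem: "t \<in> cls t" using assms by (auto simp: mem_term_class)
  have "cls (TScale c t') = cls (TScale c t)" if "t' \<in> cls t" for t'
    by (rule term_class_cong) (use that in \<open>auto simp: mem_term_class term_equiv_def\<close>)
  hence "(\<Union>t'\<in>cls t. cls (TScale c t')) = cls (TScale c t)"
    by (intro UN_constant_eq[OF mem]) auto
  thus ?thesis by (simp add: free_algebra_def)
qed

lemma free_add_mult:
  assumes "s \<in> terms K u UNIV" "t \<in> terms K u UNIV"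
  shows "cls s \<otimes>\<^bsub>F X\<^esub> cls t = cls (TMult s t)" "cls s \<oplus>\<^bsub>F X\<^esub> cls t = cls (TAdd s t)"
proof -
  have mem: "s \<in> cls s" "t \<in> cls t" using assms by (auto simp: mem_term_class)
  have "cls (TMult s' t') = cls (TMult s t)" if "s' \<in> cls s" "t' \<in> cls t" for s' t'
    by (rule term_class_cong) (use that in \<open>auto simp: mem_term_class term_equiv_def\<close>)
  hence "(\<Union>s'\<in>cls s. \<Union>t'\<in>cls t. cls (TMult s' t')) = cls (TMult s t)"
    by (intro UN_constant_eq[OF mem(1)] UN_constant_eq[OF mem(2)] ballI) auto
  thus "cls s \<otimes>\<^bsub>F X\<^esub> cls t = cls (TMult s t)" by (simp add: free_algebra_def)
  have "cls (TAdd s' t') = cls (TAdd s t)" if "s' \<in> cls s" "t' \<in> cls t" for s' t'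
    by (rule term_class_cong) (use that in \<open>auto simp: mem_term_class term_equiv_def\<close>)
  hence "(\<Union>s'\<in>cls s. \<Union>t'\<in>cls t. cls (TAdd s' t')) = cls (TAdd s t)"
    by (intro UN_constant_eq[OF mem(1)] UN_constant_eq[OF mem(2)] ballI) auto
  thus "cls s \<oplus>\<^bsub>F X\<^esub> cls t = cls (TAdd s t)" by (simp add: free_algebra_def)
qed

lemmas free_ops = free_add_mult free_smult

text \<open>The axioms of an algebra thus reduce, for the free algebra, to the same axioms in each
  member of M evaluated at arbitrary elements.\<close>

lemma classI:
  assumes "\<And>A \<rho>. \<lbrakk>A \<in> M; nonassoc_algebra K A; \<rho> \<in> UNIV \<rightarrow> carrier A\<rbrakk> \<Longrightarrow> teval A \<rho> s = teval A \<rho> t"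
  shows "cls s = cls t"
  by (rule term_class_cong) (use assms algsD in \<open>auto simp: term_equiv_def\<close>)

lemma free_algebra_algebra: "nonassoc_algebra K (F X)"
proof -
  have ag: "abelian_group (F X)"
  proof (rule abelian_groupI)
    fix x y assume "x \<in> carrier (F X)" "y \<in> carrier (F X)"
    then obtain s t where st: "s \<in> terms K u X" "t \<in> terms K u X" "x = cls s" "y = cls t"
      by (auto simp: free_algebra_carrier)
    note U = st(1,2)[THEN terms_UNIV]
    show "x \<oplus>\<^bsub>F X\<^esub> y \<in> carrier (F X)"
      using st U by (simp add: free_ops free_algebra_class_closed)
    have "cls (TAdd s t) = cls (TAdd t s)"
    proof (rule classI)
      fix A and \<rho> :: "'b \<Rightarrow> 'a" assume A: "A \<in> M" "nonassoc_algebra K A" "\<rho> \<in> UNIV \<rightarrow> carrier A"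
      interpret A: nonassoc_algebra K A by fact
      show "teval A \<rho> (TAdd s t) = teval A \<rho> (TAdd t s)"
        using teval_M[OF A(1,3)] U by (simp add: A.M.a_comm)
    qed
    thus "x \<oplus>\<^bsub>F X\<^esub> y = y \<oplus>\<^bsub>F X\<^esub> x" using st U by (simp add: free_ops)
  next
    fix x y z assume "x \<in> carrier (F X)" "y \<in> carrier (F X)" "z \<in> carrier (F X)"
    then obtain s t r where st: "s \<in> terms K u X" "t \<in> terms K u X" "r \<in> terms K u X" "x = cls s" "y = cls t" "z = cls r"
      by (auto simp: free_algebra_carrier)
    note U = st(1,2,3)[THEN terms_UNIV]
    have "cls (TAdd (TAdd s t) r) = cls (TAdd s (TAdd t r))"
    proof (rule classI)
      fix A and \<rho> :: "'b \<Rightarrow> 'a" assume A: "A \<in> M" "nonassoc_algebra K A" "\<rho> \<in> UNIV \<rightarrow> carrier A"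
      interpret A: nonassoc_algebra K A by fact
      show "teval A \<rho> (TAdd (TAdd s t) r) = teval A \<rho> (TAdd s (TAdd t r))"
        using teval_M[OF A(1,3)] U by (simp add: A.M.a_assoc)
    qed
    thus "x \<oplus>\<^bsub>F X\<^esub> y \<oplus>\<^bsub>F X\<^esub> z = x \<oplus>\<^bsub>F X\<^esub> (y \<oplus>\<^bsub>F X\<^esub> z)" using st U by (simp add: free_ops)
  next
    show "\<zero>\<^bsub>F X\<^esub> \<in> carrier (F X)" by (simp add: free_algebra_consts free_algebra_class_closed)
  next
    fix x assume "x \<in> carrier (F X)"
    then obtain s where st: "s \<in> terms K u X" "x = cls s" by (auto simp: free_algebra_carrier)
    note U = st(1)[THEN terms_UNIV]
    have "cls (TAdd TZero s) = cls s"
    proof (rule classI)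
      fix A and \<rho> :: "'b \<Rightarrow> 'a" assume A: "A \<in> M" "nonassoc_algebra K A" "\<rho> \<in> UNIV \<rightarrow> carrier A"
      interpret A: nonassoc_algebra K A by fact
      show "teval A \<rho> (TAdd TZero s) = teval A \<rho> s"
        using teval_M[OF A(1,3)] U by simp
    qed
    thus "\<zero>\<^bsub>F X\<^esub> \<oplus>\<^bsub>F X\<^esub> x = x" using st U by (simp add: free_ops free_algebra_consts)
    \<comment> \<open>Terms have no negation; the additive inverse is the multiple by -1.\<close>
    have "cls (TAdd (TScale (\<ominus>\<^bsub>K\<^esub> \<one>\<^bsub>K\<^esub>) s) s) = cls TZero"
    proof (rule classI)
      fix A and \<rho> :: "'b \<Rightarrow> 'a" assume A: "A \<in> M" "nonassoc_algebra K A" "\<rho> \<in> UNIV \<rightarrow> carrier A"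
      interpret A: nonassoc_algebra K A by fact
      show "teval A \<rho> (TAdd (TScale (\<ominus>\<^bsub>K\<^esub> \<one>\<^bsub>K\<^esub>) s) s) = teval A \<rho> TZero"
        using teval_M[OF A(1,3)] U by (simp add: A.minus_eq_smult[symmetric] A.M.l_neg)
    qed
    hence "cls (TScale (\<ominus>\<^bsub>K\<^esub> \<one>\<^bsub>K\<^esub>) s) \<oplus>\<^bsub>F X\<^esub> x = \<zero>\<^bsub>F X\<^esub>" using st U by (simp add: free_ops free_algebra_consts)
    moreover have "cls (TScale (\<ominus>\<^bsub>K\<^esub> \<one>\<^bsub>K\<^esub>) s) \<in> carrier (F X)" using st by (simp add: free_algebra_class_closed)
    ultimately show "\<exists>y\<in>carrier (F X). y \<oplus>\<^bsub>F X\<^esub> x = \<zero>\<^bsub>F X\<^esub>" by blast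
  qed
  have mod: "module K (F X)"
  proof (rule moduleI[OF is_cring ag])
    fix a b x assume ab: "a \<in> carrier K" "b \<in> carrier K" and "x \<in> carrier (F X)"
    then obtain s where st: "s \<in> terms K u X" "x = cls s" by (auto simp: free_algebra_carrier)
    note U = st(1)[THEN terms_UNIV]
    show "a \<odot>\<^bsub>F X\<^esub> x \<in> carrier (F X)" using ab st U by (simp add: free_ops free_algebra_class_closed)
    have "cls (TScale (a \<oplus>\<^bsub>K\<^esub> b) s) = cls (TAdd (TScale a s) (TScale b s))"
    proof (rule classI)
      fix A and \<rho> :: "'b \<Rightarrow> 'a" assume A: "A \<in> M" "nonassoc_algebra K A" "\<rho> \<in> UNIV \<rightarrow> carrier A"
      interpret A: nonassoc_algebra K A by fact
      show "teval A \<rho> (TScale (a \<oplus>\<^bsub>K\<^esub> b) s) = teval A \<rho> (TAdd (TScale a s) (TScale b s))"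
        using teval_M[OF A(1,3)] U ab by (simp add: A.smult_l_distr)
    qed
    thus "(a \<oplus>\<^bsub>K\<^esub> b) \<odot>\<^bsub>F X\<^esub> x = a \<odot>\<^bsub>F X\<^esub> x \<oplus>\<^bsub>F X\<^esub> b \<odot>\<^bsub>F X\<^esub> x"
      using ab st U by (simp add: free_ops)
    have "cls (TScale (a \<otimes>\<^bsub>K\<^esub> b) s) = cls (TScale a (TScale b s))"
    proof (rule classI)
      fix A and \<rho> :: "'b \<Rightarrow> 'a" assume A: "A \<in> M" "nonassoc_algebra K A" "\<rho> \<in> UNIV \<rightarrow> carrier A"
      interpret A: nonassoc_algebra K A by fact
      show "teval A \<rho> (TScale (a \<otimes>\<^bsub>K\<^esub> b) s) = teval A \<rho> (TScale a (TScale b s))"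
        using teval_M[OF A(1,3)] U ab by (simp add: A.smult_assoc1)
    qed
    thus "(a \<otimes>\<^bsub>K\<^esub> b) \<odot>\<^bsub>F X\<^esub> x = a \<odot>\<^bsub>F X\<^esub> (b \<odot>\<^bsub>F X\<^esub> x)"
      using ab st U by (simp add: free_ops)
  next
    fix x assume "x \<in> carrier (F X)"
    then obtain s where st: "s \<in> terms K u X" "x = cls s" by (auto simp: free_algebra_carrier)
    note U = st(1)[THEN terms_UNIV]
    have "cls (TScale \<one>\<^bsub>K\<^esub> s) = cls s"
    proof (rule classI)
      fix A and \<rho> :: "'b \<Rightarrow> 'a" assume A: "A \<in> M" "nonassoc_algebra K A" "\<rho> \<in> UNIV \<rightarrow> carrier A"
      interpret A: nonassoc_algebra K A by fact
      show "teval A \<rho> (TScale \<one>\<^bsub>K\<^esub> s) = teval A \<rho> s"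
        using teval_M[OF A(1,3)] U by simp
    qed
    thus "\<one>\<^bsub>K\<^esub> \<odot>\<^bsub>F X\<^esub> x = x" using st U by (simp add: free_ops)
  next
    fix a x y assume ab: "a \<in> carrier K" and "x \<in> carrier (F X)" "y \<in> carrier (F X)"
    then obtain s t where st: "s \<in> terms K u X" "t \<in> terms K u X" "x = cls s" "y = cls t"
      by (auto simp: free_algebra_carrier)
    note U = st(1,2)[THEN terms_UNIV]
    have "cls (TScale a (TAdd s t)) = cls (TAdd (TScale a s) (TScale a t))"
    proof (rule classI)
      fix A and \<rho> :: "'b \<Rightarrow> 'a" assume A: "A \<in> M" "nonassoc_algebra K A" "\<rho> \<in> UNIV \<rightarrow> carrier A"
      interpret A: nonassoc_algebra K A by fact
      show "teval A \<rho> (TScale a (TAdd s t)) = teval A \<rho> (TAdd (TScale a s) (TScale a t))"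
        using teval_M[OF A(1,3)] U ab by (simp add: A.smult_r_distr)
    qed
    thus "a \<odot>\<^bsub>F X\<^esub> (x \<oplus>\<^bsub>F X\<^esub> y) = a \<odot>\<^bsub>F X\<^esub> x \<oplus>\<^bsub>F X\<^esub> a \<odot>\<^bsub>F X\<^esub> y"
      using ab st U by (simp add: free_ops)
  qed
  show ?thesis
  proof (intro nonassoc_algebra.intro[OF mod] nonassoc_algebra_axioms.intro)
    fix x y assume "x \<in> carrier (F X)" "y \<in> carrier (F X)"
    then obtain s t where st: "s \<in> terms K u X" "t \<in> terms K u X" "x = cls s" "y = cls t"
      by (auto simp: free_algebra_carrier)
    note U = st(1,2)[THEN terms_UNIV]
    show "x \<otimes>\<^bsub>F X\<^esub> y \<in> carrier (F X)" using st U by (simp add: free_ops free_algebra_class_closed)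
    fix c assume c: "c \<in> carrier K"
    have "cls (TMult (TScale c s) t) = cls (TScale c (TMult s t))"
    proof (rule classI)
      fix A and \<rho> :: "'b \<Rightarrow> 'a" assume A: "A \<in> M" "nonassoc_algebra K A" "\<rho> \<in> UNIV \<rightarrow> carrier A"
      interpret A: nonassoc_algebra K A by fact
      show "teval A \<rho> (TMult (TScale c s) t) = teval A \<rho> (TScale c (TMult s t))"
        using teval_M[OF A(1,3)] U c by (simp add: A.smult_l)
    qed
    thus "(c \<odot>\<^bsub>F X\<^esub> x) \<otimes>\<^bsub>F X\<^esub> y = c \<odot>\<^bsub>F X\<^esub> (x \<otimes>\<^bsub>F X\<^esub> y)" using c st U by (simp add: free_ops)
    have "cls (TMult s (TScale c t)) = cls (TScale c (TMult s t))"
    proof (rule classI)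
      fix A and \<rho> :: "'b \<Rightarrow> 'a" assume A: "A \<in> M" "nonassoc_algebra K A" "\<rho> \<in> UNIV \<rightarrow> carrier A"
      interpret A: nonassoc_algebra K A by fact
      show "teval A \<rho> (TMult s (TScale c t)) = teval A \<rho> (TScale c (TMult s t))"
        using teval_M[OF A(1,3)] U c by (simp add: A.smult_r)
    qed
    thus "x \<otimes>\<^bsub>F X\<^esub> (c \<odot>\<^bsub>F X\<^esub> y) = c \<odot>\<^bsub>F X\<^esub> (x \<otimes>\<^bsub>F X\<^esub> y)" using c st U by (simp add: free_ops)
  next
    fix x y z assume "x \<in> carrier (F X)" "y \<in> carrier (F X)" "z \<in> carrier (F X)"
    then obtain s t r where st: "s \<in> terms K u X" "t \<in> terms K u X" "r \<in> terms K u X" "x = cls s" "y = cls t" "z = cls r"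
      by (auto simp: free_algebra_carrier)
    note U = st(1,2,3)[THEN terms_UNIV]
    have "cls (TMult (TAdd s t) r) = cls (TAdd (TMult s r) (TMult t r))"
    proof (rule classI)
      fix A and \<rho> :: "'b \<Rightarrow> 'a" assume A: "A \<in> M" "nonassoc_algebra K A" "\<rho> \<in> UNIV \<rightarrow> carrier A"
      interpret A: nonassoc_algebra K A by fact
      show "teval A \<rho> (TMult (TAdd s t) r) = teval A \<rho> (TAdd (TMult s r) (TMult t r))"
        using teval_M[OF A(1,3)] U by (simp add: A.l_distr)
    qed
    thus "(x \<oplus>\<^bsub>F X\<^esub> y) \<otimes>\<^bsub>F X\<^esub> z = (x \<otimes>\<^bsub>F X\<^esub> z) \<oplus>\<^bsub>F X\<^esub> (y \<otimes>\<^bsub>F X\<^esub> z)" using st U by (simp add: free_ops)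
    have "cls (TMult r (TAdd s t)) = cls (TAdd (TMult r s) (TMult r t))"
    proof (rule classI)
      fix A and \<rho> :: "'b \<Rightarrow> 'a" assume A: "A \<in> M" "nonassoc_algebra K A" "\<rho> \<in> UNIV \<rightarrow> carrier A"
      interpret A: nonassoc_algebra K A by fact
      show "teval A \<rho> (TMult r (TAdd s t)) = teval A \<rho> (TAdd (TMult r s) (TMult r t))"
        using teval_M[OF A(1,3)] U by (simp add: A.r_distr)
    qed
    thus "z \<otimes>\<^bsub>F X\<^esub> (x \<oplus>\<^bsub>F X\<^esub> y) = (z \<otimes>\<^bsub>F X\<^esub> x) \<oplus>\<^bsub>F X\<^esub> (z \<otimes>\<^bsub>F X\<^esub> y)" using st U by (simp add: free_ops)
  qed
qed

lemma free_algebra_identity: "u \<Longrightarrow> has_identity (F X)"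
  unfolding has_identity_def
proof (intro conjI ballI)
  assume u: u
  show "\<one>\<^bsub>F X\<^esub> \<in> carrier (F X)" using u by (simp add: free_algebra_consts free_algebra_class_closed)
  fix a assume "a \<in> carrier (F X)"
  then obtain s where st: "s \<in> terms K u X" "a = cls s" by (auto simp: free_algebra_carrier)
  note U = st(1)[THEN terms_UNIV]
  have "cls (TMult TOne s) = cls s \<and> cls (TMult s TOne) = cls s"
  proof (intro conjI classI)
    fix A and \<rho> :: "'b \<Rightarrow> 'a" assume A: "A \<in> M" "nonassoc_algebra K A" "\<rho> \<in> UNIV \<rightarrow> carrier A"
    show "teval A \<rho> (TMult TOne s) = teval A \<rho> s" "teval A \<rho> (TMult s TOne) = teval A \<rho> s"
      using teval_M[OF A(1,3)] U algsD(2)[OF A(1) u] by (simp_all add: has_identity_def)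
  qed
  moreover have one: "TOne \<in> terms K u (UNIV :: 'b set)" using u by simp
  ultimately show "\<one>\<^bsub>F X\<^esub> \<otimes>\<^bsub>F X\<^esub> a = a" "a \<otimes>\<^bsub>F X\<^esub> \<one>\<^bsub>F X\<^esub> = a"
    unfolding st(2) free_algebra_consts free_ops(1)[OF one U] free_ops(1)[OF U one] by auto
qed

lemma free_algebra_induct [consumes 1, case_names var zero one add smult mult]:
  assumes "a \<in> carrier (F X)" "\<And>x. x \<in> X \<Longrightarrow> P (cls (TVar x))" "P \<zero>\<^bsub>F X\<^esub>" "u \<Longrightarrow> P \<one>\<^bsub>F X\<^esub>"
    "\<And>x y. \<lbrakk>x \<in> carrier (F X); y \<in> carrier (F X); P x; P y\<rbrakk> \<Longrightarrow> P (x \<oplus>\<^bsub>F X\<^esub> y)"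
    "\<And>c x. \<lbrakk>c \<in> carrier K; x \<in> carrier (F X); P x\<rbrakk> \<Longrightarrow> P (c \<odot>\<^bsub>F X\<^esub> x)"
    "\<And>x y. \<lbrakk>x \<in> carrier (F X); y \<in> carrier (F X); P x; P y\<rbrakk> \<Longrightarrow> P (x \<otimes>\<^bsub>F X\<^esub> y)"
  shows "P a"
proof -
  from assms(1) obtain t where t: "t \<in> terms K u X" "a = cls t" by (auto simp: free_algebra_carrier)
  have "P (cls t)" using t(1)
  proof induction
    case (4 s t)
    thus ?case using assms(5)[of "cls s" "cls t"] free_ops(2)[of s t X] terms_UNIV[of s K u X] terms_UNIV[of t K u X]
      by (simp add: free_algebra_class_closed)
  next
    case (5 c t)
    thus ?case using assms(6)[of c "cls t"] free_smult[of t c X] terms_UNIV[of t K u X]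
      by (simp add: free_algebra_class_closed)
  next
    case (6 s t)
    thus ?case using assms(7)[of "cls s" "cls t"] free_ops(1)[of s t X] terms_UNIV[of s K u X] terms_UNIV[of t K u X]
      by (simp add: free_algebra_class_closed)
  qed (use assms in \<open>auto simp: free_algebra_consts\<close>)
  thus ?thesis using t by simp
qed

lemma free_algebra_generated:
  "gen_subalgebra K u (F X) ((\<lambda>x. cls (TVar x)) ` X) = carrier (F X)"
proof
  interpret FX: nonassoc_algebra K "F X" by (rule free_algebra_algebra)
  let ?g = "(\<lambda>x. cls (TVar x)) ` X"
  have g: "?g \<subseteq> carrier (F X)" by (auto intro!: free_algebra_class_closed)
  show "gen_subalgebra K u (F X) ?g \<subseteq> carrier (F X)"
    by (rule FX.gen_subalgebra_closed[OF g free_algebra_identity])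
  have sub: "subalgebra K u (F X) (gen_subalgebra K u (F X) ?g)"
    by (rule FX.gen_subalgebra_subalgebra[OF g free_algebra_identity])
  hence sm: "submodule (gen_subalgebra K u (F X) ?g) K (F X)" unfolding subalgebra_def by simp
  show "carrier (F X) \<subseteq> gen_subalgebra K u (F X) ?g"
  proof
    fix a assume "a \<in> carrier (F X)"
    thus "a \<in> gen_subalgebra K u (F X) ?g"
    proof (induction rule: free_algebra_induct)
      case (var x)
      then show ?case by (intro FX.gen_subalgebra_incl) auto
    next
      case one
      then show ?case using sub unfolding subalgebra_def by simp
    next
      case (mult x y)
      then show ?case using sub unfolding subalgebra_def by simp
    qed (use FX.submodule_zero[OF sm] FX.submoduleE(4,5)[OF sm] in auto)
  qed
qed

section \<open>Maps out of a relatively free algebra defined on terms\<close>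

lemma teval_free:
  assumes "t \<in> terms K u X" "\<And>x. x \<in> X \<Longrightarrow> \<sigma> x \<in> terms K u UNIV"
  shows "teval (F Y) (\<lambda>v. cls (\<sigma> v)) t = cls (tsubst \<sigma> t)"
proof -
  have sub: "tsubst \<sigma> t \<in> terms K u UNIV" if "t \<in> terms K u X" for t
    by (rule tsubst_terms[OF that assms(2)])
  from assms(1) show ?thesis
    by induction (simp_all add: free_ops free_algebra_consts sub)
qed

text \<open>Common ground of homomorphisms and derivations: an operation on terms that respects
  equivalence descends to classes. The representative picked by \<open>SOME\<close> may contain
  variables outside X, hence compatibility is asked for terms in all variables.\<close>

lemma class_map:
  assumes "\<And>s t. \<lbrakk>s \<in> terms K u UNIV; t \<in> terms K u UNIV; term_equiv M s t\<rbrakk> \<Longrightarrow> term_equiv M (h s) (h t)"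
    and "t \<in> terms K u X"
  shows "(\<lambda>a\<in>carrier (F X). cls (h (SOME t. t \<in> a))) (cls t) = cls (h t)"
proof -
  let ?s = "SOME s. s \<in> cls t"
  have "t \<in> cls t" using assms(2) by (simp add: mem_term_class terms_UNIV)
  hence "?s \<in> cls t" by (rule someI)
  hence "?s \<in> terms K u UNIV" "term_equiv M ?s t" by (auto simp: mem_term_class)
  hence "cls (h ?s) = cls (h t)" by (intro term_class_cong assms(1) terms_UNIV[OF assms(2)])
  thus ?thesis using assms(2) by (simp add: free_algebra_class_closed)
qed

lemma free_hom_ex:
  fixes X :: "'v set" and Y :: "'w set"
  assumes g: "\<And>x. x \<in> X \<Longrightarrow> g x \<in> carrier (F Y)"
  obtains h where "h \<in> alg_hom K u (F X) (F Y)" "\<And>x. x \<in> X \<Longrightarrow> h (cls (TVar x)) = g x"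
proof -
  have "\<forall>x\<in>X. \<exists>t\<in>terms K u Y. g x = cls t" using g by (auto simp: free_algebra_carrier)
  then obtain \<sigma>0 where s0: "\<And>x. x \<in> X \<Longrightarrow> \<sigma>0 x \<in> terms K u Y" "\<And>x. x \<in> X \<Longrightarrow> g x = cls (\<sigma>0 x)" by metis
  \<comment> \<open>Assignments in \<open>term_equiv\<close> range over all variables, so the
    substitution must produce a well-formed term at every variable, also outside X.\<close>
  define \<sigma> where "\<sigma> x = (if x \<in> X then \<sigma>0 x else TZero)" for x
  have sY: "\<sigma> x \<in> terms K u Y" for x using s0 by (simp add: \<sigma>_def)
  define h where "h = (\<lambda>a\<in>carrier (F X). cls (tsubst \<sigma> (SOME t. t \<in> a)))"
  have eq: "term_equiv M (tsubst \<sigma> s) (tsubst \<sigma> t)" if "term_equiv M s t" for s t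
    unfolding term_equiv_def teval_tsubst
  proof (intro ballI)
    fix A and \<rho> :: "'w \<Rightarrow> 'a" assume A: "A \<in> M" "\<rho> \<in> UNIV \<rightarrow> carrier A"
    have "(\<lambda>x. teval A \<rho> (\<sigma> x)) \<in> UNIV \<rightarrow> carrier A"
      using teval_M[OF A terms_UNIV[OF sY]] by simp
    thus "teval A (\<lambda>x. teval A \<rho> (\<sigma> x)) s = teval A (\<lambda>x. teval A \<rho> (\<sigma> x)) t"
      using that A(1) unfolding term_equiv_def by simp
  qed
  have h: "h (cls t) = cls (tsubst \<sigma> t)" if "t \<in> terms K u X" for t
    unfolding h_def by (rule class_map[OF eq that])
  have sub: "tsubst \<sigma> t \<in> terms K u Y" if "t \<in> terms K u X" for t
    using that sY by (intro tsubst_terms)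
  note U = terms_UNIV[OF sub] note U' = terms_UNIV[of _ K u X]
  have lin: "linear_on K (F X) (F Y) h"
    unfolding linear_on_def
  proof (intro conjI ballI)
    show "h \<in> carrier (F X) \<rightarrow> carrier (F Y)"
      using h sub by (auto simp: free_algebra_carrier)
    fix a b assume "a \<in> carrier (F X)" "b \<in> carrier (F X)"
    then obtain s t where st: "s \<in> terms K u X" "t \<in> terms K u X" "a = cls s" "b = cls t"
      by (auto simp: free_algebra_carrier)
    show "h (a \<oplus>\<^bsub>F X\<^esub> b) = h a \<oplus>\<^bsub>F Y\<^esub> h b"
      using st h[of "TAdd s t"] U U' by (simp add: free_ops h)
  next
    fix c a assume c: "c \<in> carrier K" and "a \<in> carrier (F X)"
    then obtain t where st: "t \<in> terms K u X" "a = cls t" by (auto simp: free_algebra_carrier)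
    show "h (c \<odot>\<^bsub>F X\<^esub> a) = c \<odot>\<^bsub>F Y\<^esub> h a"
      using st h[of "TScale c t"] U U' c by (simp add: free_ops h)
  qed
  have mul: "mult_on (F X) (F Y) h"
    unfolding mult_on_def
  proof (intro ballI)
    fix a b assume "a \<in> carrier (F X)" "b \<in> carrier (F X)"
    then obtain s t where st: "s \<in> terms K u X" "t \<in> terms K u X" "a = cls s" "b = cls t"
      by (auto simp: free_algebra_carrier)
    show "h (a \<otimes>\<^bsub>F X\<^esub> b) = h a \<otimes>\<^bsub>F Y\<^esub> h b"
      using st h[of "TMult s t"] U U' by (simp add: free_ops h)
  qed
  have "h \<in> alg_hom K u (F X) (F Y)"
    unfolding alg_hom_iff using lin mul h[of TOne] by (auto simp: free_algebra_consts h_def)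
  moreover have "h (cls (TVar x)) = g x" if "x \<in> X" for x
    using h[of "TVar x"] that s0 by (simp add: \<sigma>_def)
  ultimately show ?thesis using that by blast
qed

end

section \<open>Differentiating identities, and derivations of relatively free algebras\<close>

context lin_space
begin

lemma smult_commute:
  "\<lbrakk>c \<in> carrier K; d \<in> carrier K; x \<in> carrier W\<rbrakk> \<Longrightarrow> c \<odot>\<^bsub>W\<^esub> (d \<odot>\<^bsub>W\<^esub> x) = d \<odot>\<^bsub>W\<^esub> (c \<odot>\<^bsub>W\<^esub> x)"
  by (metis smult_assoc1 R.m_comm)

lemma eig_span_submodule: "submodule (eig_span K W T lam m) K W"
  unfolding eig_span_def by (rule lin_span_submodule) auto

lemma eig_span_incl: "\<lbrakk>w \<in> carrier W; T w = lam k \<odot>\<^bsub>W\<^esub> w; m \<le> k\<rbrakk> \<Longrightarrow> w \<in> eig_span K W T lam m"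
  unfolding eig_span_def by (rule lin_span_incl) auto

lemma eig_span_antimono:
  assumes "x \<in> eig_span K W T lam k" "m \<le> k" shows "x \<in> eig_span K W T lam m"
proof -
  have "eig_span K W T lam k \<subseteq> eig_span K W T lam m"
    unfolding eig_span_def by (rule lin_span_mono) (use assms(2) in \<open>auto intro!: lin_span_incl dest: order_trans[of m]\<close>)
  thus ?thesis using assms(1) by auto
qed

end

context relatively_free
begin

lemma nat_scalar_pow_inj: "nat_scalar K (2 ^ k) = nat_scalar K (2 ^ j) \<longleftrightarrow> k = j"
  by (simp add: nat_scalar_inj)

text \<open>Replacing each variable \<open>x\<close> by \<open>x + x'\<close> and expanding with respect to the degree in the
  new variables \<open>x'\<close>, which is detected by the endomorphism \<open>x \<mapsto> x\<close>, \<open>x' \<mapsto> 2x'\<close>, exhibits the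
  derivation as the linear part.\<close>

lemma tderiv_equiv:
  fixes \<sigma> :: "'v \<Rightarrow> ('k, 'v) aterm"
  assumes st: "s \<in> terms K u UNIV" "t \<in> terms K u UNIV" "term_equiv M s t"
    and \<sigma>: "\<And>x. \<sigma> x \<in> terms K u UNIV"
  shows "term_equiv M (tderiv TVar \<sigma> s) (tderiv TVar \<sigma> t)"
proof -
  \<comment> \<open>Two copies of each variable: the tag \<open>False\<close> marks the old one and
    \<open>True\<close> the increment.\<close>
  define G where "G = F (UNIV :: ('v \<times> bool) set)"
  interpret G: nonassoc_algebra K G unfolding G_def by (rule free_algebra_algebra)
  have Gid: "u \<Longrightarrow> has_identity G" unfolding G_def by (rule free_algebra_identity)
  define old :: "'v \<Rightarrow> ('k, 'v \<times> bool) aterm" where "old = (\<lambda>x. TVar (x, False))"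
  define new :: "'v \<Rightarrow> ('k, 'v \<times> bool) aterm" where "new = (\<lambda>x. TVar (x, True))"
  define pls where "pls = (\<lambda>x. TAdd (old x) (new x))"
  have vars: "old x \<in> terms K u UNIV" "new x \<in> terms K u UNIV" "pls x \<in> terms K u UNIV" for x
    by (simp_all add: old_def new_def pls_def)
  \<comment> \<open>Degree k in the increments is the eigenvalue \<open>2^k\<close> of T, so indices
    add when elements are multiplied. An endomorphism has to be used here, because derivations of
    free algebras are only obtained from this very lemma.\<close>
  define lam where "lam k = nat_scalar K (2 ^ k)" for k :: nat
  have lamc [simp]: "lam k \<in> carrier K" for k by (simp add: lam_def)
  have lam_add: "lam (j + k) = lam j \<otimes>\<^bsub>K\<^esub> lam k" for j k
    by (simp add: lam_def power_add nat_scalar_mult)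
  have lam0: "lam 0 = \<one>\<^bsub>K\<^esub>" by (simp add: lam_def)
  define g where "g = (\<lambda>(x, b). if b then lam 1 \<odot>\<^bsub>G\<^esub> cls (TVar (x, b)) else cls (TVar (x :: 'v, b)))"
  have clsG: "cls t \<in> carrier G" if "t \<in> terms K u UNIV" for t :: "('k, 'v \<times> bool) aterm"
    using that unfolding G_def by (rule free_algebra_class_closed)
  have "g v \<in> carrier G" for v
    by (cases v) (simp add: g_def clsG)
  then obtain T where T: "T \<in> alg_hom K u G G" "\<And>v. T (cls (TVar v)) = g v"
    using free_hom_ex[of UNIV g "UNIV :: ('v \<times> bool) set"] unfolding G_def by (metis UNIV_I)
  have Tl: "linear_on K G G T" and Tm: "mult_on G G T" and T1: "u \<Longrightarrow> T \<one>\<^bsub>G\<^esub> = \<one>\<^bsub>G\<^esub>"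
    using T(1) unfolding alg_hom_iff by auto
  note Tl' = linear_onD[OF Tl]
  have T0: "T \<zero>\<^bsub>G\<^esub> = \<zero>\<^bsub>G\<^esub>" by (rule linear_on_zero[OF G.module_axioms G.module_axioms Tl])
  define V where "V m = eig_span K G T lam m" for m
  have V: "submodule (V m) K G" for m unfolding V_def by (rule G.eig_span_submodule)
  note Vs = G.submoduleE[OF V]
  have Vzero: "\<zero>\<^bsub>G\<^esub> \<in> V 2" by (rule G.submodule_zero[OF V])
  have Vc: "x \<in> carrier G" if "x \<in> V m" for x m using Vs(1) that by auto
  have Tmul: "T (a \<otimes>\<^bsub>G\<^esub> b) = lam (j + k) \<odot>\<^bsub>G\<^esub> (a \<otimes>\<^bsub>G\<^esub> b)"
    if "a \<in> carrier G" "b \<in> carrier G" "T a = lam j \<odot>\<^bsub>G\<^esub> a" "T b = lam k \<odot>\<^bsub>G\<^esub> b" for a b j k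
    using that G.m_closed[OF that(1,2)] mult_onD[OF Tm that(1,2)]
      G.smult_commute[of "lam k" "lam j"]
    by (simp add: lam_add G.smult_l G.smult_r G.smult_assoc1)
  have Vmult: "a \<otimes>\<^bsub>G\<^esub> b \<in> V (j + k)" if "a \<in> V j" "b \<in> V k" for a b j k
    using that unfolding V_def by (rule G.eig_span_mult) (rule Tmul)
  have Vanti: "x \<in> V m" if "x \<in> V k" "m \<le> k" for x m k
    using that unfolding V_def by (rule G.eig_span_antimono)
  have VI: "x \<in> V k" if "x \<in> carrier G" "T x = lam k \<odot>\<^bsub>G\<^esub> x" for x k
    using that unfolding V_def by (rule G.eig_span_incl) simp
  have subs: "tsubst old t \<in> terms K u UNIV" "tsubst pls t \<in> terms K u UNIV" "tderiv old new t \<in> terms K u UNIV"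
    if "t \<in> terms K u UNIV" for t
    using that vars by (auto intro: tsubst_terms tderiv_terms)
  have opsG: "cls (TAdd s t) = cls s \<oplus>\<^bsub>G\<^esub> cls t" "cls (TMult s t) = cls s \<otimes>\<^bsub>G\<^esub> cls t"
    if "s \<in> terms K u UNIV" "t \<in> terms K u UNIV" for s t :: "('k, 'v \<times> bool) aterm"
    using that unfolding G_def by (simp_all add: free_ops)
  have scale: "cls (TScale c t) = c \<odot>\<^bsub>G\<^esub> cls t"
    if "c \<in> carrier K" "t \<in> terms K u UNIV" for c and t :: "('k, 'v \<times> bool) aterm"
    using that unfolding G_def by (simp add: free_ops)
  have constsG: "cls (TZero :: ('k, 'v \<times> bool) aterm) = \<zero>\<^bsub>G\<^esub>" "cls (TOne :: ('k, 'v \<times> bool) aterm) = \<one>\<^bsub>G\<^esub>"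
    unfolding G_def by (simp_all add: free_algebra_consts)
  have eig: "T (cls (tsubst old t)) = lam 0 \<odot>\<^bsub>G\<^esub> cls (tsubst old t)
      \<and> T (cls (tderiv old new t)) = lam 1 \<odot>\<^bsub>G\<^esub> cls (tderiv old new t)"
    if "t \<in> terms K u UNIV" for t
    using that
  proof induction
    case (1 x)
    have "cls (old x) \<in> carrier G" using clsG vars by blast
    then show ?case using T(2)[of "(x, False)"] T(2)[of "(x, True)"]
      by (simp add: g_def old_def new_def lam0)
  next
    case 3
    then have one: "\<one>\<^bsub>G\<^esub> \<in> carrier G" "T \<one>\<^bsub>G\<^esub> = \<one>\<^bsub>G\<^esub>" using T1 Gid by (auto simp: has_identity_def)
    show ?case using one T0 by (simp add: constsG lam0)
  next
    case (4 s t)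
    then show ?case using subs clsG by (simp add: opsG Tl' G.smult_r_distr)
  next
    case (5 c t)
    have "c \<odot>\<^bsub>G\<^esub> (lam k \<odot>\<^bsub>G\<^esub> x) = lam k \<odot>\<^bsub>G\<^esub> (c \<odot>\<^bsub>G\<^esub> x)" if "x \<in> carrier G" for k x
      using that 5 lamc by (simp add: G.smult_commute)
    then show ?case using 5 subs clsG by (simp add: scale Tl')
  next
    case (6 s t)
    let ?a = "cls (tsubst old s)" let ?b = "cls (tderiv old new s)"
    let ?c = "cls (tsubst old t)" let ?d = "cls (tderiv old new t)"
    have c: "?a \<in> carrier G" "?b \<in> carrier G" "?c \<in> carrier G" "?d \<in> carrier G" using 6 subs clsG by auto
    have "T (?a \<otimes>\<^bsub>G\<^esub> ?c) = lam (0 + 0) \<odot>\<^bsub>G\<^esub> (?a \<otimes>\<^bsub>G\<^esub> ?c)" "T (?b \<otimes>\<^bsub>G\<^esub> ?c) = lam (1 + 0) \<odot>\<^bsub>G\<^esub> (?b \<otimes>\<^bsub>G\<^esub> ?c)"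
      "T (?a \<otimes>\<^bsub>G\<^esub> ?d) = lam (0 + 1) \<odot>\<^bsub>G\<^esub> (?a \<otimes>\<^bsub>G\<^esub> ?d)"
      by (rule Tmul; use 6 c in simp)+
    then show ?case using 6 subs c G.m_closed by (simp add: opsG Tl' G.smult_r_distr)
  qed (simp add: constsG T0)
  have eV: "cls (tsubst old t) \<in> V 0" "cls (tderiv old new t) \<in> V 1" if "t \<in> terms K u UNIV" for t
    using eig[OF that] clsG[OF subs(1)[OF that]] clsG[OF subs(3)[OF that]] by (auto intro: VI)
  \<comment> \<open>The first-order Taylor expansion: value, derivative in the direction of the
    increments, and a remainder of degree at least 2 in them.\<close>
  have expand: "\<exists>r\<in>V 2. cls (tsubst pls t) = cls (tsubst old t) \<oplus>\<^bsub>G\<^esub> (cls (tderiv old new t) \<oplus>\<^bsub>G\<^esub> r)"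
    if "t \<in> terms K u UNIV" for t
    using that
  proof induction
    case (1 x)
    have "cls (old x) \<in> carrier G" "cls (new x) \<in> carrier G" using clsG vars by auto
    then show ?case using Vzero vars by (intro bexI[of _ "\<zero>\<^bsub>G\<^esub>"]) (simp_all add: pls_def opsG)
  next
    case 2
    then show ?case using Vzero by (intro bexI[of _ "\<zero>\<^bsub>G\<^esub>"]) (simp_all add: constsG)
  next
    case 3
    then have one: "\<one>\<^bsub>G\<^esub> \<in> carrier G" using Gid by (auto simp: has_identity_def)
    show ?case using Vzero one by (intro bexI[of _ "\<zero>\<^bsub>G\<^esub>"]) (simp_all add: constsG)
  next
    case (4 s t)
    then obtain r r' where r: "r \<in> V 2" "r' \<in> V 2"
      "cls (tsubst pls s) = cls (tsubst old s) \<oplus>\<^bsub>G\<^esub> (cls (tderiv old new s) \<oplus>\<^bsub>G\<^esub> r)"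
      "cls (tsubst pls t) = cls (tsubst old t) \<oplus>\<^bsub>G\<^esub> (cls (tderiv old new t) \<oplus>\<^bsub>G\<^esub> r')" by blast
    have c: "cls (tsubst old s) \<in> carrier G" "cls (tderiv old new s) \<in> carrier G" "r \<in> carrier G"
      "cls (tsubst old t) \<in> carrier G" "cls (tderiv old new t) \<in> carrier G" "r' \<in> carrier G"
      using 4 subs clsG r(1,2) Vc by auto
    show ?case
      by (rule bexI[of _ "r \<oplus>\<^bsub>G\<^esub> r'"]) (use 4 r c subs Vs(5) in \<open>simp_all add: opsG G.M.a_ac\<close>)
  next
    case (5 c t)
    then obtain r where r: "r \<in> V 2"
      "cls (tsubst pls t) = cls (tsubst old t) \<oplus>\<^bsub>G\<^esub> (cls (tderiv old new t) \<oplus>\<^bsub>G\<^esub> r)" by blast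
    have c: "cls (tsubst old t) \<in> carrier G" "cls (tderiv old new t) \<in> carrier G" "r \<in> carrier G"
      using 5 subs clsG r(1) Vc by auto
    show ?case
      by (rule bexI[of _ "c \<odot>\<^bsub>G\<^esub> r"]) (use 5 r c subs Vs(4) in \<open>simp_all add: scale G.smult_r_distr\<close>)
  next
    case (6 s t)
    let ?a = "cls (tsubst old s)" let ?b = "cls (tderiv old new s)"
    let ?c = "cls (tsubst old t)" let ?d = "cls (tderiv old new t)"
    obtain r r' where r: "r \<in> V 2" "r' \<in> V 2" "cls (tsubst pls s) = ?a \<oplus>\<^bsub>G\<^esub> (?b \<oplus>\<^bsub>G\<^esub> r)"
      "cls (tsubst pls t) = ?c \<oplus>\<^bsub>G\<^esub> (?d \<oplus>\<^bsub>G\<^esub> r')" using 6 by blast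
    have c: "?a \<in> carrier G" "?b \<in> carrier G" "r \<in> carrier G" "?c \<in> carrier G" "?d \<in> carrier G" "r' \<in> carrier G"
      using 6 subs clsG r(1,2) Vc by auto
    \<comment> \<open>All products that contain at least two increments. They are grouped so that
      each is covered by \<open>Vmult\<close>, with the degrees 0 + 2, 1 + 1 and 2 + 0.\<close>
    let ?q = "?a \<otimes>\<^bsub>G\<^esub> r' \<oplus>\<^bsub>G\<^esub> (?b \<otimes>\<^bsub>G\<^esub> (?d \<oplus>\<^bsub>G\<^esub> r') \<oplus>\<^bsub>G\<^esub> r \<otimes>\<^bsub>G\<^esub> (?c \<oplus>\<^bsub>G\<^esub> (?d \<oplus>\<^bsub>G\<^esub> r')))"
    have r1: "?d \<oplus>\<^bsub>G\<^esub> r' \<in> V 1" using eV(2)[OF 6(2)] Vanti[OF r(2), of 1] Vs(5) by simp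
    have r0: "?c \<oplus>\<^bsub>G\<^esub> (?d \<oplus>\<^bsub>G\<^esub> r') \<in> V 0" using eV(1)[OF 6(2)] Vanti[OF r1, of 0] Vs(5) by simp
    have q: "?q \<in> V 2"
    proof (intro Vs(5))
      show "?a \<otimes>\<^bsub>G\<^esub> r' \<in> V 2" using Vmult[OF eV(1)[OF 6(1)] r(2)] by (simp add: numeral_2_eq_2)
      show "?b \<otimes>\<^bsub>G\<^esub> (?d \<oplus>\<^bsub>G\<^esub> r') \<in> V 2" using Vmult[OF eV(2)[OF 6(1)] r1] by (simp add: numeral_2_eq_2)
      show "r \<otimes>\<^bsub>G\<^esub> (?c \<oplus>\<^bsub>G\<^esub> (?d \<oplus>\<^bsub>G\<^esub> r')) \<in> V 2" using Vmult[OF r(1) r0] by (simp add: numeral_2_eq_2)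
    qed
    have "(?a \<oplus>\<^bsub>G\<^esub> (?b \<oplus>\<^bsub>G\<^esub> r)) \<otimes>\<^bsub>G\<^esub> (?c \<oplus>\<^bsub>G\<^esub> (?d \<oplus>\<^bsub>G\<^esub> r'))
        = ?a \<otimes>\<^bsub>G\<^esub> ?c \<oplus>\<^bsub>G\<^esub> ((?b \<otimes>\<^bsub>G\<^esub> ?c \<oplus>\<^bsub>G\<^esub> ?a \<otimes>\<^bsub>G\<^esub> ?d) \<oplus>\<^bsub>G\<^esub> ?q)"
      using c G.m_closed by (simp add: G.l_distr G.r_distr G.M.a_ac)
    then show ?case using q 6 subs c G.m_closed r by (intro bexI[of _ ?q]) (simp_all add: opsG)
  qed
  obtain r where r: "r \<in> V 2" "cls (tsubst pls s) = cls (tsubst old s) \<oplus>\<^bsub>G\<^esub> (cls (tderiv old new s) \<oplus>\<^bsub>G\<^esub> r)"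
    using expand[OF st(1)] by blast
  obtain r' where r': "r' \<in> V 2" "cls (tsubst pls t) = cls (tsubst old t) \<oplus>\<^bsub>G\<^esub> (cls (tderiv old new t) \<oplus>\<^bsub>G\<^esub> r')"
    using expand[OF st(2)] by blast
  have subst_equiv: "term_equiv M (tsubst \<tau> a) (tsubst \<tau> b)"
    if "term_equiv M a b" "\<And>x. \<tau> x \<in> terms K u UNIV" for a b and \<tau> :: "'x \<Rightarrow> ('k, 'y) aterm"
    unfolding term_equiv_def teval_tsubst
  proof (intro ballI)
    fix A and \<rho> :: "'y \<Rightarrow> 'a" assume A: "A \<in> M" "\<rho> \<in> UNIV \<rightarrow> carrier A"
    have "(\<lambda>x. teval A \<rho> (\<tau> x)) \<in> UNIV \<rightarrow> carrier A"
      using teval_M[OF A that(2)] by simp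
    thus "teval A (\<lambda>x. teval A \<rho> (\<tau> x)) a = teval A (\<lambda>x. teval A \<rho> (\<tau> x)) b"
      using that(1) A(1) unfolding term_equiv_def by simp
  qed
  have e1: "cls (tsubst pls s) = cls (tsubst pls t)" "cls (tsubst old s) = cls (tsubst old t)"
    by (intro term_class_cong subst_equiv st(3) vars)+
  have c: "cls (tsubst old t) \<in> carrier G" "cls (tderiv old new s) \<in> carrier G" "cls (tderiv old new t) \<in> carrier G"
     "r \<in> carrier G" "r' \<in> carrier G"
    using subs clsG st Vc[OF r(1)] Vc[OF r'(1)] by auto
  let ?v = "cls (tderiv old new s) \<ominus>\<^bsub>G\<^esub> cls (tderiv old new t)"
  have "cls (tderiv old new s) \<oplus>\<^bsub>G\<^esub> r = cls (tderiv old new t) \<oplus>\<^bsub>G\<^esub> r'"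
    using e1 r(2) r'(2) c G.M.add.right_cancel[of "cls (tsubst old t)"] by (simp add: G.M.a_comm)
  hence sum: "?v \<oplus>\<^bsub>G\<^esub> (r \<ominus>\<^bsub>G\<^esub> r') = \<zero>\<^bsub>G\<^esub>"
  proof -
    assume e: "cls (tderiv old new s) \<oplus>\<^bsub>G\<^esub> r = cls (tderiv old new t) \<oplus>\<^bsub>G\<^esub> r'"
    have "?v \<oplus>\<^bsub>G\<^esub> (r \<ominus>\<^bsub>G\<^esub> r') = (cls (tderiv old new s) \<oplus>\<^bsub>G\<^esub> r) \<ominus>\<^bsub>G\<^esub> (cls (tderiv old new t) \<oplus>\<^bsub>G\<^esub> r')"
      using c by (simp add: a_minus_def G.M.minus_add G.M.a_ac)
    also have "\<dots> = \<zero>\<^bsub>G\<^esub>" unfolding e using c by (simp add: G.M.minus_eq_zero_iff)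
    finally show ?thesis .
  qed
  \<comment> \<open>For the zero submodule the component lemma says that a vanishing sum has a
    vanishing part of degree 1.\<close>
  have "?v \<in> {\<zero>\<^bsub>G\<^esub>}"
  proof (rule eigen_component[OF G.module_axioms char_zero_field_axioms Tl, of lam 1])
    show "submodule {\<zero>\<^bsub>G\<^esub>} K G" by (rule G.submodule_criterion) auto
    show "?v \<in> carrier G" using c by simp
    show "T ?v = lam 1 \<odot>\<^bsub>G\<^esub> ?v"
      using c eig[OF st(1)] eig[OF st(2)] linear_on_minus[OF G.module_axioms G.module_axioms Tl]
      by (simp add: a_minus_def G.smult_r_distr G.smult_r_minus)
    show "r \<ominus>\<^bsub>G\<^esub> r' \<in> eig_span K G T lam (Suc 1)"
      using G.submodule_minus_closed[OF V r(1) r'(1)] unfolding V_def by (simp add: numeral_2_eq_2)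
    show "?v \<oplus>\<^bsub>G\<^esub> (r \<ominus>\<^bsub>G\<^esub> r') \<in> {\<zero>\<^bsub>G\<^esub>}" using sum by simp
    show "lam k \<noteq> lam 1" if "k > 1" for k using that nat_scalar_pow_inj[of k 1] by (simp add: lam_def)
  qed (use T0 in auto)
  hence "cls (tderiv old new s) = cls (tderiv old new t)" using c by (simp add: G.M.minus_eq_zero_iff)
  hence "term_equiv M (tderiv old new s) (tderiv old new t)" using class_eq_iff[OF subs(3)[OF st(1)]] by simp
  \<comment> \<open>Specialising each increment to \<open>\<sigma> x\<close> and each old variable
    to itself turns the generic derivative into the wanted one.\<close>
  hence "term_equiv M (tsubst (\<lambda>(x, b). if b then \<sigma> x else TVar x) (tderiv old new s))
      (tsubst (\<lambda>(x, b). if b then \<sigma> x else TVar x) (tderiv old new t))"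
    by (rule subst_equiv) (use \<sigma> in auto)
  thus ?thesis by (simp add: tsubst_tderiv old_def new_def)
qed

text \<open>The formula on terms is recorded because it does not mention M; \<open>I_euler\<close>
  combines it with \<open>tderiv_equiv\<close> for the subvariety.\<close>

lemma free_derivation_ex:
  fixes X :: "'v set"
  assumes \<sigma>: "\<And>x. x \<in> X \<Longrightarrow> \<sigma> x \<in> terms K u X"
  obtains D where "D \<in> derivations K (F X)" "\<And>x. x \<in> X \<Longrightarrow> D (cls (TVar x)) = cls (\<sigma> x)"
    "\<And>t. t \<in> terms K u X \<Longrightarrow> D (cls t) = cls (tderiv TVar (\<lambda>x. if x \<in> X then \<sigma> x else TZero) t)"
proof -
  define \<sigma>' where "\<sigma>' x = (if x \<in> X then \<sigma> x else TZero)" for x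
  have sX: "\<sigma>' x \<in> terms K u X" for x using \<sigma> by (simp add: \<sigma>'_def)
  define D where "D = (\<lambda>a\<in>carrier (F X). cls (tderiv TVar \<sigma>' (SOME t. t \<in> a)))"
  have D: "D (cls t) = cls (tderiv TVar \<sigma>' t)" if "t \<in> terms K u X" for t
    unfolding D_def by (rule class_map[OF tderiv_equiv that]) (use terms_UNIV[OF sX] in auto)
  have sub: "tderiv TVar \<sigma>' t \<in> terms K u X" if "t \<in> terms K u X" for t
    using that sX by (intro tderiv_terms) auto
  note U = terms_UNIV[OF sub] note U' = terms_UNIV[of _ K u X]
  have "linear_on K (F X) (F X) D"
    unfolding linear_on_def
  proof (intro conjI ballI)
    show "D \<in> carrier (F X) \<rightarrow> carrier (F X)"
      using D sub by (auto simp: free_algebra_carrier)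
    fix a b assume "a \<in> carrier (F X)" "b \<in> carrier (F X)"
    then obtain s t where st: "s \<in> terms K u X" "t \<in> terms K u X" "a = cls s" "b = cls t"
      by (auto simp: free_algebra_carrier)
    show "D (a \<oplus>\<^bsub>F X\<^esub> b) = D a \<oplus>\<^bsub>F X\<^esub> D b"
      using st D[of "TAdd s t"] U U' by (simp add: free_ops D)
  next
    fix c a assume c: "c \<in> carrier K" and "a \<in> carrier (F X)"
    then obtain t where st: "t \<in> terms K u X" "a = cls t" by (auto simp: free_algebra_carrier)
    show "D (c \<odot>\<^bsub>F X\<^esub> a) = c \<odot>\<^bsub>F X\<^esub> D a"
      using st D[of "TScale c t"] U U' c by (simp add: free_ops D)
  qed
  moreover have "leibniz_on (F X) D"
    unfolding leibniz_on_def
  proof (intro ballI)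
    fix a b assume "a \<in> carrier (F X)" "b \<in> carrier (F X)"
    then obtain s t where st: "s \<in> terms K u X" "t \<in> terms K u X" "a = cls s" "b = cls t"
      by (auto simp: free_algebra_carrier)
    show "D (a \<otimes>\<^bsub>F X\<^esub> b) = (D a \<otimes>\<^bsub>F X\<^esub> b) \<oplus>\<^bsub>F X\<^esub> (a \<otimes>\<^bsub>F X\<^esub> D b)"
      using st D[of "TMult s t"] U U' by (simp add: free_ops D tsubst_TVar)
  qed
  ultimately have "D \<in> derivations K (F X)" unfolding derivations_iff by (simp add: D_def)
  moreover have "D (cls (TVar x)) = cls (\<sigma> x)" if "x \<in> X" for x
    using D[of "TVar x"] that by (simp add: \<sigma>'_def)
  ultimately show ?thesis using that D unfolding \<sigma>'_def by blast
qed

lemma derivation_unique: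
  assumes "D \<in> derivations K (F X)" "D' \<in> derivations K (F X)"
    "\<And>x. x \<in> X \<Longrightarrow> D (cls (TVar x)) = D' (cls (TVar x))"
  shows "D = D'"
proof (rule extensionalityI)
  interpret FX: nonassoc_algebra K "F X" by (rule free_algebra_algebra)
  note l = assms(1,2)[unfolded derivations_iff]
  have lin: "linear_on K (F X) (F X) D" "linear_on K (F X) (F X) D'" and lb: "leibniz_on (F X) D" "leibniz_on (F X) D'"
    and "D \<in> extensional (carrier (F X))" "D' \<in> extensional (carrier (F X))" using l by auto
  thus "D \<in> extensional (carrier (F X))" "D' \<in> extensional (carrier (F X))" by auto
  fix a assume "a \<in> carrier (F X)"
  thus "D a = D' a"
  proof (induction rule: free_algebra_induct)
    case zero
    then show ?case using lin[THEN linear_on_zero[OF FX.module_axioms FX.module_axioms]] by simp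
  next
    case one
    then show ?case using FX.derivation_one[OF free_algebra_identity lb(1)] FX.derivation_one[OF free_algebra_identity lb(2)]
      lin unfolding linear_on_def by simp
  next
    case (add x y)
    then show ?case using lin[THEN linear_onD(2)] by simp
  next
    case (smult c x)
    then show ?case using lin[THEN linear_onD(3)] by simp
  next
    case (mult x y)
    then show ?case using lb[THEN leibniz_onD] by simp
  qed (use assms in auto)
qed

end

section \<open>The universal multiplicative enveloping algebra\<close>

lemma endo_simps:
  "carrier (endo_algebra K W) = linear_maps K W W"
  "f \<otimes>\<^bsub>endo_algebra K W\<^esub> g = compose (carrier W) f g"
  "\<one>\<^bsub>endo_algebra K W\<^esub> = (\<lambda>w\<in>carrier W. w)"
  "\<zero>\<^bsub>endo_algebra K W\<^esub> = (\<lambda>w\<in>carrier W. \<zero>\<^bsub>W\<^esub>)"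
  "f \<oplus>\<^bsub>endo_algebra K W\<^esub> g = (\<lambda>w\<in>carrier W. f w \<oplus>\<^bsub>W\<^esub> g w)"
  "c \<odot>\<^bsub>endo_algebra K W\<^esub> f = (\<lambda>w\<in>carrier W. c \<odot>\<^bsub>W\<^esub> f w)"
  by (simp_all add: endo_algebra_def)

context lin_space
begin

lemma linear_mapsI:
  assumes "\<And>w. w \<in> carrier W \<Longrightarrow> f w \<in> carrier W"
    "\<And>a b. \<lbrakk>a \<in> carrier W; b \<in> carrier W\<rbrakk> \<Longrightarrow> f (a \<oplus>\<^bsub>W\<^esub> b) = f a \<oplus>\<^bsub>W\<^esub> f b"
    "\<And>c a. \<lbrakk>c \<in> carrier K; a \<in> carrier W\<rbrakk> \<Longrightarrow> f (c \<odot>\<^bsub>W\<^esub> a) = c \<odot>\<^bsub>W\<^esub> f a"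
  shows "(\<lambda>w\<in>carrier W. f w) \<in> linear_maps K W W"
  using assms unfolding linear_maps_def by simp

lemma endo_closed:
  assumes "f \<in> linear_maps K W W" "g \<in> linear_maps K W W"
  shows "(\<lambda>w\<in>carrier W. f w \<oplus>\<^bsub>W\<^esub> g w) \<in> linear_maps K W W"
    "compose (carrier W) f g \<in> linear_maps K W W"
    "c \<in> carrier K \<Longrightarrow> (\<lambda>w\<in>carrier W. c \<odot>\<^bsub>W\<^esub> f w) \<in> linear_maps K W W"
    "(\<lambda>w\<in>carrier W. \<zero>\<^bsub>W\<^esub>) \<in> linear_maps K W W"
    "(\<lambda>w\<in>carrier W. w) \<in> linear_maps K W W"
proof -
  note f = linear_mapsD[OF assms(1)] and g = linear_mapsD[OF assms(2)]
  show "(\<lambda>w\<in>carrier W. f w \<oplus>\<^bsub>W\<^esub> g w) \<in> linear_maps K W W"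
    by (rule linear_mapsI) (use f g in \<open>simp_all add: M.a_ac smult_r_distr\<close>)
  show "compose (carrier W) f g \<in> linear_maps K W W"
    unfolding compose_def by (rule linear_mapsI) (use f g in simp_all)
  show "(\<lambda>w\<in>carrier W. c \<odot>\<^bsub>W\<^esub> f w) \<in> linear_maps K W W" if "c \<in> carrier K"
  proof (rule linear_mapsI)
    fix d a assume "d \<in> carrier K" "a \<in> carrier W"
    thus "c \<odot>\<^bsub>W\<^esub> f (d \<odot>\<^bsub>W\<^esub> a) = d \<odot>\<^bsub>W\<^esub> (c \<odot>\<^bsub>W\<^esub> f a)"
      using f that smult_commute[of c d "f a"] by simp
  qed (use f that in \<open>simp_all add: smult_r_distr\<close>)
  show "(\<lambda>w\<in>carrier W. \<zero>\<^bsub>W\<^esub>) \<in> linear_maps K W W" by (rule linear_mapsI) simp_all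
  show "(\<lambda>w\<in>carrier W. w) \<in> linear_maps K W W" by (rule linear_mapsI) simp_all
qed

lemma endo_eqI:
  assumes "f \<in> linear_maps K W W" "g \<in> linear_maps K W W" "\<And>w. w \<in> carrier W \<Longrightarrow> f w = g w"
  shows "f = g"
  using assms linear_mapsD(4) by (intro extensionalityI[of f "carrier W" g]) auto

lemma endo_algebra_algebra: "nonassoc_algebra K (endo_algebra K W)"
proof -
  let ?L = "linear_maps K W W"
  have ag: "abelian_group (endo_algebra K W)"
  proof (rule abelian_groupI; unfold endo_simps)
    fix f g assume fg: "f \<in> ?L" "g \<in> ?L"
    note f = linear_mapsD[OF fg(1)] and g = linear_mapsD[OF fg(2)]
    show "(\<lambda>w\<in>carrier W. f w \<oplus>\<^bsub>W\<^esub> g w) \<in> ?L" using fg by (rule endo_closed)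
    show "(\<lambda>w\<in>carrier W. f w \<oplus>\<^bsub>W\<^esub> g w) = (\<lambda>w\<in>carrier W. g w \<oplus>\<^bsub>W\<^esub> f w)"
      using f g by (intro restrict_ext) (simp add: M.a_comm)
  next
    fix f g h assume fg: "f \<in> ?L" "g \<in> ?L" "h \<in> ?L"
    show "(\<lambda>w\<in>carrier W. (\<lambda>w\<in>carrier W. f w \<oplus>\<^bsub>W\<^esub> g w) w \<oplus>\<^bsub>W\<^esub> h w) =
          (\<lambda>w\<in>carrier W. f w \<oplus>\<^bsub>W\<^esub> (\<lambda>w\<in>carrier W. g w \<oplus>\<^bsub>W\<^esub> h w) w)"
      using fg[THEN linear_mapsD(1)] by (intro restrict_ext) (simp add: M.a_assoc)
  next
    show "(\<lambda>w\<in>carrier W. \<zero>\<^bsub>W\<^esub>) \<in> ?L" by (rule linear_mapsI) simp_all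
  next
    fix f assume fg: "f \<in> ?L"
    note f = linear_mapsD[OF fg]
    show "(\<lambda>w\<in>carrier W. (\<lambda>w\<in>carrier W. \<zero>\<^bsub>W\<^esub>) w \<oplus>\<^bsub>W\<^esub> f w) = f"
      by (rule endo_eqI[OF endo_closed(1)[OF endo_closed(4)[OF fg fg] fg] fg]) (use f in simp)
    have "(\<lambda>w\<in>carrier W. (\<lambda>w\<in>carrier W. (\<ominus>\<^bsub>K\<^esub> \<one>\<^bsub>K\<^esub>) \<odot>\<^bsub>W\<^esub> f w) w \<oplus>\<^bsub>W\<^esub> f w) = (\<lambda>w\<in>carrier W. \<zero>\<^bsub>W\<^esub>)"
      using f by (intro restrict_ext) (simp add: minus_eq_smult[symmetric] M.l_neg)
    moreover have "(\<lambda>w\<in>carrier W. (\<ominus>\<^bsub>K\<^esub> \<one>\<^bsub>K\<^esub>) \<odot>\<^bsub>W\<^esub> f w) \<in> ?L"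
      by (rule endo_closed(3)[OF fg fg]) simp
    ultimately show "\<exists>g\<in>?L. (\<lambda>w\<in>carrier W. g w \<oplus>\<^bsub>W\<^esub> f w) = (\<lambda>w\<in>carrier W. \<zero>\<^bsub>W\<^esub>)"
      by (rule bexI)
  qed
  have mod: "module K (endo_algebra K W)"
  proof (rule moduleI[OF R.is_cring ag]; unfold endo_simps)
    fix a b f assume ab: "a \<in> carrier K" "b \<in> carrier K" and f: "f \<in> ?L"
    show "(\<lambda>w\<in>carrier W. a \<odot>\<^bsub>W\<^esub> f w) \<in> ?L" using endo_closed(3)[OF f f ab(1)] .
    show "(\<lambda>w\<in>carrier W. (a \<oplus>\<^bsub>K\<^esub> b) \<odot>\<^bsub>W\<^esub> f w) =
       (\<lambda>w\<in>carrier W. (\<lambda>w\<in>carrier W. a \<odot>\<^bsub>W\<^esub> f w) w \<oplus>\<^bsub>W\<^esub> (\<lambda>w\<in>carrier W. b \<odot>\<^bsub>W\<^esub> f w) w)"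
      using linear_mapsD(1)[OF f] ab by (intro restrict_ext) (simp add: smult_l_distr)
    show "(\<lambda>w\<in>carrier W. (a \<otimes>\<^bsub>K\<^esub> b) \<odot>\<^bsub>W\<^esub> f w) = (\<lambda>w\<in>carrier W. a \<odot>\<^bsub>W\<^esub> (\<lambda>w\<in>carrier W. b \<odot>\<^bsub>W\<^esub> f w) w)"
      using linear_mapsD(1)[OF f] ab by (intro restrict_ext) (simp add: smult_assoc1)
  next
    fix a f g assume ab: "a \<in> carrier K" and f: "f \<in> ?L" "g \<in> ?L"
    show "(\<lambda>w\<in>carrier W. a \<odot>\<^bsub>W\<^esub> (\<lambda>w\<in>carrier W. f w \<oplus>\<^bsub>W\<^esub> g w) w) =
       (\<lambda>w\<in>carrier W. (\<lambda>w\<in>carrier W. a \<odot>\<^bsub>W\<^esub> f w) w \<oplus>\<^bsub>W\<^esub> (\<lambda>w\<in>carrier W. a \<odot>\<^bsub>W\<^esub> g w) w)"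
      using f[THEN linear_mapsD(1)] ab by (intro restrict_ext) (simp add: smult_r_distr)
  next
    fix f assume f: "f \<in> ?L"
    show "(\<lambda>w\<in>carrier W. \<one>\<^bsub>K\<^esub> \<odot>\<^bsub>W\<^esub> f w) = f"
      by (rule endo_eqI[OF endo_closed(3)[OF f f R.one_closed] f]) (use linear_mapsD(1)[OF f] in simp)
  qed
  show ?thesis
  proof (intro nonassoc_algebra.intro[OF mod] nonassoc_algebra_axioms.intro; unfold endo_simps)
    fix f g assume fg: "f \<in> ?L" "g \<in> ?L"
    note f = linear_mapsD[OF fg(1)] and g = linear_mapsD[OF fg(2)]
    show "compose (carrier W) f g \<in> ?L" using endo_closed(2)[OF fg] .
    fix c assume c: "c \<in> carrier K"
    show "compose (carrier W) (\<lambda>w\<in>carrier W. c \<odot>\<^bsub>W\<^esub> f w) g = (\<lambda>w\<in>carrier W. c \<odot>\<^bsub>W\<^esub> compose (carrier W) f g w)"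
      unfolding compose_def by (intro restrict_ext) (use f g c in simp)
    show "compose (carrier W) f (\<lambda>w\<in>carrier W. c \<odot>\<^bsub>W\<^esub> g w) = (\<lambda>w\<in>carrier W. c \<odot>\<^bsub>W\<^esub> compose (carrier W) f g w)"
      unfolding compose_def by (intro restrict_ext) (use f g c in simp)
  next
    fix f g h assume fg: "f \<in> ?L" "g \<in> ?L" "h \<in> ?L"
    note f = linear_mapsD[OF fg(1)] and g = linear_mapsD[OF fg(2)] and h = linear_mapsD[OF fg(3)]
    show "compose (carrier W) (\<lambda>w\<in>carrier W. f w \<oplus>\<^bsub>W\<^esub> g w) h =
      (\<lambda>w\<in>carrier W. compose (carrier W) f h w \<oplus>\<^bsub>W\<^esub> compose (carrier W) g h w)"
      unfolding compose_def by (intro restrict_ext) (use f g h in simp)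
    show "compose (carrier W) h (\<lambda>w\<in>carrier W. f w \<oplus>\<^bsub>W\<^esub> g w) =
      (\<lambda>w\<in>carrier W. compose (carrier W) h f w \<oplus>\<^bsub>W\<^esub> compose (carrier W) h g w)"
      unfolding compose_def by (intro restrict_ext) (use f g h in simp)
  qed
qed

lemma endo_algebra_identity: "has_identity (endo_algebra K W)"
  unfolding has_identity_def endo_simps
proof (intro conjI ballI)
  show "(\<lambda>w\<in>carrier W. w) \<in> linear_maps K W W" by (rule linear_mapsI) simp_all
  fix f assume "f \<in> linear_maps K W W"
  note f = this linear_mapsD[OF this]
  have "f \<in> carrier W \<rightarrow> carrier W" using f by auto
  thus "compose (carrier W) (\<lambda>w\<in>carrier W. w) f = f" "compose (carrier W) f (\<lambda>w\<in>carrier W. w) = f"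
    using f(5) Id_compose[of f "carrier W" "carrier W"] compose_Id[of f "carrier W" "carrier W"] by simp_all
qed

end

definition wy :: "gen \<Rightarrow> nat" where
  "wy v = (case v of XVar j \<Rightarrow> 0 | YVar j \<Rightarrow> 1)"

lemma wy_simps [simp]: "wy (XVar j) = 0" "wy (YVar j) = 1"
  by (simp_all add: wy_def)

section \<open>The algebras A and C and the bimodule Omega\<close>

locale free_xy = relatively_free K u M for K :: "'k ring" and u :: bool and M :: "('k, 'a) module set" +
  fixes n :: nat
begin

abbreviation "A \<equiv> alg_A K u M n"
abbreviation "C \<equiv> alg_C K u M n"
abbreviation "x \<equiv> gen_x K u M"
abbreviation "y \<equiv> gen_y K u M"
abbreviation "\<Omega> \<equiv> Omega K u M n"
abbreviation "W \<equiv> Omega_mod K u M n"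
abbreviation "U \<equiv> alg_U K u M n"
abbreviation "XY \<equiv> XVar ` {..<n} \<union> YVar ` {..<n}"

sublocale A: nonassoc_algebra K A unfolding alg_A_def by (rule free_algebra_algebra)
sublocale C: nonassoc_algebra K C unfolding alg_C_def by (rule free_algebra_algebra)

text \<open>Classes are formed among terms in all variables of the type, so X influences the carrier
  of \<open>free_algebra\<close> only. Calculations in \<open>A\<close> can therefore be carried out
  with the operations of \<open>C\<close>.\<close>

lemma A_ops: "a \<otimes>\<^bsub>A\<^esub> b = a \<otimes>\<^bsub>C\<^esub> b" "a \<oplus>\<^bsub>A\<^esub> b = a \<oplus>\<^bsub>C\<^esub> b" "c \<odot>\<^bsub>A\<^esub> a = c \<odot>\<^bsub>C\<^esub> a" "\<zero>\<^bsub>A\<^esub> = \<zero>\<^bsub>C\<^esub>" "\<one>\<^bsub>A\<^esub> = \<one>\<^bsub>C\<^esub>"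
  by (simp_all add: alg_A_def alg_C_def free_algebra_def)

lemma A_subset_C: "carrier A \<subseteq> carrier C"
  using terms_mono[of "XVar ` {..<n}" XY K u] by (auto simp: alg_A_def alg_C_def free_algebra_def)

lemma A_in_C [simp]: "a \<in> carrier A \<Longrightarrow> a \<in> carrier C"
  using A_subset_C by auto

lemma A_ident: "u \<Longrightarrow> has_identity A" and C_ident: "u \<Longrightarrow> has_identity C"
  unfolding alg_A_def alg_C_def by (rule free_algebra_identity, assumption)+

lemma x_closed [simp]: "j < n \<Longrightarrow> x j \<in> carrier A"
  unfolding gen_x_def alg_A_def by (rule free_algebra_class_closed) simp

lemma y_in_C [simp]: "j < n \<Longrightarrow> y j \<in> carrier C"
  unfolding gen_y_def alg_C_def by (rule free_algebra_class_closed) simp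

lemma A_induct [consumes 1, case_names var zero one add smult mult]:
  assumes "a \<in> carrier A" "\<And>j. j < n \<Longrightarrow> P (x j)" "P \<zero>\<^bsub>C\<^esub>" "u \<Longrightarrow> P \<one>\<^bsub>C\<^esub>"
    "\<And>a b. \<lbrakk>a \<in> carrier A; b \<in> carrier A; P a; P b\<rbrakk> \<Longrightarrow> P (a \<oplus>\<^bsub>C\<^esub> b)"
    "\<And>c a. \<lbrakk>c \<in> carrier K; a \<in> carrier A; P a\<rbrakk> \<Longrightarrow> P (c \<odot>\<^bsub>C\<^esub> a)"
    "\<And>a b. \<lbrakk>a \<in> carrier A; b \<in> carrier A; P a; P b\<rbrakk> \<Longrightarrow> P (a \<otimes>\<^bsub>C\<^esub> b)"
  shows "P a"
proof -
  have e: "free_algebra K u M (XVar ` {..<n}) = A" by (simp add: alg_A_def)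
  from assms(1) have "a \<in> carrier (free_algebra K u M (XVar ` {..<n}))" unfolding e .
  thus ?thesis
  proof (induction rule: free_algebra_induct)
    case (var v)
    then show ?case using assms(2) unfolding gen_x_def by auto
  next
    case one
    then show ?case using assms(4) unfolding e A_ops by simp
  qed (use assms in \<open>unfold e A_ops, simp_all\<close>)
qed

sublocale C_gen: generated_algebra K C u XY "gen_xy K u M" wy
proof
  show "has_identity C" if u using C_ident[OF that] .
  show "gen_xy K u M v \<in> carrier C" if "v \<in> XY" for v
    unfolding gen_xy_def alg_C_def by (rule free_algebra_class_closed) (simp only: terms_simps that)
qed

lemma Omega_eq: "\<Omega> = weight_part K u C XY (gen_xy K u M) wy 1"
  unfolding Omega_def wy_def ..

lemma gen_xy_simps: "gen_xy K u M (XVar j) = x j" "gen_xy K u M (YVar j) = y j"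
  by (simp_all add: gen_xy_def gen_x_def gen_y_def)

lemma Omega_submodule: "submodule \<Omega> K C"
  unfolding Omega_eq by (rule C_gen.weight_part_submodule)

lemmas Omega_subset = C.submoduleE(1)[OF Omega_submodule]

lemma Omega_closed [simp]:
  "w \<in> \<Omega> \<Longrightarrow> w \<in> carrier C" "\<zero>\<^bsub>C\<^esub> \<in> \<Omega>" "\<lbrakk>w \<in> \<Omega>; w' \<in> \<Omega>\<rbrakk> \<Longrightarrow> w \<oplus>\<^bsub>C\<^esub> w' \<in> \<Omega>"
  "\<lbrakk>c \<in> carrier K; w \<in> \<Omega>\<rbrakk> \<Longrightarrow> c \<odot>\<^bsub>C\<^esub> w \<in> \<Omega>" "w \<in> \<Omega> \<Longrightarrow> \<ominus>\<^bsub>C\<^esub> w \<in> \<Omega>"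
  using Omega_subset C.submodule_zero[OF Omega_submodule] C.submoduleE(3,4,5)[OF Omega_submodule] by (simp_all add: subsetD)

lemma Omega_minus [simp]: "\<lbrakk>w \<in> \<Omega>; w' \<in> \<Omega>\<rbrakk> \<Longrightarrow> w \<ominus>\<^bsub>C\<^esub> w' \<in> \<Omega>"
  by (simp add: a_minus_def)

sublocale W: lin_space K W
proof -
  have "module K W" by (rule submodule.submodule_is_module[OF Omega_submodule C.module_axioms])
  thus "lin_space K W" by (simp add: lin_space_def)
qed

text \<open>Weights in y add up, so this makes \<open>Omega\<close> stable under left and right
  multiplication by \<open>A\<close>.\<close>

lemma A_weight_0: "a \<in> carrier A \<Longrightarrow> a \<in> weight_part K u C XY (gen_xy K u M) wy 0"
proof (induction rule: A_induct)
  case (var j)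
  then show ?case using C_gen.weight_part_gen[of "XVar j"] by (simp add: gen_xy_simps)
next
  case (mult a b)
  then show ?case using C_gen.weight_part_mult[of a 0 b 0] by simp
next
  case zero
  show ?case by (rule C.submodule_zero[OF C_gen.weight_part_submodule])
next
  case one
  then show ?case by (rule C_gen.weight_part_one)
next
  case (add a b)
  show ?case by (rule C.submoduleE(5)[OF C_gen.weight_part_submodule add(3,4)])
next
  case (smult c a)
  show ?case by (rule C.submoduleE(4)[OF C_gen.weight_part_submodule smult(1,3)])
qed

lemma Omega_act [simp]:
  assumes "a \<in> carrier A" "w \<in> \<Omega>" shows "a \<otimes>\<^bsub>C\<^esub> w \<in> \<Omega>" "w \<otimes>\<^bsub>C\<^esub> a \<in> \<Omega>"
  using C_gen.weight_part_mult[of a 0 w 1] C_gen.weight_part_mult[of w 1 a 0] A_weight_0[OF assms(1)] assms(2)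
  unfolding Omega_eq by auto

lemma y_Omega [simp]: "j < n \<Longrightarrow> y j \<in> \<Omega>"
  unfolding Omega_eq using C_gen.weight_part_gen[of "YVar j"] by (simp add: gen_xy_simps)

lemma monomial_weight_0:
  assumes "t \<in> terms K u XY" "is_monomial t" "weight wy t = 0"
  shows "teval C (gen_xy K u M) t \<in> carrier A"
proof -
  have "t \<in> terms K u (XVar ` {..<n})" using assms by induction auto
  moreover from this have "teval C (gen_xy K u M) t = cls t"
    unfolding alg_C_def gen_xy_def using teval_free[of t "XVar ` {..<n}" TVar XY] by (simp add: tsubst_TVar)
  ultimately show ?thesis unfolding alg_A_def by (simp add: free_algebra_class_closed)
qed

text \<open>In a product of y-weight 1 one factor has weight 1 and the other weight 0, and a
  monomial of weight 0 lies in \<open>A\<close>. So \<open>Omega\<close> arises from the y by linear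
  combinations and multiplications by \<open>A\<close> on either side.\<close>

lemma Omega_induct [consumes 1, case_names gen zero add smult lmult rmult]:
  assumes "w \<in> \<Omega>" "\<And>j. j < n \<Longrightarrow> P (y j)" "P \<zero>\<^bsub>C\<^esub>"
    "\<And>v w. \<lbrakk>v \<in> \<Omega>; w \<in> \<Omega>; P v; P w\<rbrakk> \<Longrightarrow> P (v \<oplus>\<^bsub>C\<^esub> w)"
    "\<And>c w. \<lbrakk>c \<in> carrier K; w \<in> \<Omega>; P w\<rbrakk> \<Longrightarrow> P (c \<odot>\<^bsub>C\<^esub> w)"
    "\<And>a w. \<lbrakk>a \<in> carrier A; w \<in> \<Omega>; P w\<rbrakk> \<Longrightarrow> P (a \<otimes>\<^bsub>C\<^esub> w)"
    "\<And>a w. \<lbrakk>a \<in> carrier A; w \<in> \<Omega>; P w\<rbrakk> \<Longrightarrow> P (w \<otimes>\<^bsub>C\<^esub> a)"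
  shows "P w"
proof -
  have mono: "teval C (gen_xy K u M) t \<in> \<Omega> \<and> P (teval C (gen_xy K u M) t)"
    if "t \<in> terms K u XY" "is_monomial t" "weight wy t = 1" for t
    using that
  proof induction
    case (1 v)
    then obtain j where "v = YVar j" "j < n" by auto
    then show ?case using assms(2)[of j] y_Omega[of j] by (simp add: gen_xy_simps)
  next
    case (6 s t)
    from 6(6) consider "weight wy s = 0" "weight wy t = 1" | "weight wy s = 1" "weight wy t = 0"
      by (auto simp: add_is_1)
    then show ?case
    proof cases
      case 1
      with 6 show ?thesis using monomial_weight_0[of s] assms(6) by simp
    next
      case 2
      with 6 show ?thesis using monomial_weight_0[of t] assms(7) by simp
    qed
  qed auto
  have "submodule {w \<in> \<Omega>. P w} K C"
    by (rule C.submodule_criterion) (use assms in auto)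
  moreover have "weight_gens u K C XY (gen_xy K u M) wy 1 \<subseteq> {w \<in> \<Omega>. P w}"
    unfolding weight_gens_def using mono by auto
  ultimately have "\<Omega> \<subseteq> {w \<in> \<Omega>. P w}"
    using C.lin_span_minimal unfolding Omega_eq weight_part_eq by simp
  thus ?thesis using assms(1) by auto
qed

section \<open>The algebra U of multiplication operators on Omega\<close>

abbreviation "End \<equiv> endo_algebra K W"
abbreviation "L \<equiv> L_op K u M n"
abbreviation "R \<equiv> R_op K u M n"

lemma LR_linear: "a \<in> carrier A \<Longrightarrow> L a \<in> carrier End" "a \<in> carrier A \<Longrightarrow> R a \<in> carrier End"
  unfolding endo_simps L_op_def R_op_def linear_maps_def
  by (auto simp: C.r_distr C.l_distr C.smult_r C.smult_l)

lemma LR_closed: "L ` carrier A \<union> R ` carrier A \<subseteq> carrier End"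
  using LR_linear by auto

sublocale End: nonassoc_algebra K End by (rule W.endo_algebra_algebra)

lemma carrier_U: "carrier U = gen_subalgebra K True End (L ` carrier A \<union> R ` carrier A)"
  by (simp add: alg_U_def)

lemma U_subalgebra: "subalgebra K True End (carrier U)"
  unfolding carrier_U by (rule End.gen_subalgebra_subalgebra[OF LR_closed]) (rule W.endo_algebra_identity)

lemma U_eq: "U = End\<lparr>carrier := carrier U\<rparr>"
  by (simp add: alg_U_def)

sublocale U: nonassoc_algebra K U
  using End.subalgebra_algebra(1)[OF U_subalgebra] U_eq by simp

lemma U_identity: "has_identity U"
  using End.subalgebra_algebra(2)[OF U_subalgebra] U_eq W.endo_algebra_identity by simp

lemma U_linear_maps: "v \<in> carrier U \<Longrightarrow> v \<in> linear_maps K W W"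
  using U_subalgebra End.submoduleE(1)[of "carrier U"] by (auto simp: subalgebra_def endo_simps)

lemma U_simps:
  "w \<in> \<Omega> \<Longrightarrow> (v \<otimes>\<^bsub>U\<^esub> v') w = v (v' w)"
  "w \<in> \<Omega> \<Longrightarrow> (v \<oplus>\<^bsub>U\<^esub> v') w = v w \<oplus>\<^bsub>C\<^esub> v' w"
  "w \<in> \<Omega> \<Longrightarrow> (c \<odot>\<^bsub>U\<^esub> v) w = c \<odot>\<^bsub>C\<^esub> v w"
  "w \<in> \<Omega> \<Longrightarrow> \<one>\<^bsub>U\<^esub> w = w"
  "w \<in> \<Omega> \<Longrightarrow> \<zero>\<^bsub>U\<^esub> w = \<zero>\<^bsub>C\<^esub>"
  by (simp_all add: alg_U_def endo_algebra_def compose_def)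

lemma U_map [simp]: "\<lbrakk>v \<in> carrier U; w \<in> \<Omega>\<rbrakk> \<Longrightarrow> v w \<in> \<Omega>"
  using linear_mapsD(1)[OF U_linear_maps, of v w] by simp

lemma U_map_lin:
  assumes "v \<in> carrier U" "w \<in> \<Omega>"
  shows "w' \<in> \<Omega> \<Longrightarrow> v (w \<oplus>\<^bsub>C\<^esub> w') = v w \<oplus>\<^bsub>C\<^esub> v w'" "c \<in> carrier K \<Longrightarrow> v (c \<odot>\<^bsub>C\<^esub> w) = c \<odot>\<^bsub>C\<^esub> v w"
  using linear_mapsD(2,3)[OF U_linear_maps[OF assms(1)]] assms(2) by simp_all

lemma U_map_zero [simp]: "v \<in> carrier U \<Longrightarrow> v \<zero>\<^bsub>C\<^esub> = \<zero>\<^bsub>C\<^esub>"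
  using U_map_lin(2)[of v "\<zero>\<^bsub>C\<^esub>" "\<zero>\<^bsub>K\<^esub>"] by simp

text \<open>Elements of \<open>U\<close> are extensional functions on \<open>Omega\<close>, so
  equations in \<open>U\<close>, associativity included, are checked pointwise.\<close>

lemma U_eqI:
  assumes "v \<in> carrier U" "v' \<in> carrier U" "\<And>w. w \<in> \<Omega> \<Longrightarrow> v w = v' w" shows "v = v'"
  using W.endo_eqI[OF assms(1,2)[THEN U_linear_maps]] assms(3) by simp

lemma L_in_U [simp]: "a \<in> carrier A \<Longrightarrow> L a \<in> carrier U" and R_in_U [simp]: "a \<in> carrier A \<Longrightarrow> R a \<in> carrier U"
  unfolding carrier_U by (auto intro!: End.gen_subalgebra_incl)

lemma LR_apply: "w \<in> \<Omega> \<Longrightarrow> L a w = a \<otimes>\<^bsub>C\<^esub> w" "w \<in> \<Omega> \<Longrightarrow> R a w = w \<otimes>\<^bsub>C\<^esub> a"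
  by (simp_all add: L_op_def R_op_def)

lemma U_assoc:
  assumes "a \<in> carrier U" "b \<in> carrier U" "c \<in> carrier U"
  shows "(a \<otimes>\<^bsub>U\<^esub> b) \<otimes>\<^bsub>U\<^esub> c = a \<otimes>\<^bsub>U\<^esub> (b \<otimes>\<^bsub>U\<^esub> c)"
  by (rule U_eqI) (use assms U.m_closed in \<open>simp_all add: U_simps\<close>)

lemma U_one [simp]: "\<one>\<^bsub>U\<^esub> \<in> carrier U" "a \<in> carrier U \<Longrightarrow> \<one>\<^bsub>U\<^esub> \<otimes>\<^bsub>U\<^esub> a = a" "a \<in> carrier U \<Longrightarrow> a \<otimes>\<^bsub>U\<^esub> \<one>\<^bsub>U\<^esub> = a"
  using U_identity by (auto simp: has_identity_def)

lemma U_induct [consumes 1, case_names L R zero one add smult mult]: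
  assumes "v \<in> carrier U" "\<And>a. a \<in> carrier A \<Longrightarrow> P (L a)" "\<And>a. a \<in> carrier A \<Longrightarrow> P (R a)"
    "P \<zero>\<^bsub>U\<^esub>" "P \<one>\<^bsub>U\<^esub>"
    "\<And>v w. \<lbrakk>v \<in> carrier U; w \<in> carrier U; P v; P w\<rbrakk> \<Longrightarrow> P (v \<oplus>\<^bsub>U\<^esub> w)"
    "\<And>c v. \<lbrakk>c \<in> carrier K; v \<in> carrier U; P v\<rbrakk> \<Longrightarrow> P (c \<odot>\<^bsub>U\<^esub> v)"
    "\<And>v w. \<lbrakk>v \<in> carrier U; w \<in> carrier U; P v; P w\<rbrakk> \<Longrightarrow> P (v \<otimes>\<^bsub>U\<^esub> w)"
  shows "P v"
proof -
  have e: "\<zero>\<^bsub>U\<^esub> = \<zero>\<^bsub>End\<^esub>" "\<one>\<^bsub>U\<^esub> = \<one>\<^bsub>End\<^esub>" "v \<oplus>\<^bsub>U\<^esub> w = v \<oplus>\<^bsub>End\<^esub> w" "c \<odot>\<^bsub>U\<^esub> v = c \<odot>\<^bsub>End\<^esub> v"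
    "v \<otimes>\<^bsub>U\<^esub> w = v \<otimes>\<^bsub>End\<^esub> w" for v w c by (simp_all add: alg_U_def)
  have "subalgebra K True End {v \<in> carrier U. P v}"
  proof (rule End.subalgebraI)
    show "{v \<in> carrier U. P v} \<subseteq> carrier End" using U_linear_maps by (auto simp: endo_simps)
  qed (use assms in \<open>auto simp: e[symmetric] U.m_closed\<close>)
  hence "carrier U \<subseteq> {v \<in> carrier U. P v}"
    unfolding carrier_U[symmetric] by (subst carrier_U, rule End.gen_subalgebra_minimal) (use assms in auto)
  thus ?thesis using assms(1) by auto
qed

end

context free_xy
begin

subsection \<open>The Euler derivation and the universal derivation\<close>

lemma derivation_C_ex:
  assumes "\<And>v. v \<in> XY \<Longrightarrow> \<sigma> v \<in> terms K u XY"
  shows "\<exists>D. D \<in> derivations K C \<and> (\<forall>j<n. D (x j) = cls (\<sigma> (XVar j))) \<and> (\<forall>j<n. D (y j) = cls (\<sigma> (YVar j)))"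
proof (rule free_derivation_ex[OF assms])
  fix D assume D: "D \<in> derivations K (free_algebra K u M XY)" "\<And>v. v \<in> XY \<Longrightarrow> D (cls (TVar v)) = cls (\<sigma> v)"
  have "D \<in> derivations K C" using D(1) unfolding alg_C_def .
  moreover have "D (x j) = cls (\<sigma> (XVar j))" "D (y j) = cls (\<sigma> (YVar j))" if "j < n" for j
    using D(2)[of "XVar j"] D(2)[of "YVar j"] that by (simp_all add: gen_x_def gen_y_def)
  ultimately show "\<exists>D. D \<in> derivations K C \<and> (\<forall>j<n. D (x j) = cls (\<sigma> (XVar j))) \<and> (\<forall>j<n. D (y j) = cls (\<sigma> (YVar j)))"
    by blast
qed

text \<open>The variables y are constants for this derivation. It therefore preserves
  \<open>Omega\<close>, and on \<open>Omega\<close> it acts on the coefficients from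
  \<open>U\<close> alone, see \<open>crd_euler\<close>.\<close>

definition euler :: "'k elem \<Rightarrow> 'k elem" where
  "euler = (SOME D. D \<in> derivations K C \<and> (\<forall>j<n. D (x j) = x j) \<and> (\<forall>j<n. D (y j) = \<zero>\<^bsub>C\<^esub>))"

text \<open>The universal derivation, extended from \<open>A\<close> to an ordinary derivation of
  the free algebra \<open>C\<close>. In this form its existence is an instance of
  \<open>free_derivation_ex\<close>.\<close>

definition univ_d :: "'k elem \<Rightarrow> 'k elem" where
  "univ_d = (SOME D. D \<in> derivations K C \<and> (\<forall>j<n. D (x j) = y j) \<and> (\<forall>j<n. D (y j) = \<zero>\<^bsub>C\<^esub>))"

lemma euler_props: "euler \<in> derivations K C" "j < n \<Longrightarrow> euler (x j) = x j" "j < n \<Longrightarrow> euler (y j) = \<zero>\<^bsub>C\<^esub>"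
proof -
  have z: "cls TZero = \<zero>\<^bsub>C\<^esub>" by (simp add: alg_C_def free_algebra_consts)
  have "\<exists>D. D \<in> derivations K C \<and> (\<forall>j<n. D (x j) = x j) \<and> (\<forall>j<n. D (y j) = \<zero>\<^bsub>C\<^esub>)"
  proof -
    define \<sigma> :: "gen \<Rightarrow> ('k, gen) aterm" where "\<sigma> = (\<lambda>v. case v of XVar j \<Rightarrow> TVar (XVar j) | YVar j \<Rightarrow> TZero)"
    have "\<sigma> v \<in> terms K u XY" if "v \<in> XY" for v using that by (auto simp: \<sigma>_def)
    moreover have "cls (\<sigma> (XVar j)) = x j" "cls (\<sigma> (YVar j)) = \<zero>\<^bsub>C\<^esub>" for j
      by (simp_all add: \<sigma>_def gen_x_def z)
    ultimately show ?thesis using derivation_C_ex[of \<sigma>] by simp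
  qed
  from someI_ex[OF this] show "euler \<in> derivations K C" "j < n \<Longrightarrow> euler (x j) = x j" "j < n \<Longrightarrow> euler (y j) = \<zero>\<^bsub>C\<^esub>"
    unfolding euler_def by blast+
qed

lemma univ_d_props: "univ_d \<in> derivations K C" "j < n \<Longrightarrow> univ_d (x j) = y j" "j < n \<Longrightarrow> univ_d (y j) = \<zero>\<^bsub>C\<^esub>"
proof -
  have z: "cls TZero = \<zero>\<^bsub>C\<^esub>" by (simp add: alg_C_def free_algebra_consts)
  have "\<exists>D. D \<in> derivations K C \<and> (\<forall>j<n. D (x j) = y j) \<and> (\<forall>j<n. D (y j) = \<zero>\<^bsub>C\<^esub>)"
  proof -
    define \<sigma> :: "gen \<Rightarrow> ('k, gen) aterm" where "\<sigma> = (\<lambda>v. case v of XVar j \<Rightarrow> TVar (YVar j) | YVar j \<Rightarrow> TZero)"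
    have "\<sigma> v \<in> terms K u XY" if "v \<in> XY" for v using that by (auto simp: \<sigma>_def)
    moreover have "cls (\<sigma> (XVar j)) = y j" "cls (\<sigma> (YVar j)) = \<zero>\<^bsub>C\<^esub>" for j
      by (simp_all add: \<sigma>_def gen_y_def z)
    ultimately show ?thesis using derivation_C_ex[of \<sigma>] by simp
  qed
  from someI_ex[OF this] show "univ_d \<in> derivations K C" "j < n \<Longrightarrow> univ_d (x j) = y j" "j < n \<Longrightarrow> univ_d (y j) = \<zero>\<^bsub>C\<^esub>"
    unfolding univ_d_def by blast+
qed

lemma euler_lin: "linear_on K C C euler" and euler_leibniz: "leibniz_on C euler"
  using euler_props(1) unfolding derivations_iff by auto

lemma univ_d_lin: "linear_on K C C univ_d" and univ_d_leibniz: "leibniz_on C univ_d"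
  using univ_d_props(1) unfolding derivations_iff by auto

lemmas euler_ops = linear_onD[OF euler_lin] leibniz_onD[OF euler_leibniz]
  linear_on_zero[OF C.module_axioms C.module_axioms euler_lin]
lemmas univ_d_ops = linear_onD[OF univ_d_lin] leibniz_onD[OF univ_d_leibniz]
  linear_on_zero[OF C.module_axioms C.module_axioms univ_d_lin]

lemma derivations_one: "u \<Longrightarrow> euler \<one>\<^bsub>C\<^esub> = \<zero>\<^bsub>C\<^esub>" "u \<Longrightarrow> univ_d \<one>\<^bsub>C\<^esub> = \<zero>\<^bsub>C\<^esub>"
  using C.derivation_one[OF C_ident euler_leibniz] C.derivation_one[OF C_ident univ_d_leibniz] euler_ops(1) univ_d_ops(1)
  by auto

lemma A_closed [simp]:
  "\<lbrakk>a \<in> carrier A; b \<in> carrier A\<rbrakk> \<Longrightarrow> a \<oplus>\<^bsub>C\<^esub> b \<in> carrier A" "\<zero>\<^bsub>C\<^esub> \<in> carrier A"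
  "\<lbrakk>c \<in> carrier K; a \<in> carrier A\<rbrakk> \<Longrightarrow> c \<odot>\<^bsub>C\<^esub> a \<in> carrier A"
  "\<lbrakk>a \<in> carrier A; b \<in> carrier A\<rbrakk> \<Longrightarrow> a \<otimes>\<^bsub>C\<^esub> b \<in> carrier A"
  using A.M.a_closed[of a b] A.M.zero_closed A.smult_closed[of c a] A.m_closed[of a b] unfolding A_ops by auto

lemma euler_A [simp]: "a \<in> carrier A \<Longrightarrow> euler a \<in> carrier A"
proof (induction rule: A_induct)
  case one
  show ?case unfolding derivations_one(1)[OF one] by (rule A_closed)
qed (simp_all add: euler_props euler_ops)

lemma univ_d_A [simp]: "a \<in> carrier A \<Longrightarrow> univ_d a \<in> \<Omega>"
proof (induction rule: A_induct)
  case one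
  show ?case unfolding derivations_one(2)[OF one] by (rule Omega_closed)
qed (simp_all add: univ_d_props univ_d_ops)

lemma euler_Omega [simp]: "w \<in> \<Omega> \<Longrightarrow> euler w \<in> \<Omega>"
  by (induction rule: Omega_induct) (simp_all add: euler_props euler_ops)

text \<open>Each term of \<open>univ_d a\<close> has one x replaced by a y, so its degree in x is
  one less than before. The added summand makes up for the loss.\<close>

lemma euler_univ_d: "a \<in> carrier A \<Longrightarrow> euler (univ_d a) \<oplus>\<^bsub>C\<^esub> univ_d a = univ_d (euler a)"
proof (induction rule: A_induct)
  case (var j)
  then show ?case by (simp add: euler_props univ_d_props)
next
  case zero
  then show ?case by (simp add: euler_ops univ_d_ops)
next
  case one
  show ?case unfolding derivations_one(1)[OF one] derivations_one(2)[OF one] euler_ops(5) univ_d_ops(5) by simp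
next
  case (add a b)
  have "euler (univ_d (a \<oplus>\<^bsub>C\<^esub> b)) \<oplus>\<^bsub>C\<^esub> univ_d (a \<oplus>\<^bsub>C\<^esub> b) = (euler (univ_d a) \<oplus>\<^bsub>C\<^esub> univ_d a) \<oplus>\<^bsub>C\<^esub> (euler (univ_d b) \<oplus>\<^bsub>C\<^esub> univ_d b)"
    using add(1,2) by (simp add: euler_ops univ_d_ops C.M.a_ac)
  also have "\<dots> = univ_d (euler a) \<oplus>\<^bsub>C\<^esub> univ_d (euler b)" by (simp only: add)
  finally show ?case using add by (simp add: euler_ops univ_d_ops)
next
  case (smult c a)
  have "euler (univ_d (c \<odot>\<^bsub>C\<^esub> a)) \<oplus>\<^bsub>C\<^esub> univ_d (c \<odot>\<^bsub>C\<^esub> a) = c \<odot>\<^bsub>C\<^esub> (euler (univ_d a) \<oplus>\<^bsub>C\<^esub> univ_d a)"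
    using smult(1,2) by (simp add: euler_ops univ_d_ops C.smult_r_distr)
  also have "\<dots> = c \<odot>\<^bsub>C\<^esub> univ_d (euler a)" by (simp only: smult)
  finally show ?case using smult by (simp add: euler_ops univ_d_ops)
next
  case (mult a b)
  have c: "a \<in> carrier C" "b \<in> carrier C" "euler a \<in> carrier C" "euler b \<in> carrier C" "univ_d a \<in> carrier C" "univ_d b \<in> carrier C"
    "euler (univ_d a) \<in> carrier C" "euler (univ_d b) \<in> carrier C"
    using mult by (simp_all add: euler_ops univ_d_ops)
  have "euler (univ_d (a \<otimes>\<^bsub>C\<^esub> b)) \<oplus>\<^bsub>C\<^esub> univ_d (a \<otimes>\<^bsub>C\<^esub> b) =
      ((euler (univ_d a) \<oplus>\<^bsub>C\<^esub> univ_d a) \<otimes>\<^bsub>C\<^esub> b \<oplus>\<^bsub>C\<^esub> euler a \<otimes>\<^bsub>C\<^esub> univ_d b) \<oplus>\<^bsub>C\<^esub> (univ_d a \<otimes>\<^bsub>C\<^esub> euler b \<oplus>\<^bsub>C\<^esub> a \<otimes>\<^bsub>C\<^esub> (euler (univ_d b) \<oplus>\<^bsub>C\<^esub> univ_d b))"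
    using c C.m_closed by (simp add: euler_ops univ_d_ops C.l_distr C.r_distr C.M.a_ac)
  also have "\<dots> = univ_d (euler (a \<otimes>\<^bsub>C\<^esub> b))"
    using c C.m_closed mult by (simp add: euler_ops univ_d_ops)
  finally show ?case .
qed

lemma euler_univ_d_eigen:
  assumes "a \<in> carrier A" "euler a = nat_scalar K (Suc k) \<odot>\<^bsub>C\<^esub> a"
  shows "euler (univ_d a) = nat_scalar K k \<odot>\<^bsub>C\<^esub> univ_d a"
proof -
  have da: "univ_d a \<in> carrier C" "euler (univ_d a) \<in> carrier C" using assms by (simp_all add: univ_d_ops euler_ops)
  have "euler (univ_d a) \<oplus>\<^bsub>C\<^esub> univ_d a = nat_scalar K (Suc k) \<odot>\<^bsub>C\<^esub> univ_d a"
    using euler_univ_d[OF assms(1)] assms by (simp add: univ_d_ops)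
  also have "\<dots> = nat_scalar K k \<odot>\<^bsub>C\<^esub> univ_d a \<oplus>\<^bsub>C\<^esub> univ_d a"
    using da nat_scalar_add[of k 1] by (simp add: C.smult_l_distr)
  finally show ?thesis using da by simp
qed

text \<open>Elements of \<open>linear_maps\<close> are extensional, so the description is met by the
  restriction of \<open>univ_d\<close> to \<open>A\<close>. Uniqueness is an induction over
  \<open>A\<close>.\<close>

lemma univ_der_eq:
  assumes "a \<in> carrier A" shows "univ_der K u M n a = univ_d a"
proof -
  let ?P = "\<lambda>D. D \<in> linear_maps K A W \<and> (\<forall>j<n. D (x j) = y j) \<and>
     (\<forall>a\<in>carrier A. \<forall>b\<in>carrier A. D (a \<otimes>\<^bsub>A\<^esub> b) = L a (D b) \<oplus>\<^bsub>C\<^esub> R b (D a))"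
  have P: "?P (restrict univ_d (carrier A))"
    unfolding linear_maps_def
    by (auto simp: A_ops univ_d_ops univ_d_props LR_apply C.M.a_comm C.m_closed)
  have uniq: "D = D'" if D: "?P D" "?P D'" for D D'
  proof (rule extensionalityI[of _ "carrier A"])
    note l = D[THEN conjunct1, THEN linear_mapsD(1)] 
    show "D \<in> extensional (carrier A)" "D' \<in> extensional (carrier A)"
      using D unfolding linear_maps_def PiE_def by blast+
    have cl: "D a \<in> \<Omega>" "D' a \<in> \<Omega>" if "a \<in> carrier A" for a using l that by auto
    have ad: "D (a \<oplus>\<^bsub>C\<^esub> b) = D a \<oplus>\<^bsub>C\<^esub> D b" "D' (a \<oplus>\<^bsub>C\<^esub> b) = D' a \<oplus>\<^bsub>C\<^esub> D' b"
      if "a \<in> carrier A" "b \<in> carrier A" for a b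
      using D[THEN conjunct1, THEN linear_mapsD(2), OF that] by (simp_all add: A_ops)
    have sm: "D (c \<odot>\<^bsub>C\<^esub> a) = c \<odot>\<^bsub>C\<^esub> D a" "D' (c \<odot>\<^bsub>C\<^esub> a) = c \<odot>\<^bsub>C\<^esub> D' a"
      if "c \<in> carrier K" "a \<in> carrier A" for a c
      using D[THEN conjunct1, THEN linear_mapsD(3), OF that] by (simp_all add: A_ops)
    have mu: "D (a \<otimes>\<^bsub>C\<^esub> b) = L a (D b) \<oplus>\<^bsub>C\<^esub> R b (D a)" "D' (a \<otimes>\<^bsub>C\<^esub> b) = L a (D' b) \<oplus>\<^bsub>C\<^esub> R b (D' a)"
      if "a \<in> carrier A" "b \<in> carrier A" for a b
      using D that by (simp_all add: A_ops)
    \<comment> \<open>The description of \<open>univ_der\<close> prescribes no value at the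
      identity. Applying the product rule to \<open>1 = 1 1\<close> gives
      \<open>D 1 = D 1 + D 1\<close>.\<close>
    have D_one: "\<Delta> \<one>\<^bsub>C\<^esub> = \<zero>\<^bsub>C\<^esub>" if u "?P \<Delta>" for \<Delta>
    proof -
      have 1: "\<one>\<^bsub>C\<^esub> \<in> carrier A" "\<one>\<^bsub>C\<^esub> \<otimes>\<^bsub>C\<^esub> \<one>\<^bsub>C\<^esub> = \<one>\<^bsub>C\<^esub>"
        using A_ident[OF that(1)] unfolding has_identity_def A_ops by auto
      hence w: "\<Delta> \<one>\<^bsub>C\<^esub> \<in> \<Omega>" using that(2) linear_mapsD(1)[of \<Delta> K A W] by auto
      have "\<one>\<^bsub>C\<^esub> \<otimes>\<^bsub>C\<^esub> \<Delta> \<one>\<^bsub>C\<^esub> = \<Delta> \<one>\<^bsub>C\<^esub>" "\<Delta> \<one>\<^bsub>C\<^esub> \<otimes>\<^bsub>C\<^esub> \<one>\<^bsub>C\<^esub> = \<Delta> \<one>\<^bsub>C\<^esub>"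
        using C_ident[OF that(1)] w Omega_closed(1)[OF w] unfolding has_identity_def by auto
      moreover have "\<Delta> (\<one>\<^bsub>A\<^esub> \<otimes>\<^bsub>A\<^esub> \<one>\<^bsub>A\<^esub>) = L \<one>\<^bsub>A\<^esub> (\<Delta> \<one>\<^bsub>A\<^esub>) \<oplus>\<^bsub>C\<^esub> R \<one>\<^bsub>A\<^esub> (\<Delta> \<one>\<^bsub>A\<^esub>)"
        using that(2) 1(1) unfolding A_ops by blast
      ultimately have "\<Delta> \<one>\<^bsub>C\<^esub> = \<Delta> \<one>\<^bsub>C\<^esub> \<oplus>\<^bsub>C\<^esub> \<Delta> \<one>\<^bsub>C\<^esub>" using 1 w by (simp add: A_ops LR_apply)
      thus ?thesis using Omega_closed(1)[OF w] by (metis C.M.add.r_cancel_one')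
    qed
    have ze: "D \<zero>\<^bsub>C\<^esub> = \<zero>\<^bsub>C\<^esub>" "D' \<zero>\<^bsub>C\<^esub> = \<zero>\<^bsub>C\<^esub>"
      using sm[of "\<zero>\<^bsub>K\<^esub>" "\<zero>\<^bsub>C\<^esub>"] cl[of "\<zero>\<^bsub>C\<^esub>"] by simp_all
    fix a assume "a \<in> carrier A"
    thus "D a = D' a"
    proof (induction rule: A_induct)
      case one
      show ?case using D_one[OF one D(1)] D_one[OF one D(2)] by (simp only:)
    qed (use D ze in \<open>simp_all add: ad sm mu\<close>)
  qed
  have "univ_der K u M n = restrict univ_d (carrier A)"
    unfolding univ_der_def
  proof (rule the_equality)
    show "?P (restrict univ_d (carrier A))" by (rule P)
    show "D = restrict univ_d (carrier A)" if "?P D" for D by (rule uniq[OF that P])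
  qed
  thus ?thesis using assms by simp
qed

subsection \<open>The commutator with the Euler derivation\<close>

definition delta :: "('k elem \<Rightarrow> 'k elem) \<Rightarrow> 'k elem \<Rightarrow> 'k elem" where
  "delta v = (\<lambda>w\<in>\<Omega>. euler (v w) \<ominus>\<^bsub>C\<^esub> v (euler w))"

lemma delta_apply:
  assumes "v \<in> carrier U" "w \<in> \<Omega>"
  shows "euler (v w) = delta v w \<oplus>\<^bsub>C\<^esub> v (euler w)"
  using assms unfolding delta_def by (simp add: a_minus_def C.M.a_assoc C.M.l_neg)

text \<open>A candidate for the commutator is recognised by its product rule, which avoids
  subtraction in the computations below.\<close>

lemma delta_eqI:
  assumes v: "v \<in> carrier U" "v' \<in> carrier U" "\<And>w. w \<in> \<Omega> \<Longrightarrow> euler (v w) = v' w \<oplus>\<^bsub>C\<^esub> v (euler w)"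
  shows "delta v = v'"
proof (rule extensionalityI[of _ \<Omega>])
  show "delta v \<in> extensional \<Omega>" by (simp add: delta_def)
  show "v' \<in> extensional \<Omega>" using linear_mapsD(4)[OF U_linear_maps[OF v(2)]] by simp
  fix w assume "w \<in> \<Omega>"
  thus "delta v w = v' w" using v by (simp add: delta_def C.M.minus_eq_iff)
qed

lemma delta_L: "a \<in> carrier A \<Longrightarrow> delta (L a) = L (euler a)"
  by (rule delta_eqI) (simp_all add: LR_apply euler_ops)

lemma delta_R: "a \<in> carrier A \<Longrightarrow> delta (R a) = R (euler a)"
  by (rule delta_eqI) (simp_all add: LR_apply euler_ops C.M.a_comm C.m_closed)

text \<open>That \<open>delta\<close> maps \<open>U\<close> to itself is not yet known and is
  assumed for the arguments. \<open>delta_closed\<close> then proves it by induction over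
  \<open>U\<close>, with this rule and its two companions as the inductive steps.\<close>

lemma delta_add_aux:
  assumes "v \<in> carrier U" "v' \<in> carrier U" "delta v \<in> carrier U" "delta v' \<in> carrier U"
  shows "delta (v \<oplus>\<^bsub>U\<^esub> v') = delta v \<oplus>\<^bsub>U\<^esub> delta v'"
  by (rule delta_eqI) (use assms in \<open>simp_all add: U_simps euler_ops delta_apply C.M.a_ac\<close>)

lemma delta_smult_aux:
  assumes "v \<in> carrier U" "c \<in> carrier K" "delta v \<in> carrier U"
  shows "delta (c \<odot>\<^bsub>U\<^esub> v) = c \<odot>\<^bsub>U\<^esub> delta v"
  by (rule delta_eqI) (use assms in \<open>simp_all add: U_simps euler_ops delta_apply C.smult_r_distr\<close>)

lemma delta_mult_aux:
  assumes "v \<in> carrier U" "v' \<in> carrier U" "delta v \<in> carrier U" "delta v' \<in> carrier U"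
  shows "delta (v \<otimes>\<^bsub>U\<^esub> v') = delta v \<otimes>\<^bsub>U\<^esub> v' \<oplus>\<^bsub>U\<^esub> v \<otimes>\<^bsub>U\<^esub> delta v'"
  by (rule delta_eqI) (use assms in \<open>simp_all add: U.m_closed U_simps euler_ops delta_apply U_map_lin C.M.a_assoc\<close>)

lemma delta_one: "delta \<one>\<^bsub>U\<^esub> = \<zero>\<^bsub>U\<^esub>" and delta_zero: "delta \<zero>\<^bsub>U\<^esub> = \<zero>\<^bsub>U\<^esub>"
  by (rule delta_eqI; simp add: U_simps euler_ops)+

lemma delta_closed [simp]: "v \<in> carrier U \<Longrightarrow> delta v \<in> carrier U"
  by (induction rule: U_induct)
    (simp_all add: delta_L delta_R delta_zero delta_one delta_add_aux delta_smult_aux delta_mult_aux U.m_closed)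

lemma delta_lin: "linear_on K U U delta" and delta_leibniz: "leibniz_on U delta"
  unfolding linear_on_def leibniz_on_def by (auto simp: delta_add_aux delta_smult_aux delta_mult_aux)

lemmas delta_ops = linear_onD[OF delta_lin] leibniz_onD[OF delta_leibniz]

subsection \<open>Coordinates\<close>

lemma Omega_finsum:
  assumes "finite I" "f \<in> I \<rightarrow> \<Omega>"
  shows "(\<Oplus>\<^bsub>C\<^esub>i\<in>I. f i) \<in> \<Omega>"
  using assms by (induction I) (auto simp: Pi_iff)

lemma Omega_map_finsum:
  assumes "finite I" "f \<in> I \<rightarrow> \<Omega>" "\<And>w. w \<in> \<Omega> \<Longrightarrow> h w \<in> carrier C" "h \<zero>\<^bsub>C\<^esub> = \<zero>\<^bsub>C\<^esub>"
    "\<And>v w. \<lbrakk>v \<in> \<Omega>; w \<in> \<Omega>\<rbrakk> \<Longrightarrow> h (v \<oplus>\<^bsub>C\<^esub> w) = h v \<oplus>\<^bsub>C\<^esub> h w"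
  shows "h (\<Oplus>\<^bsub>C\<^esub>i\<in>I. f i) = (\<Oplus>\<^bsub>C\<^esub>i\<in>I. h (f i))"
  using assms(1,2)
proof (induction I)
  case empty
  then show ?case using assms by simp
next
  case (insert i I)
  hence f: "f i \<in> \<Omega>" "f \<in> I \<rightarrow> \<Omega>" "f \<in> I \<rightarrow> carrier C" "(\<lambda>i. h (f i)) \<in> I \<rightarrow> carrier C"
    using assms(3) by (auto simp: Pi_iff)
  have "h (\<Oplus>\<^bsub>C\<^esub>i\<in>insert i I. f i) = h (f i \<oplus>\<^bsub>C\<^esub> (\<Oplus>\<^bsub>C\<^esub>i\<in>I. f i))" using insert f by simp
  also have "\<dots> = h (f i) \<oplus>\<^bsub>C\<^esub> (\<Oplus>\<^bsub>C\<^esub>i\<in>I. h (f i))"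
    using assms(5)[OF f(1) Omega_finsum[OF insert(1) f(2)]] insert f by simp
  also have "\<dots> = (\<Oplus>\<^bsub>C\<^esub>i\<in>insert i I. h (f i))" using insert f assms(3) by simp
  finally show ?case .
qed

definition comb :: "(nat \<Rightarrow> 'k elem \<Rightarrow> 'k elem) \<Rightarrow> 'k elem" where
  "comb v = (\<Oplus>\<^bsub>C\<^esub>j\<in>{..<n}. v j (y j))"

lemma comb_terms: "v \<in> {..<n} \<rightarrow> carrier U \<Longrightarrow> (\<lambda>j. v j (y j)) \<in> {..<n} \<rightarrow> \<Omega>"
  by (auto simp: Pi_iff)

lemma comb_closed [simp]: "v \<in> {..<n} \<rightarrow> carrier U \<Longrightarrow> comb v \<in> \<Omega>"
  unfolding comb_def by (intro Omega_finsum comb_terms) auto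

lemma comb_cong: "(\<And>j. j < n \<Longrightarrow> v j (y j) = w j (y j)) \<Longrightarrow> v \<in> {..<n} \<rightarrow> carrier U \<Longrightarrow> w \<in> {..<n} \<rightarrow> carrier U
   \<Longrightarrow> comb v = comb w"
  unfolding comb_def by (intro C.M.finsum_cong') (auto simp: Pi_iff)

lemma comb_add:
  assumes "v \<in> {..<n} \<rightarrow> carrier U" "w \<in> {..<n} \<rightarrow> carrier U"
  shows "comb (\<lambda>j. v j \<oplus>\<^bsub>U\<^esub> w j) = comb v \<oplus>\<^bsub>C\<^esub> comb w"
proof -
  have "comb (\<lambda>j. v j \<oplus>\<^bsub>U\<^esub> w j) = (\<Oplus>\<^bsub>C\<^esub>j\<in>{..<n}. v j (y j) \<oplus>\<^bsub>C\<^esub> w j (y j))"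
    unfolding comb_def by (intro C.M.finsum_cong') (use assms in \<open>auto simp: Pi_iff U_simps\<close>)
  also have "\<dots> = comb v \<oplus>\<^bsub>C\<^esub> comb w"
    unfolding comb_def by (rule C.M.finsum_addf) (use assms in \<open>auto simp: Pi_iff\<close>)
  finally show ?thesis .
qed

lemma comb_U:
  assumes "a \<in> carrier U" "v \<in> {..<n} \<rightarrow> carrier U"
  shows "a (comb v) = comb (\<lambda>j. a \<otimes>\<^bsub>U\<^esub> v j)"
proof -
  have "a (comb v) = (\<Oplus>\<^bsub>C\<^esub>j\<in>{..<n}. a (v j (y j)))"
    unfolding comb_def by (rule Omega_map_finsum) (use assms in \<open>auto simp: Pi_iff U_map_lin\<close>)
  also have "\<dots> = comb (\<lambda>j. a \<otimes>\<^bsub>U\<^esub> v j)"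
    unfolding comb_def by (intro C.M.finsum_cong') (use assms in \<open>auto simp: Pi_iff U_simps\<close>)
  finally show ?thesis .
qed

lemma comb_single:
  assumes "k < n" "a \<in> carrier U"
  shows "comb (\<lambda>j. if j = k then a else \<zero>\<^bsub>U\<^esub>) = a (y k)"
proof -
  have "comb (\<lambda>j. if j = k then a else \<zero>\<^bsub>U\<^esub>) = (\<Oplus>\<^bsub>C\<^esub>j\<in>{..<n}. if k = j then a (y j) else \<zero>\<^bsub>C\<^esub>)"
    unfolding comb_def by (intro C.M.finsum_cong') (use assms in \<open>auto simp: Pi_iff U_simps\<close>)
  also have "\<dots> = a (y k)" by (rule C.M.finsum_singleton) (use assms in auto)
  finally show ?thesis .
qed

lemma comb_ex: "w \<in> \<Omega> \<Longrightarrow> \<exists>v \<in> {..<n} \<rightarrow> carrier U. w = comb v"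
proof (induction rule: Omega_induct)
  case (gen j)
  have "comb (\<lambda>k. if k = j then \<one>\<^bsub>U\<^esub> else \<zero>\<^bsub>U\<^esub>) = y j" using gen by (simp add: comb_single U_simps)
  moreover have "(\<lambda>k. if k = j then \<one>\<^bsub>U\<^esub> else \<zero>\<^bsub>U\<^esub>) \<in> {..<n} \<rightarrow> carrier U" by auto
  ultimately show ?case by metis
next
  case zero
  have "comb (\<lambda>k. \<zero>\<^bsub>U\<^esub>) = (\<Oplus>\<^bsub>C\<^esub>j\<in>{..<n}. \<zero>\<^bsub>C\<^esub>)"
    unfolding comb_def by (intro C.M.finsum_cong') (auto simp: U_simps)
  also have "\<dots> = \<zero>\<^bsub>C\<^esub>" by (rule C.M.finsum_zero)
  finally have "comb (\<lambda>k. \<zero>\<^bsub>U\<^esub>) = \<zero>\<^bsub>C\<^esub>" .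
  moreover have "(\<lambda>k. \<zero>\<^bsub>U\<^esub>) \<in> {..<n} \<rightarrow> carrier U" by auto
  ultimately show ?case by metis
next
  case (add v w)
  then obtain v' w' where *: "v' \<in> {..<n} \<rightarrow> carrier U" "v = comb v'" "w' \<in> {..<n} \<rightarrow> carrier U" "w = comb w'" by blast
  have "v \<oplus>\<^bsub>C\<^esub> w = comb (\<lambda>j. v' j \<oplus>\<^bsub>U\<^esub> w' j)" using * by (simp add: comb_add)
  moreover have "(\<lambda>j. v' j \<oplus>\<^bsub>U\<^esub> w' j) \<in> {..<n} \<rightarrow> carrier U" using * by (auto simp: Pi_iff)
  ultimately show ?case by blast
next
  case (smult c w)
  then obtain w' where *: "w' \<in> {..<n} \<rightarrow> carrier U" "w = comb w'" by blast
  \<comment> \<open>A scalar acts on \<open>Omega\<close> as the element \<open>c 1\<close> of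
    \<open>U\<close>, so the case is an instance of \<open>comb_U\<close>.\<close>
  have "c \<odot>\<^bsub>C\<^esub> w = (c \<odot>\<^bsub>U\<^esub> \<one>\<^bsub>U\<^esub>) w" using smult by (simp add: U_simps)
  also have "\<dots> = comb (\<lambda>j. (c \<odot>\<^bsub>U\<^esub> \<one>\<^bsub>U\<^esub>) \<otimes>\<^bsub>U\<^esub> w' j)" using smult * by (simp add: comb_U)
  finally have "c \<odot>\<^bsub>C\<^esub> w = comb (\<lambda>j. (c \<odot>\<^bsub>U\<^esub> \<one>\<^bsub>U\<^esub>) \<otimes>\<^bsub>U\<^esub> w' j)" .
  moreover have "(\<lambda>j. (c \<odot>\<^bsub>U\<^esub> \<one>\<^bsub>U\<^esub>) \<otimes>\<^bsub>U\<^esub> w' j) \<in> {..<n} \<rightarrow> carrier U"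
    using * smult by (auto simp: Pi_iff intro!: U.m_closed)
  ultimately show ?case by blast
next
  case (lmult a w)
  then obtain w' where *: "w' \<in> {..<n} \<rightarrow> carrier U" "w = comb w'" by blast
  have "a \<otimes>\<^bsub>C\<^esub> w = comb (\<lambda>j. L a \<otimes>\<^bsub>U\<^esub> w' j)" using lmult * comb_U[of "L a" w'] by (simp add: LR_apply)
  moreover have "(\<lambda>j. L a \<otimes>\<^bsub>U\<^esub> w' j) \<in> {..<n} \<rightarrow> carrier U"
    using * lmult by (auto simp: Pi_iff intro!: U.m_closed)
  ultimately show ?case by blast
next
  case (rmult a w)
  then obtain w' where *: "w' \<in> {..<n} \<rightarrow> carrier U" "w = comb w'" by blast
  have "w \<otimes>\<^bsub>C\<^esub> a = comb (\<lambda>j. R a \<otimes>\<^bsub>U\<^esub> w' j)" using rmult * comb_U[of "R a" w'] by (simp add: LR_apply)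
  moreover have "(\<lambda>j. R a \<otimes>\<^bsub>U\<^esub> w' j) \<in> {..<n} \<rightarrow> carrier U"
    using * rmult by (auto simp: Pi_iff intro!: U.m_closed)
  ultimately show ?case by blast
qed

text \<open>The endomorphism fixing the \<open>x\<close> variables and sending \<open>y j\<close> to \<open>w\<close> and the other \<open>y k\<close> to \<open>0\<close>
  commutes with \<open>U\<close>, so it reads off the \<open>j\<close>-th coefficient as an operator.\<close>

lemma comb_unique:
  assumes v: "v \<in> {..<n} \<rightarrow> carrier U" "v' \<in> {..<n} \<rightarrow> carrier U" "comb v = comb v'" and j: "j < n"
  shows "v j = v' j"
proof (rule U_eqI)
  show vj: "v j \<in> carrier U" "v' j \<in> carrier U" using v j by auto
  fix w assume w: "w \<in> \<Omega>"
  define g where "g = (\<lambda>z. case z of XVar i \<Rightarrow> x i | YVar i \<Rightarrow> if i = j then w else \<zero>\<^bsub>C\<^esub>)"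
  have gXY: "g z \<in> carrier (free_algebra K u M XY)" if "z \<in> XY" for z
    using that w unfolding g_def alg_C_def[symmetric] by (auto split: gen.splits)
  have "\<exists>h. h \<in> alg_hom K u C C \<and> (\<forall>z\<in>XY. h (cls (TVar z)) = g z)"
  proof (rule free_hom_ex[of XY g XY])
    show "g z \<in> carrier (free_algebra K u M XY)" if "z \<in> XY" for z by (rule gXY[OF that])
    fix h assume "h \<in> alg_hom K u (free_algebra K u M XY) (free_algebra K u M XY)"
      "\<And>z. z \<in> XY \<Longrightarrow> h (cls (TVar z)) = g z"
    thus "\<exists>h. h \<in> alg_hom K u C C \<and> (\<forall>z\<in>XY. h (cls (TVar z)) = g z)" unfolding alg_C_def by auto
  qed
  then obtain h where hC: "h \<in> alg_hom K u C C" and h: "\<forall>z\<in>XY. h (cls (TVar z)) = g z" by blast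
  from hC have hl: "linear_on K C C h" and hm: "mult_on C C h" and h1: "u \<longrightarrow> h \<one>\<^bsub>C\<^esub> = \<one>\<^bsub>C\<^esub>"
    unfolding alg_hom_iff by auto
  note hops = linear_onD[OF hl] mult_onD[OF hm] linear_on_zero[OF C.module_axioms C.module_axioms hl]
  have hx: "h (x i) = x i" if "i < n" for i
    using h[rule_format, of "XVar i"] that unfolding g_def by (simp add: gen_x_def)
  have hy: "h (y i) = (if i = j then w else \<zero>\<^bsub>C\<^esub>)" if "i < n" for i
    using h[rule_format, of "YVar i"] that unfolding g_def by (simp add: gen_y_def)
  have hA: "h a = a" if "a \<in> carrier A" for a
    using that
  proof (induction rule: A_induct)
    case one
    show ?case using h1 one by (rule mp)
  qed (simp_all add: hx hops)
  have hO: "h \<omega> \<in> \<Omega>" if "\<omega> \<in> \<Omega>" for \<omega>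
    using that by (induction rule: Omega_induct) (use w in \<open>simp_all add: hy hops hA\<close>)
  have hU: "\<forall>\<omega>\<in>\<Omega>. h (a \<omega>) = a (h \<omega>)" if "a \<in> carrier U" for a
    using that by (induction rule: U_induct) (simp_all add: LR_apply U_simps hops hA hO)
  have ev: "h (comb v) = v j w" if v: "v \<in> {..<n} \<rightarrow> carrier U" for v
  proof -
    have "h (comb v) = (\<Oplus>\<^bsub>C\<^esub>i\<in>{..<n}. h (v i (y i)))"
      unfolding comb_def by (rule Omega_map_finsum) (use v in \<open>auto simp: hops Pi_iff\<close>)
    also have "\<dots> = (\<Oplus>\<^bsub>C\<^esub>i\<in>{..<n}. if j = i then v i w else \<zero>\<^bsub>C\<^esub>)"
      by (intro C.M.finsum_cong') (use v w hU hy in \<open>auto simp: Pi_iff\<close>)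
    also have "\<dots> = v j w" by (rule C.M.finsum_singleton) (use v j w in \<open>auto simp: Pi_iff\<close>)
    finally show ?thesis .
  qed
  show "v j w = v' j w" using ev[OF v(1)] ev[OF v(2)] v(3) by simp
qed

text \<open>The description agrees with that of \<open>fox_der\<close>, so the partial derivatives
  of a are the coordinates of \<open>univ_d a\<close>.\<close>

definition crd :: "'k elem \<Rightarrow> nat \<Rightarrow> 'k elem \<Rightarrow> 'k elem" where
  "crd w = (THE v. v \<in> {..<n} \<rightarrow>\<^sub>E carrier U \<and> w = (\<Oplus>\<^bsub>C\<^esub>j\<in>{..<n}. v j (y j)))"

lemma crd_props:
  assumes "w \<in> \<Omega>"
  shows "crd w \<in> {..<n} \<rightarrow> carrier U" "comb (crd w) = w"
proof -
  obtain v where v: "v \<in> {..<n} \<rightarrow> carrier U" "w = comb v" using comb_ex[OF assms] by blast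
  have rc: "comb (restrict v {..<n}) = comb v" by (rule comb_cong) (use v in auto)
  have "\<exists>!v. v \<in> {..<n} \<rightarrow>\<^sub>E carrier U \<and> w = (\<Oplus>\<^bsub>C\<^esub>j\<in>{..<n}. v j (y j))"
  proof (rule ex1I[of _ "restrict v {..<n}"])
    show "restrict v {..<n} \<in> {..<n} \<rightarrow>\<^sub>E carrier U \<and> w = (\<Oplus>\<^bsub>C\<^esub>j\<in>{..<n}. restrict v {..<n} j (y j))"
      using v rc unfolding comb_def by auto
    fix v' assume v': "v' \<in> {..<n} \<rightarrow>\<^sub>E carrier U \<and> w = (\<Oplus>\<^bsub>C\<^esub>j\<in>{..<n}. v' j (y j))"
    hence v'2: "v' \<in> {..<n} \<rightarrow> carrier U" "w = comb v'" by (auto simp: comb_def PiE_def)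
    show "v' = restrict v {..<n}"
    proof (rule extensionalityI[of _ "{..<n}"])
      fix j assume "j \<in> {..<n}"
      thus "v' j = restrict v {..<n} j" using comb_unique[OF v'2(1) v(1)] v v'2 by simp
    qed (use v' in \<open>auto simp: PiE_def\<close>)
  qed
  from theI'[OF this] show "crd w \<in> {..<n} \<rightarrow> carrier U" "comb (crd w) = w"
    unfolding crd_def comb_def by (auto simp: PiE_def)
qed

lemma fox_der_eq: "a \<in> carrier A \<Longrightarrow> fox_der K u M n a = crd (univ_d a)"
  unfolding fox_der_def crd_def by (simp add: univ_der_eq)

lemma crd_closed [simp]: "\<lbrakk>w \<in> \<Omega>; j < n\<rbrakk> \<Longrightarrow> crd w j \<in> carrier U"
  using crd_props(1) by auto

lemma crd_eqI: "\<lbrakk>v \<in> {..<n} \<rightarrow> carrier U; w = comb v; j < n\<rbrakk> \<Longrightarrow> crd w j = v j"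
  using comb_unique[OF crd_props(1)[of w], of v j] crd_props(2)[of w] comb_closed[of v] by simp

text \<open>The elements of the dual \<open>Hom_U(Omega, U)\<close>, where \<open>U\<close> acts on
  \<open>Omega\<close> by application. Linearity over K is implied, since scalars are multiples of
  the identity of \<open>U\<close>.\<close>

definition functional :: "('k elem \<Rightarrow> 'k elem \<Rightarrow> 'k elem) \<Rightarrow> bool" where
  "functional c \<longleftrightarrow> (\<forall>w\<in>\<Omega>. c w \<in> carrier U) \<and> (\<forall>v\<in>\<Omega>. \<forall>w\<in>\<Omega>. c (v \<oplus>\<^bsub>C\<^esub> w) = c v \<oplus>\<^bsub>U\<^esub> c w) \<and>
     (\<forall>a\<in>carrier U. \<forall>w\<in>\<Omega>. c (a w) = a \<otimes>\<^bsub>U\<^esub> c w)"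

lemma functionalD:
  assumes "functional c"
  shows "w \<in> \<Omega> \<Longrightarrow> c w \<in> carrier U" "\<lbrakk>v \<in> \<Omega>; w \<in> \<Omega>\<rbrakk> \<Longrightarrow> c (v \<oplus>\<^bsub>C\<^esub> w) = c v \<oplus>\<^bsub>U\<^esub> c w"
    "\<lbrakk>a \<in> carrier U; w \<in> \<Omega>\<rbrakk> \<Longrightarrow> c (a w) = a \<otimes>\<^bsub>U\<^esub> c w"
  using assms unfolding functional_def by auto

lemma functional_zero: "functional c \<Longrightarrow> c \<zero>\<^bsub>C\<^esub> = \<zero>\<^bsub>U\<^esub>"
  using functionalD(1)[of c "\<zero>\<^bsub>C\<^esub>"] functionalD(3)[of c "\<zero>\<^bsub>U\<^esub>" "\<zero>\<^bsub>C\<^esub>"] by (simp add: U_simps)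

lemma functional_smult:
  assumes "functional c" "k \<in> carrier K" "w \<in> \<Omega>" shows "c (k \<odot>\<^bsub>C\<^esub> w) = k \<odot>\<^bsub>U\<^esub> c w"
proof -
  have "k \<odot>\<^bsub>C\<^esub> w = (k \<odot>\<^bsub>U\<^esub> \<one>\<^bsub>U\<^esub>) w" using assms by (simp add: U_simps)
  thus ?thesis using functionalD[OF assms(1)] assms by (simp add: U.smult_l)
qed

lemma crd_functional: "j < n \<Longrightarrow> functional (\<lambda>w. crd w j)"
  unfolding functional_def
proof (intro conjI ballI)
  assume j: "j < n"
  fix w assume w: "w \<in> \<Omega>"
  show "crd w j \<in> carrier U" using w j by simp
  show "crd (v \<oplus>\<^bsub>C\<^esub> w) j = crd v j \<oplus>\<^bsub>U\<^esub> crd w j" if "v \<in> \<Omega>" for v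
    by (rule crd_eqI[of "\<lambda>j. crd v j \<oplus>\<^bsub>U\<^esub> crd w j"])
      (use j w that crd_props in \<open>auto simp: comb_add\<close>)
  show "crd (a w) j = a \<otimes>\<^bsub>U\<^esub> crd w j" if "a \<in> carrier U" for a
    by (rule crd_eqI[of "\<lambda>j. a \<otimes>\<^bsub>U\<^esub> crd w j"])
      (use j w that crd_props comb_U[of a "crd w"] in \<open>auto intro!: U.m_closed\<close>)
qed

lemma crd_y: "\<lbrakk>j < n; k < n\<rbrakk> \<Longrightarrow> crd (y k) j = (if j = k then \<one>\<^bsub>U\<^esub> else \<zero>\<^bsub>U\<^esub>)"
  by (rule crd_eqI[of "\<lambda>j. if j = k then \<one>\<^bsub>U\<^esub> else \<zero>\<^bsub>U\<^esub>"]) (auto simp: comb_single U_simps)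

text \<open>The product rule for an operator applied to a vector gives
  \<open>E(v y) = delta(v) y + v(E y)\<close>, and the Euler derivation kills the y. Differentiating
  a transition matrix entrywise by \<open>delta\<close> thus amounts to applying the Euler
  derivation to the vectors.\<close>

lemma crd_euler:
  assumes w: "w \<in> \<Omega>" and j: "j < n" shows "crd (euler w) j = delta (crd w j)"
proof (rule crd_eqI[of "\<lambda>j. delta (crd w j)"])
  show "(\<lambda>j. delta (crd w j)) \<in> {..<n} \<rightarrow> carrier U" using w by auto
  have "euler w = euler (comb (crd w))" using crd_props(2)[OF w] by simp
  also have "\<dots> = (\<Oplus>\<^bsub>C\<^esub>j\<in>{..<n}. euler (crd w j (y j)))"
    unfolding comb_def by (rule Omega_map_finsum) (use w in \<open>auto simp: euler_ops\<close>)
  also have "\<dots> = comb (\<lambda>j. delta (crd w j))"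
    unfolding comb_def
    by (intro C.M.finsum_cong') (use w in \<open>auto simp: Pi_iff delta_apply euler_props\<close>)
  finally show "euler w = comb (\<lambda>j. delta (crd w j))" .
qed fact

end

lemma (in lin_space) submodule_finsum:
  assumes "submodule H K W" "finite I" "f \<in> I \<rightarrow> H"
  shows "(\<Oplus>\<^bsub>W\<^esub>i\<in>I. f i) \<in> H"
  using assms(2,3)
proof (induction I)
  case empty
  then show ?case using submodule_zero[OF assms(1)] by simp
next
  case (insert i I)
  hence f: "f i \<in> H" "f \<in> I \<rightarrow> H" by auto
  moreover have "f \<in> I \<rightarrow> carrier W" "f i \<in> carrier W" using f submoduleE(1)[OF assms(1)] by auto
  ultimately show ?case using insert submoduleE(5)[OF assms(1)] by simp
qed

context free_xy
begin

subsection \<open>Bases with vanishing logarithmic trace\<close>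

abbreviation "CU \<equiv> commutator_span K U"

lemma commutators_closed:
  "{(a \<otimes>\<^bsub>U\<^esub> b) \<ominus>\<^bsub>U\<^esub> (b \<otimes>\<^bsub>U\<^esub> a) | a b. a \<in> carrier U \<and> b \<in> carrier U} \<subseteq> carrier U"
  by (auto simp: U.m_closed)

lemma CU_submodule: "submodule CU K U"
  unfolding commutator_span_def by (rule U.lin_span_submodule[OF commutators_closed])

lemma commutator_CU: "\<lbrakk>a \<in> carrier U; b \<in> carrier U\<rbrakk> \<Longrightarrow> (a \<otimes>\<^bsub>U\<^esub> b) \<ominus>\<^bsub>U\<^esub> (b \<otimes>\<^bsub>U\<^esub> a) \<in> CU"
  unfolding commutator_span_def by (rule U.lin_span_incl) auto

text \<open>A derivation satisfies \<open>delta [a,b] = [delta a, b] + [a, delta b]\<close>. The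
  invariance is what allows a homogeneous component to be extracted inside
  \<open>[U,U]\<close>.\<close>

lemma delta_CU: "s \<in> CU \<Longrightarrow> delta s \<in> CU"
proof -
  note CU = U.submoduleE[OF CU_submodule]
  assume "s \<in> CU"
  thus ?thesis using commutators_closed unfolding commutator_span_def
  proof (induction rule: U.lin_span_induct)
    case (base s)
    then obtain a b where ab: "a \<in> carrier U" "b \<in> carrier U" "s = (a \<otimes>\<^bsub>U\<^esub> b) \<ominus>\<^bsub>U\<^esub> (b \<otimes>\<^bsub>U\<^esub> a)" by blast
    have "delta s = delta (a \<otimes>\<^bsub>U\<^esub> b) \<ominus>\<^bsub>U\<^esub> delta (b \<otimes>\<^bsub>U\<^esub> a)"
      unfolding ab(3) by (rule linear_on_minus[OF U.module_axioms U.module_axioms delta_lin]) (use ab in \<open>simp_all add: U.m_closed\<close>)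
    also have "\<dots> = (delta a \<otimes>\<^bsub>U\<^esub> b \<ominus>\<^bsub>U\<^esub> b \<otimes>\<^bsub>U\<^esub> delta a) \<oplus>\<^bsub>U\<^esub> (a \<otimes>\<^bsub>U\<^esub> delta b \<ominus>\<^bsub>U\<^esub> delta b \<otimes>\<^bsub>U\<^esub> a)"
      using ab(1,2) by (simp add: delta_ops U.m_closed a_minus_def U.M.minus_add U.M.a_ac)
    finally show ?case
      using CU(5)[OF commutator_CU[of "delta a" b] commutator_CU[of a "delta b"]] ab(1,2)
      unfolding commutator_span_def by simp
  next
    case zero
    show ?case using U.submodule_zero[OF CU_submodule] unfolding commutator_span_def by (simp add: delta_zero)
  next
    case (add v w)
    then show ?case using CU(5) unfolding commutator_span_def by (simp add: delta_ops)
  next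
    case (smult c v)
    then show ?case using CU(4) unfolding commutator_span_def by (simp add: delta_ops)
  qed
qed

text \<open>With respect to a basis \<open>Y\<close> of \<open>\<Omega>\<close>, given by its dual functionals \<open>c\<close>, the sum below is the
  trace of \<open>P\<^sup>-\<^sup>1 \<delta>(P)\<close> where \<open>P\<close> expresses \<open>Y\<close> in the \<open>y j\<close>.\<close>

definition dual_basis :: "(nat \<Rightarrow> 'k elem) \<Rightarrow> (nat \<Rightarrow> 'k elem \<Rightarrow> 'k elem \<Rightarrow> 'k elem) \<Rightarrow> bool" where
  "dual_basis Y c \<longleftrightarrow> (\<forall>j<n. Y j \<in> \<Omega>) \<and> (\<forall>j<n. functional (c j)) \<and>
     (\<forall>j<n. \<forall>k<n. c j (Y k) = (if j = k then \<one>\<^bsub>U\<^esub> else \<zero>\<^bsub>U\<^esub>))"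

text \<open>The functionals c play the role of the inverse matrix. Each elementary change of Y
  updates them by an explicit formula, so no matrix over the noncommutative algebra \<open>U\<close>
  is ever inverted; being dual to Y is all that is recorded of them.\<close>

definition log_traceless :: "(nat \<Rightarrow> 'k elem) \<Rightarrow> bool" where
  "log_traceless Y \<longleftrightarrow> (\<exists>c. dual_basis Y c \<and> (\<Oplus>\<^bsub>U\<^esub>j\<in>{..<n}. c j (euler (Y j))) \<in> CU)"

lemma dual_basisD:
  assumes "dual_basis Y c"
  shows "j < n \<Longrightarrow> Y j \<in> \<Omega>" "j < n \<Longrightarrow> functional (c j)"
    "\<lbrakk>j < n; k < n\<rbrakk> \<Longrightarrow> c j (Y k) = (if j = k then \<one>\<^bsub>U\<^esub> else \<zero>\<^bsub>U\<^esub>)"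
  using assms unfolding dual_basis_def by auto

lemma log_traceless_cong: "log_traceless Y \<Longrightarrow> (\<And>j. j < n \<Longrightarrow> Y j = Z j) \<Longrightarrow> log_traceless Z"
proof -
  assume "log_traceless Y" and YZ: "\<And>j. j < n \<Longrightarrow> Y j = Z j"
  then obtain c where c: "dual_basis Y c" "(\<Oplus>\<^bsub>U\<^esub>j\<in>{..<n}. c j (euler (Y j))) \<in> CU" unfolding log_traceless_def by blast
  have "dual_basis Z c" using c(1) YZ unfolding dual_basis_def by simp
  moreover have "(\<Oplus>\<^bsub>U\<^esub>j\<in>{..<n}. c j (euler (Z j))) = (\<Oplus>\<^bsub>U\<^esub>j\<in>{..<n}. c j (euler (Y j)))"
    by (rule U.M.finsum_cong') (use YZ dual_basisD[OF c(1)] functionalD(1) in auto)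
  ultimately show ?thesis using c(2) unfolding log_traceless_def by auto
qed

lemma log_traceless_y: "log_traceless y"
proof -
  have z: "crd (euler (y j)) j = \<zero>\<^bsub>U\<^esub>" if "j < n" for j
    using functional_zero[OF crd_functional[OF that]] that by (simp add: euler_props)
  have "(\<Oplus>\<^bsub>U\<^esub>j\<in>{..<n}. crd (euler (y j)) j) = (\<Oplus>\<^bsub>U\<^esub>j\<in>{..<n}. \<zero>\<^bsub>U\<^esub>)"
    by (rule U.M.finsum_cong') (use z in auto)
  hence "(\<Oplus>\<^bsub>U\<^esub>j\<in>{..<n}. crd (euler (y j)) j) \<in> CU" using U.submodule_zero[OF CU_submodule] by simp
  moreover have "dual_basis y (\<lambda>j w. crd w j)"
    unfolding dual_basis_def using crd_functional crd_y by simp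
  ultimately show ?thesis unfolding log_traceless_def by blast
qed

lemma functional_scale:
  assumes "functional c" "k \<in> carrier K" shows "functional (\<lambda>w. k \<odot>\<^bsub>U\<^esub> c w)"
  using functionalD[OF assms(1)] assms(2) unfolding functional_def
  by (simp add: U.smult_r_distr U.smult_r)

text \<open>The Euler derivation is linear over K, and the inverse scalar in the new functional
  cancels \<open>\<alpha>\<close>, so every summand of the trace stays the same.\<close>

lemma log_traceless_scale:
  assumes "log_traceless Y" "j < n" "\<alpha> \<in> carrier K" "\<alpha> \<noteq> \<zero>\<^bsub>K\<^esub>"
  shows "log_traceless (Y(j := \<alpha> \<odot>\<^bsub>C\<^esub> Y j))"
proof -
  obtain c where c: "dual_basis Y c" "(\<Oplus>\<^bsub>U\<^esub>j\<in>{..<n}. c j (euler (Y j))) \<in> CU"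
    using assms(1) unfolding log_traceless_def by blast
  note b = dual_basisD[OF c(1)]
  obtain \<beta> where \<beta>: "\<beta> \<in> carrier K" "\<beta> \<otimes>\<^bsub>K\<^esub> \<alpha> = \<one>\<^bsub>K\<^esub>" using inverse_ex[OF assms(3,4)] by blast
  define c' where "c' = c(j := \<lambda>w. \<beta> \<odot>\<^bsub>U\<^esub> c j w)"
  let ?Y = "Y(j := \<alpha> \<odot>\<^bsub>C\<^esub> Y j)"
  have sm: "\<beta> \<odot>\<^bsub>U\<^esub> (\<alpha> \<odot>\<^bsub>U\<^esub> v) = v" if "v \<in> carrier U" for v
    using that \<beta> assms(3) by (simp add: U.smult_assoc1[symmetric])
  have "dual_basis ?Y c'"
    unfolding dual_basis_def
  proof (intro conjI allI impI)
    fix k assume k: "k < n"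
    show "?Y k \<in> \<Omega>" using b(1)[OF k] b(1)[OF assms(2)] assms(3) by simp
    show "functional (c' k)" using b(2)[OF k] functional_scale[OF b(2)[OF assms(2)] \<beta>(1)] by (simp add: c'_def)
    fix l assume l: "l < n"
    show "c' k (?Y l) = (if k = l then \<one>\<^bsub>U\<^esub> else \<zero>\<^bsub>U\<^esub>)"
      using b(3)[OF k l] functional_smult[OF b(2)[OF k] assms(3) b(1)[OF l]] sm[of "\<one>\<^bsub>U\<^esub>"] \<beta> assms(3)
      by (auto simp: c'_def)
  qed
  moreover have "(\<Oplus>\<^bsub>U\<^esub>k\<in>{..<n}. c' k (euler (?Y k))) = (\<Oplus>\<^bsub>U\<^esub>k\<in>{..<n}. c k (euler (Y k)))"
  proof (rule U.M.finsum_cong')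
    fix k assume "k \<in> {..<n}"
    hence k: "k < n" by simp
    show "c' k (euler (?Y k)) = c k (euler (Y k))"
      using b(1)[OF k] functional_smult[OF b(2)[OF k] assms(3), of "euler (Y k)"] sm[of "c k (euler (Y k))"]
        functionalD(1)[OF b(2)[OF k], of "euler (Y k)"] assms(3)
      by (cases "k = j") (simp_all add: c'_def euler_ops)
  qed (use functionalD(1) b in auto)
  ultimately show ?thesis using c(2) unfolding log_traceless_def by auto
qed

text \<open>Right multiplication commutes with the left action of \<open>U\<close>. Combinations of
  this shape are the new dual functionals after an elementary change, and with \<open>a = 1\<close>
  they are differences of functionals.\<close>

lemma functional_minus_mult:
  assumes "functional c" "functional c'" "a \<in> carrier U"
  shows "functional (\<lambda>w. c w \<ominus>\<^bsub>U\<^esub> c' w \<otimes>\<^bsub>U\<^esub> a)"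
  unfolding functional_def
proof (intro conjI ballI)
  note f = functionalD[OF assms(1)] functionalD[OF assms(2)]
  fix w assume w: "w \<in> \<Omega>"
  show "c w \<ominus>\<^bsub>U\<^esub> c' w \<otimes>\<^bsub>U\<^esub> a \<in> carrier U" using f w assms(3) U.m_closed by simp
  show "c (v \<oplus>\<^bsub>C\<^esub> w) \<ominus>\<^bsub>U\<^esub> c' (v \<oplus>\<^bsub>C\<^esub> w) \<otimes>\<^bsub>U\<^esub> a
      = (c v \<ominus>\<^bsub>U\<^esub> c' v \<otimes>\<^bsub>U\<^esub> a) \<oplus>\<^bsub>U\<^esub> (c w \<ominus>\<^bsub>U\<^esub> c' w \<otimes>\<^bsub>U\<^esub> a)" if "v \<in> \<Omega>" for v
    using f w that assms(3) by (simp add: U.m_closed U.l_distr a_minus_def U.M.minus_add U.M.a_ac)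
  show "c (b w) \<ominus>\<^bsub>U\<^esub> c' (b w) \<otimes>\<^bsub>U\<^esub> a = b \<otimes>\<^bsub>U\<^esub> (c w \<ominus>\<^bsub>U\<^esub> c' w \<otimes>\<^bsub>U\<^esub> a)" if "b \<in> carrier U" for b
    using f w that assms(3) by (simp add: U.m_closed U.r_distr a_minus_def U.minus_mult U_assoc)
qed

text \<open>An elementary basis change modifies the trace by a single commutator.\<close>

lemma log_traceless_add:
  assumes "log_traceless Y" "j < n" "l < n" "l \<noteq> j" "a \<in> carrier U"
  shows "log_traceless (Y(j := Y j \<oplus>\<^bsub>C\<^esub> a (Y l)))"
proof -
  obtain c where c: "dual_basis Y c" "(\<Oplus>\<^bsub>U\<^esub>j\<in>{..<n}. c j (euler (Y j))) \<in> CU"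
    using assms(1) unfolding log_traceless_def by blast
  note b = dual_basisD[OF c(1)]
  \<comment> \<open>Read off from
    \<open>c_j Y_j + c_l Y_l = c_j (Y_j + a Y_l) + (c_l - c_j a) Y_l\<close>.\<close>
  define c' where "c' = c(l := \<lambda>w. c l w \<ominus>\<^bsub>U\<^esub> c j w \<otimes>\<^bsub>U\<^esub> a)"
  let ?Y = "Y(j := Y j \<oplus>\<^bsub>C\<^esub> a (Y l))"
  note bj = b(1)[OF assms(2)] b(2)[OF assms(2)] and bl = b(1)[OF assms(3)] b(2)[OF assms(3)]
  have "dual_basis ?Y c'"
    unfolding dual_basis_def
  proof (intro conjI allI impI)
    fix k assume k: "k < n"
    show "?Y k \<in> \<Omega>" using b(1)[OF k] bj bl assms(5) by simp
    show "functional (c' k)" using b(2)[OF k] functional_minus_mult[OF bl(2) bj(2) assms(5)] by (simp add: c'_def)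
    fix m assume m: "m < n"
    have e: "c k (?Y m) = (if k = m then \<one>\<^bsub>U\<^esub> else if m = j \<and> k = l then a else \<zero>\<^bsub>U\<^esub>)" if "k < n" for k
      using b(3)[OF that m] b(3)[OF that assms(2)] b(3)[OF that assms(3)]
        functionalD(2)[OF b(2)[OF that] bj(1), of "a (Y l)"] functionalD(3)[OF b(2)[OF that] assms(5) bl(1)]
        bl assms(4,5) by auto
    show "c' k (?Y m) = (if k = m then \<one>\<^bsub>U\<^esub> else \<zero>\<^bsub>U\<^esub>)"
      using e[OF k] e[OF assms(2)] assms(4,5)
      by (auto simp: c'_def a_minus_def U.M.r_neg)
  qed
  moreover have "(\<Oplus>\<^bsub>U\<^esub>k\<in>{..<n}. c' k (euler (?Y k))) \<in> CU"
  proof -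
    \<comment> \<open>The summand at j gains \<open>a z\<close> and the summand at l loses
      \<open>z a\<close>; the trace changes by the commutator of a and z.\<close>
    let ?z = "c j (euler (Y l))"
    have z: "?z \<in> carrier U" using functionalD(1)[OF bj(2)] bl by simp
    have az: "a \<otimes>\<^bsub>U\<^esub> ?z \<in> carrier U" "?z \<otimes>\<^bsub>U\<^esub> a \<in> carrier U" using z assms U.m_closed by auto
    have fc: "c k (euler (Y k)) \<in> carrier U" if "k < n" for k
      using functionalD(1)[OF b(2)[OF that]] b(1)[OF that] by simp
    have "(\<Oplus>\<^bsub>U\<^esub>k\<in>{..<n}. c' k (euler (?Y k))) = (\<Oplus>\<^bsub>U\<^esub>k\<in>{..<n}. c k (euler (Y k)) \<oplus>\<^bsub>U\<^esub>
        ((if j = k then a \<otimes>\<^bsub>U\<^esub> ?z else \<zero>\<^bsub>U\<^esub>) \<oplus>\<^bsub>U\<^esub> (if l = k then \<ominus>\<^bsub>U\<^esub> (?z \<otimes>\<^bsub>U\<^esub> a) else \<zero>\<^bsub>U\<^esub>)))"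
    proof (rule U.M.finsum_cong')
      fix k assume "k \<in> {..<n}"
      hence k: "k < n" by simp
      show "c' k (euler (?Y k)) = c k (euler (Y k)) \<oplus>\<^bsub>U\<^esub>
        ((if j = k then a \<otimes>\<^bsub>U\<^esub> ?z else \<zero>\<^bsub>U\<^esub>) \<oplus>\<^bsub>U\<^esub> (if l = k then \<ominus>\<^bsub>U\<^esub> (?z \<otimes>\<^bsub>U\<^esub> a) else \<zero>\<^bsub>U\<^esub>))"
      proof (cases "k = j")
        case True
        \<comment> \<open>The term with \<open>delta a\<close> contributes nothing to the trace: its
          coefficient at j is \<open>delta a\<close> times \<open>c_j(Y_l)\<close>, which is zero as
          l differs from j.\<close>
        have "euler (a (Y l)) = delta a (Y l) \<oplus>\<^bsub>C\<^esub> a (euler (Y l))" by (rule delta_apply[OF assms(5) bl(1)])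
        moreover have "c j (delta a (Y l)) = \<zero>\<^bsub>U\<^esub>"
          using functionalD(3)[OF bj(2) delta_closed[OF assms(5)] bl(1)] b(3)[OF assms(2,3)] assms(4,5) by simp
        moreover have "c j (a (euler (Y l))) = a \<otimes>\<^bsub>U\<^esub> ?z" using functionalD(3)[OF bj(2) assms(5)] bl by simp
        ultimately have "c j (euler (Y j \<oplus>\<^bsub>C\<^esub> a (Y l))) = c j (euler (Y j)) \<oplus>\<^bsub>U\<^esub> a \<otimes>\<^bsub>U\<^esub> ?z"
          using functionalD(2)[OF bj(2)] bj bl assms(5) az by (simp add: euler_ops)
        thus ?thesis using True assms(4) az by (simp add: c'_def)
      next
        case False
        thus ?thesis using fc[OF k] az by (simp add: c'_def a_minus_def)
      qed
    qed (use fc az in auto)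
    also have "\<dots> = (\<Oplus>\<^bsub>U\<^esub>k\<in>{..<n}. c k (euler (Y k))) \<oplus>\<^bsub>U\<^esub>
        ((\<Oplus>\<^bsub>U\<^esub>k\<in>{..<n}. if j = k then a \<otimes>\<^bsub>U\<^esub> ?z else \<zero>\<^bsub>U\<^esub>) \<oplus>\<^bsub>U\<^esub>
         (\<Oplus>\<^bsub>U\<^esub>k\<in>{..<n}. if l = k then \<ominus>\<^bsub>U\<^esub> (?z \<otimes>\<^bsub>U\<^esub> a) else \<zero>\<^bsub>U\<^esub>))"
    proof -
      have "(\<lambda>k. c k (euler (Y k))) \<in> {..<n} \<rightarrow> carrier U"
        "(\<lambda>k. if j = k then a \<otimes>\<^bsub>U\<^esub> ?z else \<zero>\<^bsub>U\<^esub>) \<in> {..<n} \<rightarrow> carrier U"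
        "(\<lambda>k. if l = k then \<ominus>\<^bsub>U\<^esub> (?z \<otimes>\<^bsub>U\<^esub> a) else \<zero>\<^bsub>U\<^esub>) \<in> {..<n} \<rightarrow> carrier U"
        "(\<lambda>k. (if j = k then a \<otimes>\<^bsub>U\<^esub> ?z else \<zero>\<^bsub>U\<^esub>) \<oplus>\<^bsub>U\<^esub> (if l = k then \<ominus>\<^bsub>U\<^esub> (?z \<otimes>\<^bsub>U\<^esub> a) else \<zero>\<^bsub>U\<^esub>)) \<in> {..<n} \<rightarrow> carrier U"
        using fc az by auto
      thus ?thesis by (simp add: U.M.finsum_addf)
    qed
    also have "(\<Oplus>\<^bsub>U\<^esub>k\<in>{..<n}. if j = k then a \<otimes>\<^bsub>U\<^esub> ?z else \<zero>\<^bsub>U\<^esub>) = a \<otimes>\<^bsub>U\<^esub> ?z"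
      by (rule U.M.finsum_singleton) (use assms az in auto)
    also have "(\<Oplus>\<^bsub>U\<^esub>k\<in>{..<n}. if l = k then \<ominus>\<^bsub>U\<^esub> (?z \<otimes>\<^bsub>U\<^esub> a) else \<zero>\<^bsub>U\<^esub>) = \<ominus>\<^bsub>U\<^esub> (?z \<otimes>\<^bsub>U\<^esub> a)"
      by (rule U.M.finsum_singleton[where f = "\<lambda>_. \<ominus>\<^bsub>U\<^esub> (?z \<otimes>\<^bsub>U\<^esub> a)"]) (use assms az in auto)
    finally have "(\<Oplus>\<^bsub>U\<^esub>k\<in>{..<n}. c' k (euler (?Y k))) =
        (\<Oplus>\<^bsub>U\<^esub>k\<in>{..<n}. c k (euler (Y k))) \<oplus>\<^bsub>U\<^esub> (a \<otimes>\<^bsub>U\<^esub> ?z \<ominus>\<^bsub>U\<^esub> ?z \<otimes>\<^bsub>U\<^esub> a)" by (simp add: a_minus_def)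
    thus ?thesis using U.submoduleE(5)[OF CU_submodule c(2) commutator_CU[OF assms(5) z]] by simp
  qed
  ultimately show ?thesis unfolding log_traceless_def by blast
qed

text \<open>By the product rule \<open>univ_d f\<close> is a combination over \<open>U\<close> of
  the vectors \<open>univ_d (X l)\<close> with l different from j. Adding it to the j-th vector is
  therefore a succession of elementary basis changes.\<close>

lemma log_traceless_elementary:
  assumes X: "\<And>l. l < n \<Longrightarrow> X l \<in> carrier A" and log_traceless: "log_traceless (\<lambda>l. univ_d (X l))" and j: "j < n"
    and \<alpha>: "\<alpha> \<in> carrier K" "\<alpha> \<noteq> \<zero>\<^bsub>K\<^esub>" and f: "f \<in> gen_subalgebra K u A (X ` ({..<n} - {j}))"
  shows "log_traceless (\<lambda>l. univ_d ((X(j := \<alpha> \<odot>\<^bsub>A\<^esub> X j \<oplus>\<^bsub>A\<^esub> f)) l))"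
proof -
  \<comment> \<open>The quantifier over Y lets additions at place j be chained: after one of them
    the j-th vector is a new one, while the others are still the
    \<open>univ_d (X l)\<close>.\<close>
  define Q where "Q w \<longleftrightarrow> (\<forall>Y. log_traceless Y \<longrightarrow> (\<forall>l<n. l \<noteq> j \<longrightarrow> Y l = univ_d (X l)) \<longrightarrow> log_traceless (Y(j := Y j \<oplus>\<^bsub>C\<^esub> w)))" for w
  \<comment> \<open>Quantifying over all operators makes S stable under \<open>U\<close>, which the
    product rule requires.\<close>
  define S where "S = {w \<in> \<Omega>. \<forall>a\<in>carrier U. Q (a w)}"
  have goodc: "Y j \<in> carrier C" if "log_traceless Y" for Y
    using that j unfolding log_traceless_def dual_basis_def by auto
  have Qadd: "Q (v \<oplus>\<^bsub>C\<^esub> w)" if vw: "v \<in> \<Omega>" "w \<in> \<Omega>" "Q v" "Q w" for v w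
    unfolding Q_def
  proof (intro allI impI)
    fix Y assume Y: "log_traceless Y" "\<forall>l<n. l \<noteq> j \<longrightarrow> Y l = univ_d (X l)"
    let ?Z = "Y(j := Y j \<oplus>\<^bsub>C\<^esub> v)"
    have "log_traceless ?Z" using vw(3) Y unfolding Q_def by blast
    moreover have "\<forall>l<n. l \<noteq> j \<longrightarrow> ?Z l = univ_d (X l)" using Y(2) by simp
    ultimately have "log_traceless (?Z(j := ?Z j \<oplus>\<^bsub>C\<^esub> w))" using vw(4) unfolding Q_def by blast
    thus "log_traceless (Y(j := Y j \<oplus>\<^bsub>C\<^esub> (v \<oplus>\<^bsub>C\<^esub> w)))" using goodc[OF Y(1)] vw by (simp add: C.M.a_assoc)
  qed
  have Q0: "Q \<zero>\<^bsub>C\<^esub>"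
    unfolding Q_def using goodc by simp
  have Sadd: "v \<oplus>\<^bsub>C\<^esub> w \<in> S" if "v \<in> S" "w \<in> S" for v w
    using that Qadd unfolding S_def by (simp add: U_map_lin)
  have SU: "a w \<in> S" if a: "a \<in> carrier U" and w: "w \<in> S" for a w
    unfolding S_def
  proof (intro CollectI conjI ballI)
    show "a w \<in> \<Omega>" using a w unfolding S_def by simp
    fix b assume b: "b \<in> carrier U"
    have "Q ((b \<otimes>\<^bsub>U\<^esub> a) w)" using w U.m_closed[OF b a] unfolding S_def by blast
    thus "Q (b (a w))" using w unfolding S_def by (simp add: U_simps)
  qed
  have Ssm: "k \<odot>\<^bsub>C\<^esub> w \<in> S" if "k \<in> carrier K" "w \<in> S" for k w
    using SU[of "k \<odot>\<^bsub>U\<^esub> \<one>\<^bsub>U\<^esub>" w] that unfolding S_def by (simp add: U_simps)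
  have S0: "\<zero>\<^bsub>C\<^esub> \<in> S" unfolding S_def using Q0 by simp
  have gens: "univ_d (X l) \<in> S" if l: "l < n" "l \<noteq> j" for l
    unfolding S_def Q_def
  proof (intro CollectI conjI ballI allI impI)
    show "univ_d (X l) \<in> \<Omega>" using X l by simp
    fix a Y assume "a \<in> carrier U" "log_traceless Y" "\<forall>l<n. l \<noteq> j \<longrightarrow> Y l = univ_d (X l)"
    thus "log_traceless (Y(j := Y j \<oplus>\<^bsub>C\<^esub> a (univ_d (X l))))" using log_traceless_add[of Y j l a] j l by simp
  qed
  have gs: "X ` ({..<n} - {j}) \<subseteq> carrier A" using X by auto
  have fA: "f \<in> carrier A"
    using A.gen_subalgebra_closed[OF gs A_ident] f by auto
  have "u \<longrightarrow> has_identity A" using A_ident by simp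
  with f have "univ_d f \<in> S" using gs
  proof (induction rule: A.gen_subalgebra_induct)
    case zero
    show ?case unfolding A_ops univ_d_ops(5) by (rule S0)
  next
    case one
    show ?case unfolding A_ops derivations_one(2)[OF one] by (rule S0)
  next
    case (mult a b)
    have "univ_d (a \<otimes>\<^bsub>A\<^esub> b) = R b (univ_d a) \<oplus>\<^bsub>C\<^esub> L a (univ_d b)"
      using mult(1,2) by (simp add: A_ops univ_d_ops LR_apply)
    thus ?case using mult SU Sadd by simp
  next
    case (add a b)
    thus ?case using Sadd by (simp add: A_ops univ_d_ops)
  next
    case (smult c a)
    thus ?case using Ssm by (simp add: A_ops univ_d_ops)
  qed (use gens in auto)
  hence "univ_d f \<in> \<Omega>" "Q (\<one>\<^bsub>U\<^esub> (univ_d f))" using U_one(1) unfolding S_def by blast+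
  hence Qf: "Q (univ_d f)" by (simp add: U_simps)
  \<comment> \<open>The vector is scaled before \<open>univ_d f\<close> is added; Q applies to the
    scaled family, which is unchanged away from j.\<close>
  let ?Y = "(\<lambda>l. univ_d (X l))(j := \<alpha> \<odot>\<^bsub>C\<^esub> univ_d (X j))"
  have "log_traceless ?Y" using log_traceless_scale[OF log_traceless j \<alpha>] .
  moreover have "\<forall>l<n. l \<noteq> j \<longrightarrow> ?Y l = univ_d (X l)" by simp
  ultimately have "log_traceless (?Y(j := ?Y j \<oplus>\<^bsub>C\<^esub> univ_d f))" using Qf unfolding Q_def by blast
  thus ?thesis
    by (rule log_traceless_cong) (use X j \<alpha> fA in \<open>simp add: A_ops univ_d_ops\<close>)
qed

subsection \<open>Filtrations by degree\<close>

abbreviation "UF \<equiv> eig_span K U delta (nat_scalar K)"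
abbreviation "AF \<equiv> eig_span K A euler (nat_scalar K)"

text \<open>Degree in x only, measured on coordinates: the y have degree 0, in accordance with the
  Euler derivation killing them.\<close>

definition OmegaF :: "nat \<Rightarrow> 'k elem set" where
  "OmegaF m = {w \<in> \<Omega>. \<forall>j<n. crd w j \<in> UF m}"

lemma euler_lin_A: "linear_on K A A euler" and euler_leibniz_A: "leibniz_on A euler"
  unfolding linear_on_def leibniz_on_def by (auto simp: A_ops euler_ops)

lemma AF_mult: "\<lbrakk>a \<in> AF j; b \<in> AF k\<rbrakk> \<Longrightarrow> a \<otimes>\<^bsub>A\<^esub> b \<in> AF (j + k)"
  by (rule A.eig_span_mult)
    (simp_all add: leibniz_onD[OF euler_leibniz_A] A.smult_l A.smult_r A.smult_l_distr A.m_closed nat_scalar_add)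

lemma UF_mult: "\<lbrakk>a \<in> UF j; b \<in> UF k\<rbrakk> \<Longrightarrow> a \<otimes>\<^bsub>U\<^esub> b \<in> UF (j + k)"
  by (rule U.eig_span_mult)
    (simp_all add: delta_ops U.smult_l U.smult_r U.smult_l_distr U.m_closed nat_scalar_add)

lemma UF_submodule: "submodule (UF m) K U"
  by (rule U.eig_span_submodule)

lemmas UF_ops = U.submoduleE[OF UF_submodule] U.submodule_zero[OF UF_submodule]

text \<open>Generators are eigenvectors of degree 1, the identity is one of degree 0, and degrees
  add in products. So Euler eigenvectors of nonnegative integral eigenvalue span
  \<open>A\<close>.\<close>

lemma AF_0: "a \<in> carrier A \<Longrightarrow> a \<in> AF 0"
proof (induction rule: A_induct)
  case (var j)
  then show ?case by (intro A.eig_span_incl[of _ _ _ 1]) (simp_all add: euler_props)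
next
  case zero
  show ?case unfolding A_ops(4)[symmetric] by (rule A.submodule_zero[OF A.eig_span_submodule])
next
  case one
  have 1: "\<one>\<^bsub>A\<^esub> \<in> carrier A" using A_ident[OF one] by (simp add: has_identity_def)
  have "euler \<one>\<^bsub>A\<^esub> = nat_scalar K 0 \<odot>\<^bsub>A\<^esub> \<one>\<^bsub>A\<^esub>" using derivations_one(1)[OF one] 1 A.smult_l_null[OF 1] by (simp add: A_ops)
  from A.eig_span_incl[of _ euler "nat_scalar K" 0, OF 1 this, of 0] show ?case by (simp add: A_ops)
next
  case (add a b)
  show ?case unfolding A_ops[symmetric] by (rule A.submoduleE(5)[OF A.eig_span_submodule add(3,4)])
next
  case (smult c a)
  show ?case unfolding A_ops[symmetric] by (rule A.submoduleE(4)[OF A.eig_span_submodule smult(1,3)])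
next
  case (mult a b)
  then show ?case using AF_mult[of a 0 b 0] by (simp add: A_ops)
qed

lemma LR_ops:
  assumes "a \<in> carrier A" "b \<in> carrier A"
  shows "L (a \<oplus>\<^bsub>C\<^esub> b) = L a \<oplus>\<^bsub>U\<^esub> L b" "R (a \<oplus>\<^bsub>C\<^esub> b) = R a \<oplus>\<^bsub>U\<^esub> R b"
    "k \<in> carrier K \<Longrightarrow> L (k \<odot>\<^bsub>C\<^esub> a) = k \<odot>\<^bsub>U\<^esub> L a" "k \<in> carrier K \<Longrightarrow> R (k \<odot>\<^bsub>C\<^esub> a) = k \<odot>\<^bsub>U\<^esub> R a"
  by (rule U_eqI; use assms in \<open>simp add: LR_apply U_simps C.l_distr C.r_distr C.smult_l C.smult_r\<close>)+

text \<open>An eigenvector of the Euler derivation yields multiplication operators that are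
  eigenvectors of \<open>delta\<close> of the same degree. This is the base for \<open>UF_0\<close>,
  which says that \<open>delta\<close> is diagonalisable on \<open>U\<close> with degrees at least
  0.\<close>

lemma LR_UF: "a \<in> carrier A \<Longrightarrow> L a \<in> UF 0 \<and> R a \<in> UF 0"
proof -
  assume "a \<in> carrier A"
  hence "a \<in> AF 0" by (rule AF_0)
  moreover have "{w \<in> carrier A. \<exists>k\<ge>0. euler w = nat_scalar K k \<odot>\<^bsub>A\<^esub> w} \<subseteq> carrier A" by auto
  ultimately show ?thesis unfolding eig_span_def[of K A]
  proof (induction rule: A.lin_span_induct)
    case (base a)
    then obtain k where k: "a \<in> carrier A" "euler a = nat_scalar K k \<odot>\<^bsub>C\<^esub> a" by (auto simp: A_ops)
    have "delta (L a) = nat_scalar K k \<odot>\<^bsub>U\<^esub> L a" "delta (R a) = nat_scalar K k \<odot>\<^bsub>U\<^esub> R a"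
      using k by (simp_all add: delta_L delta_R LR_ops)
    thus ?case using k(1) by (auto intro!: U.eig_span_incl)
  next
    case zero
    have "L \<zero>\<^bsub>A\<^esub> = \<zero>\<^bsub>U\<^esub>" "R \<zero>\<^bsub>A\<^esub> = \<zero>\<^bsub>U\<^esub>"
      by (rule U_eqI; simp add: LR_apply U_simps A_ops)+
    thus ?case using UF_ops(7) by simp
  next
    case (add a b)
    then show ?case using UF_ops(5) by (simp add: A_ops LR_ops)
  next
    case (smult k a)
    then show ?case using UF_ops(4) by (simp add: A_ops LR_ops)
  qed
qed

lemma UF_0: "v \<in> carrier U \<Longrightarrow> v \<in> UF 0"
proof (induction rule: U_induct)
  case one
  show ?case by (rule U.eig_span_incl[of _ _ _ 0]) (simp_all add: delta_one)
next
  case (mult v w)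
  then show ?case using UF_mult[of v 0 w 0] by simp
qed (use LR_UF UF_ops in auto)

lemma delta_UF: "v \<in> UF m \<Longrightarrow> delta v \<in> UF m"
proof -
  assume "v \<in> UF m"
  moreover have "{w \<in> carrier U. \<exists>k\<ge>m. delta w = nat_scalar K k \<odot>\<^bsub>U\<^esub> w} \<subseteq> carrier U" by auto
  ultimately have "v \<in> carrier U \<and> delta v \<in> UF m" unfolding eig_span_def[of K U delta "nat_scalar K" m]
  proof (induction rule: U.lin_span_induct)
    case (base v)
    then obtain k where k: "v \<in> carrier U" "k \<ge> m" "delta v = nat_scalar K k \<odot>\<^bsub>U\<^esub> v" by auto
    hence "v \<in> UF m" by (intro U.eig_span_incl)
    hence "delta v \<in> UF m" unfolding k(3) by (intro UF_ops(4)) simp_all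
    thus ?case using k unfolding eig_span_def by simp
  next
    case zero
    then show ?case using UF_ops(7) unfolding eig_span_def by (simp add: delta_zero)
  next
    case (add v w)
    then show ?case using UF_ops(5) unfolding eig_span_def by (simp add: delta_ops)
  next
    case (smult c v)
    then show ?case using UF_ops(4) unfolding eig_span_def by (simp add: delta_ops)
  qed
  thus ?thesis by simp
qed

lemma OmegaF_ops:
  "\<zero>\<^bsub>C\<^esub> \<in> OmegaF m" "\<lbrakk>v \<in> OmegaF m; w \<in> OmegaF m\<rbrakk> \<Longrightarrow> v \<oplus>\<^bsub>C\<^esub> w \<in> OmegaF m"
  "\<lbrakk>k \<in> carrier K; w \<in> OmegaF m\<rbrakk> \<Longrightarrow> k \<odot>\<^bsub>C\<^esub> w \<in> OmegaF m" "w \<in> OmegaF m \<Longrightarrow> euler w \<in> OmegaF m" "w \<in> OmegaF m \<Longrightarrow> w \<in> \<Omega>"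
  unfolding OmegaF_def using functional_zero[OF crd_functional] functionalD(2)[OF crd_functional]
    functional_smult[OF crd_functional] UF_ops(4,5,7) by (auto simp: crd_euler delta_UF)

lemma OmegaF_antimono: "\<lbrakk>w \<in> OmegaF k; m \<le> k\<rbrakk> \<Longrightarrow> w \<in> OmegaF m"
  unfolding OmegaF_def using U.eig_span_antimono by blast

text \<open>The shift by one is the x that \<open>univ_d\<close> turns into a y.\<close>

lemma univ_d_AF: "a \<in> AF (Suc m) \<Longrightarrow> a \<in> carrier A \<and> univ_d a \<in> OmegaF m"
proof -
  assume "a \<in> AF (Suc m)"
  moreover have "{w \<in> carrier A. \<exists>k\<ge>Suc m. euler w = nat_scalar K k \<odot>\<^bsub>A\<^esub> w} \<subseteq> carrier A" by auto
  ultimately show ?thesis unfolding eig_span_def[of K A]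
  proof (induction rule: A.lin_span_induct)
    case (base a)
    then obtain k where k: "a \<in> carrier A" "k \<ge> Suc m" "euler a = nat_scalar K k \<odot>\<^bsub>C\<^esub> a" by (auto simp: A_ops)
    obtain k' where k': "k = Suc k'" "m \<le> k'" using k(2) by (cases k) auto
    have e: "euler (univ_d a) = nat_scalar K k' \<odot>\<^bsub>C\<^esub> univ_d a" using euler_univ_d_eigen[OF k(1)] k(3) k' by simp
    have "crd (univ_d a) j \<in> UF m" if "j < n" for j
      by (rule U.eig_span_incl[OF _ _ k'(2)])
        (use that k(1) crd_euler[of "univ_d a" j] functional_smult[OF crd_functional[OF that]] e in simp_all)
    thus ?case using k(1) unfolding OmegaF_def by simp
  next
    case (add a b)
    then show ?case using OmegaF_ops by (simp add: A_ops univ_d_ops)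
  next
    case (smult c a)
    then show ?case using OmegaF_ops by (simp add: A_ops univ_d_ops)
  qed (use OmegaF_ops in \<open>simp add: A_ops univ_d_ops\<close>)
qed

text \<open>A functional maps the sum of the \<open>v_j y_j\<close> to the sum of the
  \<open>v_j c(y_j)\<close>, where degrees add.\<close>

lemma functional_OmegaF:
  assumes w: "w \<in> OmegaF m" and c: "functional c" and cy: "\<And>k. k < n \<Longrightarrow> c (y k) \<in> UF p"
  shows "c w \<in> UF (m + p)"
proof -
  have wO: "w \<in> \<Omega>" and cw: "\<And>j. j < n \<Longrightarrow> crd w j \<in> UF m" using w unfolding OmegaF_def by auto
  have "\<And>I. finite I \<Longrightarrow> I \<subseteq> {..<n} \<Longrightarrow> c (\<Oplus>\<^bsub>C\<^esub>j\<in>I. crd w j (y j)) \<in> UF (m + p)"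
  proof -
    fix I assume "finite (I :: nat set)" "I \<subseteq> {..<n}"
    thus "c (\<Oplus>\<^bsub>C\<^esub>j\<in>I. crd w j (y j)) \<in> UF (m + p)"
    proof (induction I)
      case empty
      show ?case using functional_zero[OF c] UF_ops(7) by simp
    next
      case (insert j I)
      have j: "j < n" and I: "(\<lambda>j. crd w j (y j)) \<in> I \<rightarrow> \<Omega>" and jO: "crd w j (y j) \<in> \<Omega>"
        using insert wO by auto
      have s: "(\<Oplus>\<^bsub>C\<^esub>j\<in>I. crd w j (y j)) \<in> \<Omega>" by (rule Omega_finsum[OF insert(1) I])
      have "(\<Oplus>\<^bsub>C\<^esub>j\<in>insert j I. crd w j (y j)) = crd w j (y j) \<oplus>\<^bsub>C\<^esub> (\<Oplus>\<^bsub>C\<^esub>j\<in>I. crd w j (y j))"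
        by (rule C.M.finsum_insert) (use insert I jO in \<open>auto simp: Pi_iff\<close>)
      hence "c (\<Oplus>\<^bsub>C\<^esub>j\<in>insert j I. crd w j (y j)) = crd w j \<otimes>\<^bsub>U\<^esub> c (y j) \<oplus>\<^bsub>U\<^esub> c (\<Oplus>\<^bsub>C\<^esub>j\<in>I. crd w j (y j))"
        using functionalD[OF c] s jO j wO by simp
      thus ?case using UF_ops(5)[OF UF_mult[OF cw[OF j] cy[OF j]]] insert by simp
    qed
  qed
  from this[of "{..<n}"] show ?thesis using crd_props(2)[OF wO] unfolding comb_def by simp
qed

text \<open>The component of lowest degree of the logarithmic trace is \<open>i\<close> times the divergence.\<close>

lemma log_traceless_divergence:
  assumes log_traceless: "log_traceless (\<lambda>j. univ_d (x j \<oplus>\<^bsub>C\<^esub> f j \<oplus>\<^bsub>C\<^esub> g j))" and i: "1 \<le> i"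
    and f: "\<And>j. j < n \<Longrightarrow> f j \<in> carrier A" "\<And>j. j < n \<Longrightarrow> euler (f j) = nat_scalar K (Suc i) \<odot>\<^bsub>C\<^esub> f j"
    and g: "\<And>j. j < n \<Longrightarrow> g j \<in> AF (Suc (Suc i))"
  shows "(\<Oplus>\<^bsub>U\<^esub>j\<in>{..<n}. crd (univ_d (f j)) j) \<in> CU"
proof -
  obtain c where c: "dual_basis (\<lambda>j. univ_d (x j \<oplus>\<^bsub>C\<^esub> f j \<oplus>\<^bsub>C\<^esub> g j)) c"
    and cs: "(\<Oplus>\<^bsub>U\<^esub>j\<in>{..<n}. c j (euler (univ_d (x j \<oplus>\<^bsub>C\<^esub> f j \<oplus>\<^bsub>C\<^esub> g j)))) \<in> CU"
    using log_traceless unfolding log_traceless_def by blast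
  note b = dual_basisD[OF c]
  have gA: "g j \<in> carrier A" and dg: "univ_d (g j) \<in> OmegaF (Suc i)" if "j < n" for j using univ_d_AF[OF g[OF that]] by auto
  have "f j \<in> AF (Suc i)" if "j < n" for j
    by (rule A.eig_span_incl[of _ _ _ "Suc i"]) (use f that in \<open>simp_all add: A_ops\<close>)
  hence df: "univ_d (f j) \<in> OmegaF i" if "j < n" for j using univ_d_AF that by blast
  \<comment> \<open>The deviation of the basis vectors from the y: the transition matrix is the
    identity plus entries of degree at least i.\<close>
  define e where "e j = univ_d (f j) \<oplus>\<^bsub>C\<^esub> univ_d (g j)" for j
  have e: "e j \<in> OmegaF i" "e j \<in> \<Omega>" if "j < n" for j
  proof -
    show "e j \<in> OmegaF i" unfolding e_def using OmegaF_ops(2)[OF df OmegaF_antimono[OF dg]] that by simp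
    thus "e j \<in> \<Omega>" by (rule OmegaF_ops)
  qed
  have dX: "univ_d (x j \<oplus>\<^bsub>C\<^esub> f j \<oplus>\<^bsub>C\<^esub> g j) = y j \<oplus>\<^bsub>C\<^esub> e j" if "j < n" for j
    using that f(1) gA by (simp add: univ_d_ops univ_d_props e_def C.M.a_assoc)
  \<comment> \<open>The remainder of the j-th summand of the trace. It collects the error made when
    the dual functional is replaced by the j-th coordinate, and the contribution of the terms
    \<open>g j\<close>; both have degree above i.\<close>
  define r where "r j = (c j (euler (e j)) \<ominus>\<^bsub>U\<^esub> crd (euler (e j)) j) \<oplus>\<^bsub>U\<^esub> crd (euler (univ_d (g j))) j" for j
  have r: "r j \<in> UF (Suc i)" "c j (euler (univ_d (x j \<oplus>\<^bsub>C\<^esub> f j \<oplus>\<^bsub>C\<^esub> g j))) = nat_scalar K i \<odot>\<^bsub>U\<^esub> crd (univ_d (f j)) j \<oplus>\<^bsub>U\<^esub> r j"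
    if j: "j < n" for j
  proof -
    note fj = b(2)[OF j] and gj = crd_functional[OF j]
    \<comment> \<open>The factor one gives the difference of two functionals the form required by
      \<open>functional_minus_mult\<close>.\<close>
    let ?c = "\<lambda>w. c j w \<ominus>\<^bsub>U\<^esub> crd w j \<otimes>\<^bsub>U\<^esub> \<one>\<^bsub>U\<^esub>"
    have fc: "functional ?c" by (rule functional_minus_mult[OF fj gj U_one(1)])
    \<comment> \<open>Duality gives \<open>c_j(y_k + e_k)\<close>, which equals the j-th coordinate
      of \<open>y_k\<close>. The difference at \<open>y_k\<close> is thus \<open>- c_j(e_k)\<close>,
      and \<open>e_k\<close> has degree at least i.\<close>
    have "?c (y k) \<in> UF i" if k: "k < n" for k
    proof -
      let ?t = "crd (y k) j"
      have cl: "c j (y k) \<in> carrier U" "c j (e k) \<in> carrier U" "?t \<in> carrier U"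
        using functionalD(1)[OF fj] k e j by simp_all
      have "c j (y k) \<oplus>\<^bsub>U\<^esub> c j (e k) = ?t"
        using b(3)[OF j k] unfolding dX[OF k] crd_y[OF j k] using functionalD(2)[OF fj, of "y k" "e k"] k e by simp
      hence "(c j (y k) \<oplus>\<^bsub>U\<^esub> c j (e k)) \<ominus>\<^bsub>U\<^esub> ?t = \<zero>\<^bsub>U\<^esub>" using cl by (simp add: U.M.minus_eq_zero_iff)
      hence "?c (y k) \<oplus>\<^bsub>U\<^esub> c j (e k) = \<zero>\<^bsub>U\<^esub>" using cl by (simp add: a_minus_def U.M.a_ac)
      hence "?c (y k) = \<ominus>\<^bsub>U\<^esub> c j (e k)"
        using U.M.minus_equality functionalD(1)[OF fj, of "e k"] functionalD(1)[OF fc, of "y k"] k e by simp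
      moreover have "c j (e k) \<in> UF (i + 0)"
        by (rule functional_OmegaF[OF e(1)[OF k] fj]) (rule UF_0, use functionalD(1)[OF fj] in simp)
      ultimately show ?thesis using UF_ops(3) by simp
    qed
    \<comment> \<open>The error is quadratic in the deviation, of degree at least 2i, and this is at
      least i + 1 because i is positive.\<close>
    hence "?c (euler (e j)) \<in> UF (i + i)" by (intro functional_OmegaF OmegaF_ops(4) e j fc)
    hence 1: "c j (euler (e j)) \<ominus>\<^bsub>U\<^esub> crd (euler (e j)) j \<in> UF (Suc i)"
      using U.eig_span_antimono[of _ delta "nat_scalar K" "i + i" "Suc i"] i e(2)[OF j] j by simp
    have 2: "crd (euler (univ_d (g j))) j \<in> UF (Suc i)"
      using OmegaF_ops(4)[OF dg[OF j]] j unfolding OmegaF_def by blast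
    show "r j \<in> UF (Suc i)" unfolding r_def by (rule UF_ops(5)[OF 1 2])
    have "euler (univ_d (f j)) = nat_scalar K i \<odot>\<^bsub>C\<^esub> univ_d (f j)" by (rule euler_univ_d_eigen[OF f[OF j]])
    hence ce: "crd (euler (e j)) j = nat_scalar K i \<odot>\<^bsub>U\<^esub> crd (univ_d (f j)) j \<oplus>\<^bsub>U\<^esub> crd (euler (univ_d (g j))) j"
      using functionalD(2)[OF gj] functional_smult[OF gj] f(1)[OF j] gA[OF j]
      by (simp add: e_def euler_ops)
    have "c j (euler (univ_d (x j \<oplus>\<^bsub>C\<^esub> f j \<oplus>\<^bsub>C\<^esub> g j))) = c j (euler (e j))"
      unfolding dX[OF j] using e(2)[OF j] j by (simp add: euler_ops euler_props)
    also have "\<dots> = (c j (euler (e j)) \<ominus>\<^bsub>U\<^esub> crd (euler (e j)) j) \<oplus>\<^bsub>U\<^esub> crd (euler (e j)) j"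
      using functionalD(1)[OF fj, of "euler (e j)"] e(2)[OF j] j by (simp add: a_minus_def U.M.a_assoc U.M.l_neg)
    also have "\<dots> = nat_scalar K i \<odot>\<^bsub>U\<^esub> crd (univ_d (f j)) j \<oplus>\<^bsub>U\<^esub> r j"
      unfolding r_def ce
      using functionalD(1)[OF fj, of "euler (e j)"] e(2)[OF j] j f(1)[OF j] gA[OF j]
      by (simp add: U.M.a_ac)
    finally show "c j (euler (univ_d (x j \<oplus>\<^bsub>C\<^esub> f j \<oplus>\<^bsub>C\<^esub> g j))) = nat_scalar K i \<odot>\<^bsub>U\<^esub> crd (univ_d (f j)) j \<oplus>\<^bsub>U\<^esub> r j" .
  qed
  let ?V = "\<Oplus>\<^bsub>U\<^esub>j\<in>{..<n}. crd (univ_d (f j)) j"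
  have vc: "(\<lambda>j. crd (univ_d (f j)) j) \<in> {..<n} \<rightarrow> carrier U" using f(1) by auto
  have rc: "r \<in> {..<n} \<rightarrow> UF (Suc i)" using r(1) by auto
  have rcU: "r \<in> {..<n} \<rightarrow> carrier U" using rc UF_ops(1) by blast
  have "(\<Oplus>\<^bsub>U\<^esub>j\<in>{..<n}. c j (euler (univ_d (x j \<oplus>\<^bsub>C\<^esub> f j \<oplus>\<^bsub>C\<^esub> g j)))) =
      (\<Oplus>\<^bsub>U\<^esub>j\<in>{..<n}. nat_scalar K i \<odot>\<^bsub>U\<^esub> crd (univ_d (f j)) j \<oplus>\<^bsub>U\<^esub> r j)"
    by (rule U.M.finsum_cong') (use r(2) vc rcU in \<open>auto simp: Pi_iff\<close>)
  also have "\<dots> = (\<Oplus>\<^bsub>U\<^esub>j\<in>{..<n}. nat_scalar K i \<odot>\<^bsub>U\<^esub> crd (univ_d (f j)) j) \<oplus>\<^bsub>U\<^esub> (\<Oplus>\<^bsub>U\<^esub>j\<in>{..<n}. r j)"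
    by (rule U.M.finsum_addf) (use vc rcU in \<open>auto simp: Pi_iff\<close>)
  also have "(\<Oplus>\<^bsub>U\<^esub>j\<in>{..<n}. nat_scalar K i \<odot>\<^bsub>U\<^esub> crd (univ_d (f j)) j) = nat_scalar K i \<odot>\<^bsub>U\<^esub> ?V"
    by (rule U.finsum_smult_ldistr[symmetric]) (use vc in auto)
  finally have sum: "nat_scalar K i \<odot>\<^bsub>U\<^esub> ?V \<oplus>\<^bsub>U\<^esub> (\<Oplus>\<^bsub>U\<^esub>j\<in>{..<n}. r j) \<in> CU" using cs by simp
  have Vc: "?V \<in> carrier U" by (rule U.M.finsum_closed[OF vc])
  \<comment> \<open>The \<open>f j\<close> have degree i + 1, their partial derivatives degree i.
    The divergence is therefore an eigenvector of \<open>delta\<close> with eigenvalue i.\<close>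
  have dV: "delta ?V = nat_scalar K i \<odot>\<^bsub>U\<^esub> ?V"
  proof -
    have "delta ?V = (\<Oplus>\<^bsub>U\<^esub>j\<in>{..<n}. delta (crd (univ_d (f j)) j))"
      by (rule linear_on_finsum[OF U.module_axioms U.module_axioms delta_lin]) (use vc in auto)
    also have "\<dots> = (\<Oplus>\<^bsub>U\<^esub>j\<in>{..<n}. nat_scalar K i \<odot>\<^bsub>U\<^esub> crd (univ_d (f j)) j)"
    proof (rule U.M.finsum_cong')
      fix j assume "j \<in> {..<n}"
      hence j: "j < n" by simp
      have "delta (crd (univ_d (f j)) j) = crd (euler (univ_d (f j))) j" using crd_euler f(1) j by simp
      also have "euler (univ_d (f j)) = nat_scalar K i \<odot>\<^bsub>C\<^esub> univ_d (f j)" by (rule euler_univ_d_eigen[OF f[OF j]])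
      finally show "delta (crd (univ_d (f j)) j) = nat_scalar K i \<odot>\<^bsub>U\<^esub> crd (univ_d (f j)) j"
        using functional_smult[OF crd_functional[OF j]] f(1)[OF j] by simp
    qed (use f(1) in auto)
    also have "\<dots> = nat_scalar K i \<odot>\<^bsub>U\<^esub> ?V"
      by (rule U.finsum_smult_ldistr[symmetric]) (use vc in auto)
    finally show ?thesis .
  qed
  have "nat_scalar K i \<odot>\<^bsub>U\<^esub> ?V \<in> CU"
  proof (rule eigen_component[OF U.module_axioms char_zero_field_axioms delta_lin _ _ CU_submodule delta_CU _ _ _ sum])
    show "nat_scalar K k \<noteq> nat_scalar K i" if "k > i" for k using that by (simp add: nat_scalar_inj)
    show "delta (nat_scalar K i \<odot>\<^bsub>U\<^esub> ?V) = nat_scalar K i \<odot>\<^bsub>U\<^esub> (nat_scalar K i \<odot>\<^bsub>U\<^esub> ?V)"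
      using Vc dV by (simp add: delta_ops)
    show "(\<Oplus>\<^bsub>U\<^esub>j\<in>{..<n}. r j) \<in> UF (Suc i)" by (rule U.submodule_finsum[OF UF_submodule _ rc]) simp
  qed (use Vc in auto)
  \<comment> \<open>The trace delivers i times the divergence, and i is positive, hence invertible
    in characteristic zero.\<close>
  moreover have "nat_scalar K i \<noteq> \<zero>\<^bsub>K\<^esub>" using i nat_scalar_inj[of i 0] by simp
  then obtain k where k: "k \<in> carrier K" "k \<otimes>\<^bsub>K\<^esub> nat_scalar K i = \<one>\<^bsub>K\<^esub>" using inverse_ex[of "nat_scalar K i"] by auto
  ultimately have "k \<odot>\<^bsub>U\<^esub> (nat_scalar K i \<odot>\<^bsub>U\<^esub> ?V) \<in> CU" using U.submoduleE(4)[OF CU_submodule] by blast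
  thus ?thesis using k Vc by (simp add: U.smult_assoc1[symmetric])
qed

end

section \<open>Quotients\<close>

text \<open>\<open>alg_hom\<close> without extensionality, so that compositions can be written as
  plain functions.\<close>

definition hom_on :: "'k ring \<Rightarrow> bool \<Rightarrow> ('k, 'a) module \<Rightarrow> ('k, 'b) module \<Rightarrow> ('a \<Rightarrow> 'b) \<Rightarrow> bool" where
  "hom_on K u A B h \<longleftrightarrow> linear_on K A B h \<and> mult_on A B h \<and> (u \<longrightarrow> h \<one>\<^bsub>A\<^esub> = \<one>\<^bsub>B\<^esub>)"

lemma hom_onD:
  assumes "hom_on K u A B h"
  shows "linear_on K A B h" "mult_on A B h" "u \<Longrightarrow> h \<one>\<^bsub>A\<^esub> = \<one>\<^bsub>B\<^esub>"
    "a \<in> carrier A \<Longrightarrow> h a \<in> carrier B"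
    "\<lbrakk>a \<in> carrier A; b \<in> carrier A\<rbrakk> \<Longrightarrow> h (a \<oplus>\<^bsub>A\<^esub> b) = h a \<oplus>\<^bsub>B\<^esub> h b"
    "\<lbrakk>c \<in> carrier K; a \<in> carrier A\<rbrakk> \<Longrightarrow> h (c \<odot>\<^bsub>A\<^esub> a) = c \<odot>\<^bsub>B\<^esub> h a"
    "\<lbrakk>a \<in> carrier A; b \<in> carrier A\<rbrakk> \<Longrightarrow> h (a \<otimes>\<^bsub>A\<^esub> b) = h a \<otimes>\<^bsub>B\<^esub> h b"
  using assms linear_onD[of K A B h] mult_onD[of A B h] unfolding hom_on_def by blast+

lemma alg_hom_hom_on: "h \<in> alg_hom K u A B \<Longrightarrow> hom_on K u A B h"
  unfolding alg_hom_iff hom_on_def by simp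

lemma hom_on_comp: "\<lbrakk>hom_on K u A B h; hom_on K u B C g\<rbrakk> \<Longrightarrow> hom_on K u A C (\<lambda>a. g (h a))"
  unfolding hom_on_def linear_on_def mult_on_def by (auto simp: Pi_iff)

lemma teval_hom:
  assumes "nonassoc_algebra K A" "nonassoc_algebra K B" "hom_on K u A B h" "u \<Longrightarrow> has_identity A"
    "\<And>x. x \<in> X \<Longrightarrow> g x \<in> carrier A" "t \<in> terms K u X"
  shows "teval B (\<lambda>x. h (g x)) t = h (teval A g t)"
proof -
  interpret A: nonassoc_algebra K A by fact
  interpret B: nonassoc_algebra K B by fact
  have cl: "teval A g t \<in> carrier A" if "t \<in> terms K u X" for t
    by (rule A.teval_closed[OF that assms(4,5)])
  from assms(6) show ?thesis
  proof induction
    case 2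
    show ?case using linear_on_zero[OF A.module_axioms B.module_axioms hom_onD(1)[OF assms(3)]] by simp
  next
    case 3
    show ?case using hom_onD(3)[OF assms(3) 3] by simp
  qed (simp_all add: hom_onD(5,6,7)[OF assms(3)] cl)
qed

locale algebra_ideal = nonassoc_algebra K A for K :: "'k ring" and A :: "('k, 'a) module" +
  fixes I :: "'a set"
  assumes I_submodule: "submodule I K A"
    and I_mult: "\<lbrakk>a \<in> carrier A; i \<in> I\<rbrakk> \<Longrightarrow> a \<otimes>\<^bsub>A\<^esub> i \<in> I" "\<lbrakk>a \<in> carrier A; i \<in> I\<rbrakk> \<Longrightarrow> i \<otimes>\<^bsub>A\<^esub> a \<in> I"
begin

abbreviation "B \<equiv> quot_algebra A I"

definition proj :: "'a \<Rightarrow> 'a set" where "proj a = I +>\<^bsub>A\<^esub> a"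

lemmas I_ops = submoduleE[OF I_submodule]

lemma I_subgroup: "subgroup I (add_monoid A)"
  using I_submodule unfolding submodule_def by simp

sublocale I: abelian_subgroup I A
  by (rule abelian_subgroupI3[OF additive_subgroup.intro[OF I_subgroup] M.abelian_group_axioms])

lemma mem_proj: "a \<in> carrier A \<Longrightarrow> b \<in> proj a \<longleftrightarrow> b \<in> carrier A \<and> b \<ominus>\<^bsub>A\<^esub> a \<in> I"
proof
  assume a: "a \<in> carrier A" and "b \<in> proj a"
  then obtain h where h: "h \<in> I" "b = h \<oplus>\<^bsub>A\<^esub> a" unfolding proj_def a_r_coset_def' by auto
  moreover have "h \<in> carrier A" using h I_ops(1) by auto
  ultimately show "b \<in> carrier A \<and> b \<ominus>\<^bsub>A\<^esub> a \<in> I" using a by (simp add: a_minus_def M.a_assoc M.r_neg)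
next
  assume a: "a \<in> carrier A" and b: "b \<in> carrier A \<and> b \<ominus>\<^bsub>A\<^esub> a \<in> I"
  hence "b = (b \<ominus>\<^bsub>A\<^esub> a) \<oplus>\<^bsub>A\<^esub> a" by (simp add: a_minus_def M.a_assoc M.l_neg)
  thus "b \<in> proj a" using b unfolding proj_def a_r_coset_def' by blast
qed

lemma proj_eq_iff:
  assumes "a \<in> carrier A" "b \<in> carrier A" shows "proj a = proj b \<longleftrightarrow> a \<ominus>\<^bsub>A\<^esub> b \<in> I"
proof
  assume "proj a = proj b"
  moreover have "a \<in> proj a" using assms submodule_zero[OF I_submodule] by (simp add: mem_proj a_minus_def M.r_neg)
  ultimately show "a \<ominus>\<^bsub>A\<^esub> b \<in> I" using mem_proj[OF assms(2)] by simp
next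
  assume "a \<ominus>\<^bsub>A\<^esub> b \<in> I"
  hence "a \<in> I +>\<^bsub>A\<^esub> b" using mem_proj[OF assms(2)] assms(1) unfolding proj_def by simp
  from M.a_repr_independence[OF this assms(2) I_subgroup] show "proj a = proj b" unfolding proj_def by simp
qed

lemma proj_self: "a \<in> carrier A \<Longrightarrow> a \<in> proj a"
  using submodule_zero[OF I_submodule] by (simp add: mem_proj a_minus_def M.r_neg)

lemma B_carrier: "carrier B = proj ` carrier A"
  unfolding quot_algebra_def FactRing_def proj_def A_RCOSETS_def' by auto

lemma proj_add: "\<lbrakk>a \<in> carrier A; b \<in> carrier A\<rbrakk> \<Longrightarrow> proj (a \<oplus>\<^bsub>A\<^esub> b) = proj a \<oplus>\<^bsub>B\<^esub> proj b"
  unfolding proj_def quot_algebra_def FactRing_def by (simp add: I.a_rcos_sum)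

lemma proj_zero: "proj \<zero>\<^bsub>A\<^esub> = \<zero>\<^bsub>B\<^esub>"
  unfolding proj_def quot_algebra_def FactRing_def using I_ops(1) by simp

lemma proj_one: "proj \<one>\<^bsub>A\<^esub> = \<one>\<^bsub>B\<^esub>"
  unfolding proj_def quot_algebra_def FactRing_def by simp

lemma proj_mult:
  assumes a: "a \<in> carrier A" and b: "b \<in> carrier A" shows "proj (a \<otimes>\<^bsub>A\<^esub> b) = proj a \<otimes>\<^bsub>B\<^esub> proj b"
proof -
  have *: "proj (a' \<otimes>\<^bsub>A\<^esub> b') = proj (a \<otimes>\<^bsub>A\<^esub> b)" if "a' \<in> proj a" "b' \<in> proj b" for a' b'
  proof -
    have a': "a' \<in> carrier A" "a' \<ominus>\<^bsub>A\<^esub> a \<in> I" and b': "b' \<in> carrier A" "b' \<ominus>\<^bsub>A\<^esub> b \<in> I"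
      using that mem_proj a b by auto
    have c: "a' \<otimes>\<^bsub>A\<^esub> b' \<in> carrier A" "a \<otimes>\<^bsub>A\<^esub> b' \<in> carrier A" "a \<otimes>\<^bsub>A\<^esub> b \<in> carrier A"
      using a b a' b' m_closed by auto
    have "(a' \<ominus>\<^bsub>A\<^esub> a) \<otimes>\<^bsub>A\<^esub> b' = a' \<otimes>\<^bsub>A\<^esub> b' \<ominus>\<^bsub>A\<^esub> a \<otimes>\<^bsub>A\<^esub> b'" "a \<otimes>\<^bsub>A\<^esub> (b' \<ominus>\<^bsub>A\<^esub> b) = a \<otimes>\<^bsub>A\<^esub> b' \<ominus>\<^bsub>A\<^esub> a \<otimes>\<^bsub>A\<^esub> b"
      using a b a' b' by (simp_all add: a_minus_def l_distr r_distr minus_mult)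
    moreover have "(a' \<otimes>\<^bsub>A\<^esub> b' \<ominus>\<^bsub>A\<^esub> a \<otimes>\<^bsub>A\<^esub> b') \<oplus>\<^bsub>A\<^esub> (a \<otimes>\<^bsub>A\<^esub> b' \<ominus>\<^bsub>A\<^esub> a \<otimes>\<^bsub>A\<^esub> b) = a' \<otimes>\<^bsub>A\<^esub> b' \<ominus>\<^bsub>A\<^esub> a \<otimes>\<^bsub>A\<^esub> b"
      by (rule M.minus_add_minus[OF c])
    ultimately have "a' \<otimes>\<^bsub>A\<^esub> b' \<ominus>\<^bsub>A\<^esub> a \<otimes>\<^bsub>A\<^esub> b \<in> I"
      using I_ops(5)[OF I_mult(2)[OF b'(1) a'(2)] I_mult(1)[OF a b'(2)]] by simp
    thus ?thesis using proj_eq_iff c by simp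
  qed
  have "(\<Union>a'\<in>proj a. \<Union>b'\<in>proj b. proj (a' \<otimes>\<^bsub>A\<^esub> b')) = proj (a \<otimes>\<^bsub>A\<^esub> b)"
    by (intro UN_constant_eq[OF proj_self[OF a]] UN_constant_eq[OF proj_self[OF b]] ballI *)
  thus ?thesis unfolding quot_algebra_def FactRing_def rcoset_mult_def proj_def[symmetric] by simp
qed

lemma proj_smult:
  assumes c: "c \<in> carrier K" and a: "a \<in> carrier A" shows "proj (c \<odot>\<^bsub>A\<^esub> a) = c \<odot>\<^bsub>B\<^esub> proj a"
proof -
  have *: "proj (c \<odot>\<^bsub>A\<^esub> a') = proj (c \<odot>\<^bsub>A\<^esub> a)" if "a' \<in> proj a" for a'
  proof -
    have a': "a' \<in> carrier A" "a' \<ominus>\<^bsub>A\<^esub> a \<in> I" using that mem_proj a by auto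
    have "c \<odot>\<^bsub>A\<^esub> (a' \<ominus>\<^bsub>A\<^esub> a) = c \<odot>\<^bsub>A\<^esub> a' \<ominus>\<^bsub>A\<^esub> c \<odot>\<^bsub>A\<^esub> a"
      using a a' c by (simp add: a_minus_def smult_r_distr smult_r_minus)
    thus ?thesis using proj_eq_iff I_ops(4)[OF c a'(2)] c a a' by simp
  qed
  have "(\<Union>a'\<in>proj a. proj (c \<odot>\<^bsub>A\<^esub> a')) = proj (c \<odot>\<^bsub>A\<^esub> a)"
    by (intro UN_constant_eq[OF proj_self[OF a]] ballI *)
  thus ?thesis unfolding quot_algebra_def proj_def[symmetric] by simp
qed

lemma B_algebra: "nonassoc_algebra K B"
  by (rule alg_image[OF B_carrier proj_add proj_smult proj_mult proj_zero])

lemma B_identity: "has_identity A \<Longrightarrow> has_identity B"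
  unfolding has_identity_def by (auto simp: B_carrier proj_one[symmetric] proj_mult[symmetric])

lemma proj_hom: "hom_on K u A B proj"
  unfolding hom_on_def linear_on_def mult_on_def
  by (auto simp: B_carrier proj_add proj_smult proj_mult proj_one)

lemma proj_minus:
  assumes "a \<in> carrier A" "b \<in> carrier A" shows "proj (a \<ominus>\<^bsub>A\<^esub> b) = proj a \<ominus>\<^bsub>B\<^esub> proj b"
  by (rule linear_on_minus[OF module_axioms nonassoc_algebra.axioms(1)[OF B_algebra] hom_onD(1)[OF proj_hom] assms])

lemma proj_submodule:
  assumes "submodule H K A" shows "submodule (proj ` H) K B"
proof -
  interpret B: nonassoc_algebra K B by (rule B_algebra)
  note H = submoduleE[OF assms] submodule_zero[OF assms]
  have Hc: "h \<in> carrier A" if "h \<in> H" for h using H(1) that by auto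
  show ?thesis
  proof (rule B.submodule_criterion)
    show "proj ` H \<subseteq> carrier B" using Hc by (auto simp: B_carrier)
    show "\<zero>\<^bsub>B\<^esub> \<in> proj ` H" unfolding proj_zero[symmetric] by (rule imageI[OF H(7)])
    show "a \<oplus>\<^bsub>B\<^esub> b \<in> proj ` H" if "a \<in> proj ` H" "b \<in> proj ` H" for a b
      using that H(5) Hc by (auto simp: proj_add[symmetric])
    show "c \<odot>\<^bsub>B\<^esub> a \<in> proj ` H" if "c \<in> carrier K" "a \<in> proj ` H" for c a
      using that H(4) Hc by (auto simp: proj_smult[symmetric])
  qed
qed

text \<open>A monomial in the images of the generators is the image of the same monomial. An element
  of degree at least m in the quotient thus has a preimage of degree at least m, which is how
  estimates in \<open>B\<close> come back to \<open>A\<close>.\<close>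

lemma degree_ge_quot:
  assumes deg: "degree_algebra K A u n g"
  shows "degree_algebra K B u n (\<lambda>j. proj (g j))"
    "degree_ge K u B n (\<lambda>j. proj (g j)) m \<subseteq> proj ` degree_ge K u A n g m"
proof -
  interpret A: degree_algebra K A u n g by fact
  interpret B: nonassoc_algebra K B by (rule B_algebra)
  have gc: "g j \<in> carrier A" if "j < n" for j using A.gens that by simp
  have img: "(\<lambda>j. proj (g j)) ` {..<n} \<subseteq> carrier B" using gc by (auto simp: B_carrier)
  have Bid: "u \<Longrightarrow> has_identity B" using A.ident B_identity by simp
  have "proj a \<in> gen_subalgebra K u B ((\<lambda>j. proj (g j)) ` {..<n})" if "a \<in> carrier A" for a
  proof -
    let ?G = "gen_subalgebra K u B ((\<lambda>j. proj (g j)) ` {..<n})"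
    have sub: "subalgebra K u B ?G" by (rule B.gen_subalgebra_subalgebra[OF img Bid])
    have sm: "submodule ?G K B" and mu: "\<And>a b. \<lbrakk>a \<in> ?G; b \<in> ?G\<rbrakk> \<Longrightarrow> a \<otimes>\<^bsub>B\<^esub> b \<in> ?G" and one: "u \<Longrightarrow> \<one>\<^bsub>B\<^esub> \<in> ?G"
      using sub unfolding subalgebra_def by auto
    note G = B.submoduleE[OF sm] B.submodule_zero[OF sm]
    have "a \<in> gen_subalgebra K u A (g ` {..<n})" using that A.generated by simp
    moreover have "u \<longrightarrow> has_identity A" using A.ident by simp
    moreover have "g ` {..<n} \<subseteq> carrier A" using gc by auto
    ultimately show ?thesis
    proof (induction rule: gen_subalgebra_induct)
      case (base a)
      thus ?case by (intro B.gen_subalgebra_incl) auto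
    next
      case zero
      show ?case unfolding proj_zero by (rule G(7))
    next
      case one'': one
      show ?case unfolding proj_one by (rule one[OF one''])
    next
      case (add a b)
      show ?case unfolding proj_add[OF add(1,2)] by (rule G(5)[OF add(3,4)])
    next
      case (smult c a)
      show ?case unfolding proj_smult[OF smult(1,2)] by (rule G(4)[OF smult(1,3)])
    next
      case (mult a b)
      show ?case unfolding proj_mult[OF mult(1,2)] by (rule mu[OF mult(3,4)])
    qed
  qed
  hence gen: "gen_subalgebra K u B ((\<lambda>j. proj (g j)) ` {..<n}) = carrier B"
    using B.gen_subalgebra_closed[OF img Bid] by (auto simp: B_carrier)
  show dB: "degree_algebra K B u n (\<lambda>j. proj (g j))"
  proof
    show "has_identity B" if u by (rule Bid[OF that])
    show "proj (g j) \<in> carrier B" if "j \<in> {..<n}" for j using that img by auto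
    show "gen_subalgebra K u B ((\<lambda>j. proj (g j)) ` {..<n}) = carrier B" by (rule gen)
  qed
  have part: "degree_part K u B n (\<lambda>j. proj (g j)) k \<subseteq> proj ` degree_part K u A n g k" for k
  proof -
    have "weight_gens u K B {..<n} (\<lambda>j. proj (g j)) (\<lambda>_. 1) k \<subseteq> proj ` degree_part K u A n g k"
    proof
      fix b assume b: "b \<in> weight_gens u K B {..<n} (\<lambda>j. proj (g j)) (\<lambda>_. 1) k"
      show "b \<in> proj ` degree_part K u A n g k"
      proof (cases "u \<and> k = 0 \<and> b = \<one>\<^bsub>B\<^esub>")
        case True
        have "\<one>\<^bsub>A\<^esub> \<in> degree_part K u A n g 0" unfolding degree_part_def using A.weight_part_one True by blast
        thus ?thesis using True proj_one by (metis imageI)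
      next
        case False
        then obtain t where t: "t \<in> terms K u {..<n}" "is_monomial t" "weight (\<lambda>_. 1) t = k"
          "b = teval B (\<lambda>j. proj (g j)) t"
          using b unfolding weight_gens_def by (auto split: if_splits)
        have "teval A g t \<in> degree_part K u A n g k"
          unfolding degree_part_def weight_part_eq
          by (rule lin_span_incl) (use t in \<open>auto simp: weight_gens_def\<close>)
        moreover have "b = proj (teval A g t)"
          unfolding t(4) by (rule teval_hom[OF nonassoc_algebra_axioms B_algebra proj_hom A.ident _ t(1)]) (assumption, rule gc, simp)
        ultimately show ?thesis by blast
      qed
    qed
    thus ?thesis unfolding degree_part_def[of K u B] weight_part_eq
      by (rule B.lin_span_minimal[OF proj_submodule[OF A.degree_part_submodule]])
  qed
  show "degree_ge K u B n (\<lambda>j. proj (g j)) m \<subseteq> proj ` degree_ge K u A n g m"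
    unfolding degree_ge_def[of K u B]
  proof (rule B.lin_span_minimal[OF proj_submodule[OF A.degree_ge_submodule]])
    show "(\<Union>k\<in>{m..}. degree_part K u B n (\<lambda>j. proj (g j)) k) \<subseteq> proj ` degree_ge K u A n g m"
    proof
      fix b assume "b \<in> (\<Union>k\<in>{m..}. degree_part K u B n (\<lambda>j. proj (g j)) k)"
      then obtain k where "m \<le> k" "b \<in> degree_part K u B n (\<lambda>j. proj (g j)) k" by auto
      thus "b \<in> proj ` degree_ge K u A n g m" using part[of k] A.degree_part_ge[of m k] by auto
    qed
  qed
qed

end

text \<open>Tame automorphisms are generated as a group, so the induction over them has a case for
  inverses; with this lemma it becomes the case of generators.\<close>

lemma elementary_inverse:
  assumes K: "field K" and B: "nonassoc_algebra K B" and Bid: "u \<Longrightarrow> has_identity B"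
    and z: "\<And>l. l < n \<Longrightarrow> z l \<in> carrier B"
    and el: "\<psi> \<in> elementary_auts K u B n z"
  shows "inv\<^bsub>BijGroup (carrier B)\<^esub> \<psi> \<in> elementary_auts K u B n z"
proof -
  interpret B: nonassoc_algebra K B by fact
  obtain j \<alpha> f where j: "j < n" and \<alpha>: "\<alpha> \<in> carrier K" "\<alpha> \<noteq> \<zero>\<^bsub>K\<^esub>"
    and f: "f \<in> gen_subalgebra K u B (z ` ({..<n} - {j}))"
    and \<psi>j: "\<psi> (z j) = (\<alpha> \<odot>\<^bsub>B\<^esub> z j) \<oplus>\<^bsub>B\<^esub> f" and \<psi>l: "\<And>l. l < n \<Longrightarrow> l \<noteq> j \<Longrightarrow> \<psi> (z l) = z l"
    and aut: "\<psi> \<in> alg_hom K u B B" "\<psi> \<in> Bij (carrier B)"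
    using el unfolding elementary_auts_def alg_aut_def by auto
  note h = hom_onD[OF alg_hom_hom_on[OF aut(1)]]
  have bij: "bij_betw \<psi> (carrier B) (carrier B)" using aut(2) unfolding Bij_def by simp
  define \<chi> where "\<chi> = (\<lambda>b\<in>carrier B. inv_into (carrier B) \<psi> b)"
  have inv: "inv\<^bsub>BijGroup (carrier B)\<^esub> \<psi> = \<chi>" unfolding \<chi>_def by (rule inv_BijGroup[OF aut(2)])
  have \<chi>B: "\<chi> \<in> Bij (carrier B)" unfolding \<chi>_def by (rule restrict_inv_into_Bij[OF aut(2)])
  have c: "\<chi> b \<in> carrier B" "\<psi> (\<chi> b) = b" if "b \<in> carrier B" for b
    using that bij Bij_inv_into_mem[OF aut(2) that] unfolding \<chi>_def
    by (auto simp: bij_betw_inv_into_right)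
  have eqI: "\<chi> b = a" if "a \<in> carrier B" "\<psi> a = b" for a b
    using that bij h(4)[OF that(1)] unfolding \<chi>_def by (auto simp: bij_betw_inv_into_left)
  have hom: "\<chi> \<in> alg_hom K u B B"
    unfolding alg_hom_iff linear_on_def mult_on_def
  proof (intro conjI ballI impI)
    show "\<chi> \<in> carrier B \<rightarrow> carrier B" using c by auto
    show "\<chi> \<in> extensional (carrier B)" by (simp add: \<chi>_def)
    show "\<chi> \<one>\<^bsub>B\<^esub> = \<one>\<^bsub>B\<^esub>" if u using h(3)[OF that] Bid[OF that] by (intro eqI) (auto simp: has_identity_def)
    fix a assume a: "a \<in> carrier B"
    show "\<chi> (k \<odot>\<^bsub>B\<^esub> a) = k \<odot>\<^bsub>B\<^esub> \<chi> a" if "k \<in> carrier K" for k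
      using a that c h by (intro eqI) simp_all
    fix b assume b: "b \<in> carrier B"
    show "\<chi> (a \<oplus>\<^bsub>B\<^esub> b) = \<chi> a \<oplus>\<^bsub>B\<^esub> \<chi> b" using a b c h by (intro eqI) simp_all
    show "\<chi> (a \<otimes>\<^bsub>B\<^esub> b) = \<chi> a \<otimes>\<^bsub>B\<^esub> \<chi> b" using a b c h B.m_closed by (intro eqI) simp_all
  qed
  have zs: "z ` ({..<n} - {j}) \<subseteq> carrier B" using z by auto
  let ?G = "gen_subalgebra K u B (z ` ({..<n} - {j}))"
  have Bid': "u \<longrightarrow> has_identity B" using Bid by simp
  \<comment> \<open>All generators of the subalgebra that contains f are fixed.\<close>
  have fix_f: "\<psi> f = f" using f Bid' zs
  proof (induction rule: B.gen_subalgebra_induct)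
    case zero
    show ?case by (rule linear_on_zero[OF B.module_axioms B.module_axioms h(1)])
  next
    case one
    show ?case by (rule h(3)[OF one])
  qed (use \<psi>l h in auto)
  have fB: "f \<in> carrier B" using B.gen_subalgebra_closed[OF zs Bid] f by auto
  interpret K: field K by fact
  have "\<alpha> \<in> Units K" using \<alpha> K.field_Units by simp
  then obtain \<beta> where \<beta>: "\<beta> \<in> carrier K" "\<beta> \<otimes>\<^bsub>K\<^esub> \<alpha> = \<one>\<^bsub>K\<^esub>" unfolding Units_def by auto
  have \<beta>0: "\<beta> \<noteq> \<zero>\<^bsub>K\<^esub>" using \<beta> \<alpha> by auto
  \<comment> \<open>The equation \<open>w = \<alpha> z_j + f\<close> is solved for
    \<open>z_j\<close>; as f is fixed, the inverse maps \<open>z_j\<close> to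
    \<open>\<beta> z_j - \<beta> f\<close>.\<close>
  let ?f = "(\<ominus>\<^bsub>K\<^esub> \<beta>) \<odot>\<^bsub>B\<^esub> f"
  have zj: "z j \<in> carrier B" using z j by simp
  have "\<psi> ((\<beta> \<odot>\<^bsub>B\<^esub> z j) \<oplus>\<^bsub>B\<^esub> ?f) = z j"
  proof -
    have "\<psi> ((\<beta> \<odot>\<^bsub>B\<^esub> z j) \<oplus>\<^bsub>B\<^esub> ?f) = \<beta> \<odot>\<^bsub>B\<^esub> ((\<alpha> \<odot>\<^bsub>B\<^esub> z j) \<oplus>\<^bsub>B\<^esub> f) \<oplus>\<^bsub>B\<^esub> ?f"
      using h \<beta> zj fB by (simp add: fix_f \<psi>j)
    also have "\<dots> = (\<beta> \<odot>\<^bsub>B\<^esub> (\<alpha> \<odot>\<^bsub>B\<^esub> z j)) \<oplus>\<^bsub>B\<^esub> (\<beta> \<odot>\<^bsub>B\<^esub> f \<oplus>\<^bsub>B\<^esub> ?f)"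
      using \<beta> \<alpha> zj fB by (simp add: B.smult_r_distr B.M.a_assoc)
    also have "\<dots> = z j"
      using \<beta> \<alpha> zj fB by (simp add: B.smult_assoc1[symmetric] B.smult_l_minus B.M.r_neg)
    finally show ?thesis .
  qed
  hence "\<chi> (z j) = (\<beta> \<odot>\<^bsub>B\<^esub> z j) \<oplus>\<^bsub>B\<^esub> ?f" using \<beta> zj fB by (intro eqI) simp_all
  moreover have "submodule ?G K B"
    using B.gen_subalgebra_subalgebra[OF zs Bid] unfolding subalgebra_def by simp
  hence "?f \<in> ?G" using B.submoduleE(4) f \<beta> by simp
  moreover have "\<forall>l\<in>{..<n} - {j}. \<chi> (z l) = z l" using \<psi>l z by (auto intro!: eqI)
  ultimately show ?thesis
    unfolding inv elementary_auts_def alg_aut_def using hom \<chi>B j \<beta> \<beta>0 by blast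
qed

section \<open>Automorphisms of the free algebras of a subvariety\<close>

locale subvariety = free_xy K u M n for K :: "'k ring" and u :: bool and M :: "('k, 'a) module set" and n +
  fixes N :: "('k, 'a) module set"
  assumes N_subset: "N \<subseteq> M"
begin

abbreviation "TX \<equiv> terms K u (XVar ` {..<n})"
abbreviation "A_part \<equiv> degree_part K u A n x"
abbreviation "A_ge \<equiv> degree_ge K u A n x"
abbreviation "I \<equiv> ideal_I K u M N n"
abbreviation "B \<equiv> alg_B K u M N n"
abbreviation "\<pi> \<equiv> to_B K u M N n"
abbreviation "z \<equiv> gen_z K u M N n"

lemma A_carrierE:
  assumes "a \<in> carrier A" obtains t where "t \<in> TX" "a = cls t"
  using assms unfolding alg_A_def free_algebra_carrier by auto

lemma class_in_A: "t \<in> TX \<Longrightarrow> cls t \<in> carrier A"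
  unfolding alg_A_def by (rule free_algebra_class_closed)

lemma ops_A:
  assumes "s \<in> TX" "t \<in> TX"
  shows "cls s \<otimes>\<^bsub>A\<^esub> cls t = cls (TMult s t)" "cls s \<oplus>\<^bsub>A\<^esub> cls t = cls (TAdd s t)"
    "c \<in> carrier K \<Longrightarrow> c \<odot>\<^bsub>A\<^esub> cls t = cls (TScale c t)"
  unfolding alg_A_def using assms[THEN terms_UNIV] by (simp_all add: free_ops)

lemma N_free: "relatively_free K u N"
  using N_subset algs by unfold_locales auto

text \<open>\<open>ideal_I\<close> asks for some representative that vanishes in N. Terms equivalent
  over M are equivalent over the smaller class N, so every representative decides
  membership.\<close>

lemma I_mem:
  assumes "t \<in> TX"
  shows "cls t \<in> I \<longleftrightarrow> term_equiv N t TZero"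
proof -
  have sat: "(\<forall>S\<in>N. satisfies S s) \<longleftrightarrow> term_equiv N s TZero" for s :: "('k, gen) aterm"
    unfolding satisfies_def term_equiv_def by simp
  have "term_equiv N t TZero" if "s \<in> TX" "term_equiv N s TZero" "cls t = cls s" for s
  proof -
    have "term_equiv M t s" using that(3) class_eq_iff[OF terms_UNIV[OF assms]] by simp
    hence "term_equiv N t s" using N_subset unfolding term_equiv_def by blast
    thus ?thesis using that(2) unfolding term_equiv_def by simp
  qed
  note conv = this
  show ?thesis
  proof
    assume "cls t \<in> I"
    then obtain s where "cls t = cls s" "s \<in> TX" "term_equiv N s TZero"
      unfolding ideal_I_def sat mem_Collect_eq by (elim exE conjE)
    thus "term_equiv N t TZero" by (intro conv)
  next
    assume "term_equiv N t TZero"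
    with assms show "cls t \<in> I"
      unfolding ideal_I_def sat mem_Collect_eq by (intro exI[of _ t] conjI refl)
  qed
qed

lemma I_subset: "I \<subseteq> carrier A"
proof
  fix a assume "a \<in> I"
  then obtain t where "a = cls t" "t \<in> TX"
    unfolding ideal_I_def mem_Collect_eq by (elim exE conjE)
  thus "a \<in> carrier A" using class_in_A by simp
qed

lemma I_E:
  assumes "a \<in> I" obtains t where "t \<in> TX" "a = cls t" "term_equiv N t TZero"
proof -
  have "a \<in> carrier A" using assms I_subset by (rule subsetD[rotated])
  then obtain t where t: "t \<in> TX" "a = cls t" by (rule A_carrierE)
  with assms I_mem[OF t(1)] show ?thesis by (intro that[of t]) simp_all
qed

lemma N_eval:
  assumes "S \<in> N" "\<rho> \<in> UNIV \<rightarrow> carrier S" "t \<in> TX"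
  shows "teval S \<rho> t \<in> carrier S" "nonassoc_algebra K S"
  using relatively_free.teval_M[OF N_free assms(1,2) terms_UNIV[OF assms(3)]]
    relatively_free.algsD(1)[OF N_free assms(1)] by auto

lemma I_submodule: "submodule I K A"
proof (rule A.submodule_criterion[OF I_subset])
  have "cls (TZero :: ('k, gen) aterm) \<in> I" by (subst I_mem) simp_all
  thus "\<zero>\<^bsub>A\<^esub> \<in> I" by (simp add: alg_A_def free_algebra_consts)
next
  fix a b assume "a \<in> I" "b \<in> I"
  then obtain s t where s: "s \<in> TX" "a = cls s" "term_equiv N s TZero"
    and t: "t \<in> TX" "b = cls t" "term_equiv N t TZero" by (elim I_E)
  have "term_equiv N (TAdd s t) TZero"
    unfolding term_equiv_def
  proof (intro ballI)
    fix S and \<rho> :: "gen \<Rightarrow> 'a" assume S: "S \<in> N" "\<rho> \<in> UNIV \<rightarrow> carrier S"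
    interpret S: nonassoc_algebra K S by (rule N_eval(2)[OF S s(1)])
    show "teval S \<rho> (TAdd s t) = teval S \<rho> TZero" using s(3) t(3) S unfolding term_equiv_def by simp
  qed
  thus "a \<oplus>\<^bsub>A\<^esub> b \<in> I" using s t by (simp add: ops_A I_mem)
next
  fix c a assume c: "c \<in> carrier K" and "a \<in> I"
  then obtain s where s: "s \<in> TX" "a = cls s" "term_equiv N s TZero" by (elim I_E)
  have "term_equiv N (TScale c s) TZero"
    unfolding term_equiv_def
  proof (intro ballI)
    fix S and \<rho> :: "gen \<Rightarrow> 'a" assume S: "S \<in> N" "\<rho> \<in> UNIV \<rightarrow> carrier S"
    interpret S: nonassoc_algebra K S by (rule N_eval(2)[OF S s(1)])
    show "teval S \<rho> (TScale c s) = teval S \<rho> TZero" using s(3) c S unfolding term_equiv_def by simp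
  qed
  thus "c \<odot>\<^bsub>A\<^esub> a \<in> I" using s c by (simp add: ops_A(3)[OF s(1) s(1)] I_mem)
qed

lemma I_mult:
  assumes "a \<in> carrier A" "b \<in> I" shows "a \<otimes>\<^bsub>A\<^esub> b \<in> I" "b \<otimes>\<^bsub>A\<^esub> a \<in> I"
proof -
  obtain s where s: "s \<in> TX" "a = cls s" using A_carrierE[OF assms(1)] .
  obtain t where t: "t \<in> TX" "b = cls t" "term_equiv N t TZero" using I_E[OF assms(2)] .
  have "term_equiv N (TMult s t) TZero \<and> term_equiv N (TMult t s) TZero"
    unfolding term_equiv_def
  proof (intro conjI ballI)
    fix S and \<rho> :: "gen \<Rightarrow> 'a" assume S: "S \<in> N" "\<rho> \<in> UNIV \<rightarrow> carrier S"
    interpret S: nonassoc_algebra K S by (rule N_eval(2)[OF S s(1)])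
    show "teval S \<rho> (TMult s t) = teval S \<rho> TZero" "teval S \<rho> (TMult t s) = teval S \<rho> TZero"
      using t(3) S N_eval(1)[OF S s(1)] unfolding term_equiv_def by simp_all
  qed
  thus "a \<otimes>\<^bsub>A\<^esub> b \<in> I" "b \<otimes>\<^bsub>A\<^esub> a \<in> I"
    unfolding s(2) t(2) ops_A(1)[OF s(1) t(1)] ops_A(1)[OF t(1) s(1)] using s(1) t(1) by (simp_all add: I_mem)
qed

sublocale Q: algebra_ideal K A I
  by (intro algebra_ideal.intro algebra_ideal_axioms.intro A.nonassoc_algebra_axioms I_submodule I_mult)

lemma proj_eq: "Q.proj = \<pi>"
  by (rule ext) (simp add: Q.proj_def to_B_def)

lemma z_eq: "z = (\<lambda>j. \<pi> (x j))"
  by (rule ext) (simp add: gen_z_def)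

text \<open>On terms the Euler derivation is the formal derivative with
  \<open>\<sigma> x = x\<close>, a formula that depends on no variety. Hence
  \<open>tderiv_equiv\<close> can be applied to N and shows that derivatives of identities of N are
  identities of N.\<close>

lemma I_euler: "a \<in> I \<Longrightarrow> euler a \<in> I"
proof -
  assume "a \<in> I"
  then obtain t where t: "t \<in> TX" "a = cls t" "term_equiv N t TZero" by (rule I_E)
  define \<sigma> :: "gen \<Rightarrow> ('k, gen) aterm" where "\<sigma> v = (if v \<in> XVar ` {..<n} then TVar v else TZero)" for v
  have "euler (cls t) = cls (tderiv TVar \<sigma> t)"
  proof (rule free_derivation_ex[of "XVar ` {..<n}" TVar])
    show "TVar v \<in> TX" if "v \<in> XVar ` {..<n}" for v using that by simp
    fix D assume D: "D \<in> derivations K (free_algebra K u M (XVar ` {..<n}))"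
      "\<And>v. v \<in> XVar ` {..<n} \<Longrightarrow> D (cls (TVar v)) = cls (TVar v)"
      "\<And>t. t \<in> TX \<Longrightarrow>
        D (cls t) = cls (tderiv TVar (\<lambda>x. if x \<in> XVar ` {..<n} then TVar x else TZero) t)"
    \<comment> \<open>\<open>derivation_unique\<close> compares extensional maps on
      \<open>A\<close>, whereas \<open>euler\<close> is defined on all of \<open>C\<close>.\<close>
    have rE: "restrict euler (carrier A) \<in> derivations K A"
      unfolding derivations_iff linear_on_def leibniz_on_def by (auto simp: A_ops euler_ops)
    have "restrict euler (carrier A) = D"
    proof (rule derivation_unique[OF _ D(1)])
      show "restrict euler (carrier A) \<in> derivations K (free_algebra K u M (XVar ` {..<n}))"
        using rE unfolding alg_A_def .
      fix v assume v: "v \<in> XVar ` {..<n}"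
      then obtain j where j: "j < n" "v = XVar j" by auto
      have "restrict euler (carrier A) (x j) = x j" using j(1) by (simp add: euler_props)
      thus "restrict euler (carrier A) (cls (TVar v)) = D (cls (TVar v))"
        using D(2)[OF v] unfolding j(2) gen_x_def by (simp only:)
    qed
    moreover have "restrict euler (carrier A) (cls t) = euler (cls t)" using class_in_A[OF t(1)] by simp
    moreover have "D (cls t) = cls (tderiv TVar \<sigma> t)" unfolding D(3)[OF t(1)] \<sigma>_def ..
    ultimately show "euler (cls t) = cls (tderiv TVar \<sigma> t)" by (simp only:)
  qed
  moreover have "term_equiv N (tderiv TVar \<sigma> t) (tderiv TVar \<sigma> TZero)"
    by (rule relatively_free.tderiv_equiv[OF N_free terms_UNIV[OF t(1)] _ t(3)]) (simp_all add: \<sigma>_def)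
  moreover have "tderiv TVar \<sigma> t \<in> TX"
    by (rule tderiv_terms[OF t(1)]) (simp_all add: \<sigma>_def)
  ultimately show "euler a \<in> I" using t(2) I_mem by simp
qed

section \<open>The gradings of A and B, and homogeneity of I\<close>

sublocale A_deg: degree_algebra K A u n x
proof
  show "has_identity A" if u by (rule A_ident[OF that])
  show "x j \<in> carrier A" if "j \<in> {..<n}" for j using that by simp
  have "(\<lambda>v. cls (TVar v)) ` XVar ` {..<n} = x ` {..<n}" by (simp add: image_image gen_x_def)
  thus "gen_subalgebra K u A (x ` {..<n}) = carrier A"
    using free_algebra_generated[of "XVar ` {..<n}"] unfolding alg_A_def by simp
qed

sublocale B: degree_algebra K B u n z
  unfolding z_eq using Q.degree_ge_quot(1)[OF A_deg.degree_algebra_axioms] unfolding proj_eq alg_B_def .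

lemma B_degree_ge: "degree_ge K u B n z m \<subseteq> \<pi> ` A_ge m"
  unfolding z_eq using Q.degree_ge_quot(2)[OF A_deg.degree_algebra_axioms, of m] unfolding proj_eq alg_B_def .

lemma \<pi>_hom: "hom_on K u A B \<pi>"
  using Q.proj_hom unfolding proj_eq alg_B_def .

lemmas \<pi>_ops = hom_onD[OF \<pi>_hom]

lemma B_carrier: "carrier B = \<pi> ` carrier A"
  using Q.B_carrier unfolding proj_eq alg_B_def .

lemma \<pi>_eq_iff: "\<lbrakk>a \<in> carrier A; b \<in> carrier A\<rbrakk> \<Longrightarrow> \<pi> a = \<pi> b \<longleftrightarrow> a \<ominus>\<^bsub>A\<^esub> b \<in> I"
  using Q.proj_eq_iff unfolding proj_eq .

lemma \<pi>_minus: "\<lbrakk>a \<in> carrier A; b \<in> carrier A\<rbrakk> \<Longrightarrow> \<pi> (a \<ominus>\<^bsub>A\<^esub> b) = \<pi> a \<ominus>\<^bsub>B\<^esub> \<pi> b"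
  using Q.proj_minus unfolding proj_eq alg_B_def .

lemma B_ident: "u \<Longrightarrow> has_identity B"
  using B.ident .

lemma z_closed: "l < n \<Longrightarrow> z l \<in> carrier B"
  using B.gens by simp

lemma degree_part_eigen: "a \<in> A_part k \<Longrightarrow> a \<in> carrier A \<and> euler a = nat_scalar K k \<odot>\<^bsub>A\<^esub> a"
proof -
  assume a: "a \<in> A_part k"
  have "euler a = nat_scalar K k \<odot>\<^bsub>A\<^esub> a"
    by (rule A_deg.weight_part_derivation[OF a[unfolded degree_part_def] euler_lin_A euler_leibniz_A])
      (simp_all add: euler_props nat_scalar_add)
  thus ?thesis using a A_deg.degree_part_closed by blast
qed

lemma degree_ge_AF: "A_ge m \<subseteq> AF m"
  unfolding degree_ge_def
proof (rule A.lin_span_minimal[OF A.eig_span_submodule])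
  show "(\<Union>k\<in>{m..}. A_part k) \<subseteq> AF m"
  proof
    fix a assume "a \<in> (\<Union>k\<in>{m..}. A_part k)"
    then obtain k where "m \<le> k" "a \<in> A_part k" by auto
    thus "a \<in> AF m" using degree_part_eigen[of a k] A.eig_span_incl[of a euler "nat_scalar K" k m] by blast
  qed
qed

text \<open>Used for \<open>I\<close>, where it expresses homogeneity, and for the zero subspace,
  where it expresses independence of the graded parts of \<open>A\<close>.\<close>

lemma component_in:
  assumes S: "submodule S K A" "\<And>s. s \<in> S \<Longrightarrow> euler s \<in> S"
    and a: "a \<in> carrier A" "euler a = nat_scalar K k \<odot>\<^bsub>A\<^esub> a" and b: "b \<in> AF (Suc k)" and ab: "a \<oplus>\<^bsub>A\<^esub> b \<in> S"
  shows "a \<in> S"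
  by (rule eigen_component[where lam = "nat_scalar K" and i = k and T = euler,
        OF A.module_axioms char_zero_field_axioms euler_lin_A _ _ S a b ab])
    (simp_all add: nat_scalar_inj)

text \<open>The lowest component of an element of \<open>I\<close> lies in \<open>I\<close> by
  homogeneity, and it is zero as long as its degree is at most k. Removing components one by one
  reaches degree k + 1.\<close>

lemma I_degree_ge:
  assumes "I \<inter> degree_le K u A n x k \<subseteq> {\<zero>\<^bsub>A\<^esub>}" "m \<le> Suc k"
  shows "I \<subseteq> A_ge m"
  using assms(2)
proof (induction m)
  case 0
  show ?case using A_deg.degree_ge_0 I_subset by simp
next
  case (Suc m)
  show ?case
  proof
    fix a assume a: "a \<in> I"
    hence "a \<in> A_ge m" using Suc by auto
    then obtain b c where bc: "b \<in> A_part m" "c \<in> A_ge (Suc m)" "a = b \<oplus>\<^bsub>A\<^esub> c"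
      by (rule A_deg.degree_ge_split)
    have "b \<in> I"
      by (rule component_in[OF I_submodule I_euler _ _ _ a[unfolded bc(3)]])
        (use degree_part_eigen[OF bc(1)] degree_ge_AF bc(2) in auto)
    moreover have "b \<in> degree_le K u A n x k"
      unfolding degree_le_def by (rule A.lin_span_incl) (use bc(1) Suc(2) in auto)
    ultimately have "b = \<zero>\<^bsub>A\<^esub>" using assms(1) by blast
    thus "a \<in> A_ge (Suc m)" using bc A_deg.degree_ge_closed[of "Suc m"] by auto
  qed
qed

text \<open>Instead of lifting tame automorphisms of \<open>B\<close> to automorphisms of \<open>A\<close>, it suffices to lift the
  images of the generators.\<close>

definition lifts :: "('k elem set \<Rightarrow> 'k elem set) \<Rightarrow> (nat \<Rightarrow> 'k elem) \<Rightarrow> bool" where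
  "lifts \<theta> X \<longleftrightarrow> (\<forall>l<n. X l \<in> carrier A \<and> \<theta> (z l) = \<pi> (X l)) \<and> log_traceless (\<lambda>l. univ_d (X l))"

text \<open>Precomposition with an elementary automorphism replaces \<open>\<theta> z_j\<close> by
  \<open>\<alpha> \<theta> z_j + \<theta> f\<close> and keeps the other images. On lifts this is an
  elementary transformation of the tuple X, so \<open>log_traceless_elementary\<close>
  applies.\<close>

lemma lifts_elementary:
  assumes \<psi>: "\<psi> \<in> elementary_auts K u B n z" and \<theta>: "hom_on K u B B \<theta>" and X: "lifts \<theta> X"
  shows "\<exists>X'. lifts (\<lambda>b. \<theta> (\<psi> b)) X'"
proof -
  obtain j \<alpha> f where j: "j < n" and \<alpha>: "\<alpha> \<in> carrier K" "\<alpha> \<noteq> \<zero>\<^bsub>K\<^esub>"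
    and f: "f \<in> gen_subalgebra K u B (z ` ({..<n} - {j}))"
    and \<psi>j: "\<psi> (z j) = (\<alpha> \<odot>\<^bsub>B\<^esub> z j) \<oplus>\<^bsub>B\<^esub> f" and \<psi>l': "\<forall>l\<in>{..<n} - {j}. \<psi> (z l) = z l"
    using \<psi> unfolding elementary_auts_def by blast
  have \<psi>l: "\<psi> (z l) = z l" if "l < n" "l \<noteq> j" for l using \<psi>l' that by simp
  note h = hom_onD[OF \<theta>]
  have XA: "X l \<in> carrier A" "\<theta> (z l) = \<pi> (X l)" if "l < n" for l using X that unfolding lifts_def by auto
  let ?S = "X ` ({..<n} - {j})"
  have S: "?S \<subseteq> carrier A" using XA by auto
  have zs: "z ` ({..<n} - {j}) \<subseteq> carrier B" using z_closed by auto
  have sub: "subalgebra K u A (gen_subalgebra K u A ?S)" by (rule A.gen_subalgebra_subalgebra[OF S A_ident])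
  hence sm: "submodule (gen_subalgebra K u A ?S) K A" and
    mu: "\<And>a b. \<lbrakk>a \<in> gen_subalgebra K u A ?S; b \<in> gen_subalgebra K u A ?S\<rbrakk> \<Longrightarrow> a \<otimes>\<^bsub>A\<^esub> b \<in> gen_subalgebra K u A ?S"
    unfolding subalgebra_def by auto
  note G = A.submoduleE[OF sm] A.submodule_zero[OF sm]
  have Gc: "a \<in> carrier A" if "a \<in> gen_subalgebra K u A ?S" for a using G(1) that by auto
  have "u \<longrightarrow> has_identity B" using B_ident by simp
  \<comment> \<open>The preimage of \<open>\<theta> f\<close> is built along the generation of f,
    with X l in place of z l. An arbitrary preimage could lie outside the subalgebra generated by
    the X l with l different from j.\<close>
  with f have "\<exists>a \<in> gen_subalgebra K u A ?S. \<theta> f = \<pi> a" using zs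
  proof (induction rule: B.gen_subalgebra_induct)
    case (base b)
    then obtain l where l: "l < n" "l \<noteq> j" "b = z l" by auto
    show ?case by (rule bexI[of _ "X l"]) (use l XA in \<open>auto intro!: A.gen_subalgebra_incl\<close>)
  next
    case zero
    have "\<theta> \<zero>\<^bsub>B\<^esub> = \<pi> \<zero>\<^bsub>A\<^esub>"
      using linear_on_zero[OF B.module_axioms B.module_axioms h(1)]
        linear_on_zero[OF A.module_axioms B.module_axioms \<pi>_ops(1)] by simp
    thus ?case using G(7) by blast
  next
    case one
    have "\<theta> \<one>\<^bsub>B\<^esub> = \<pi> \<one>\<^bsub>A\<^esub>" using h(3)[OF one] \<pi>_ops(3)[OF one] by simp
    moreover have "\<one>\<^bsub>A\<^esub> \<in> gen_subalgebra K u A ?S" using sub one unfolding subalgebra_def by simp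
    ultimately show ?case by blast
  next
    case (add b c)
    then obtain b' c' where "b' \<in> gen_subalgebra K u A ?S" "\<theta> b = \<pi> b'" "c' \<in> gen_subalgebra K u A ?S" "\<theta> c = \<pi> c'"
      by blast
    thus ?case using add(1,2) h(5) \<pi>_ops(5) G(5) Gc by (intro bexI[of _ "b' \<oplus>\<^bsub>A\<^esub> c'"]) simp_all
  next
    case (smult k b)
    then obtain b' where "b' \<in> gen_subalgebra K u A ?S" "\<theta> b = \<pi> b'" by blast
    thus ?case using smult(1,2) h(6) \<pi>_ops(6) G(4) Gc by (intro bexI[of _ "k \<odot>\<^bsub>A\<^esub> b'"]) simp_all
  next
    case (mult b c)
    then obtain b' c' where "b' \<in> gen_subalgebra K u A ?S" "\<theta> b = \<pi> b'" "c' \<in> gen_subalgebra K u A ?S" "\<theta> c = \<pi> c'"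
      by blast
    thus ?case using mult(1,2) h(7) \<pi>_ops(7) mu Gc by (intro bexI[of _ "b' \<otimes>\<^bsub>A\<^esub> c'"]) simp_all
  qed
  then obtain a where a: "a \<in> gen_subalgebra K u A ?S" "\<theta> f = \<pi> a" by blast
  have fB: "f \<in> carrier B" using B.gen_subalgebra_closed[OF zs B_ident] f by auto
  let ?X = "X(j := \<alpha> \<odot>\<^bsub>A\<^esub> X j \<oplus>\<^bsub>A\<^esub> a)"
  have "lifts (\<lambda>b. \<theta> (\<psi> b)) ?X"
    unfolding lifts_def
  proof (intro conjI allI impI)
    show "log_traceless (\<lambda>l. univ_d (?X l))"
      by (rule log_traceless_elementary[OF _ _ j \<alpha> a(1)]) (use XA X in \<open>auto simp: lifts_def\<close>)
    fix l assume l: "l < n"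
    show "?X l \<in> carrier A" using XA(1)[OF l] XA(1)[OF j] Gc[OF a(1)] \<alpha> by simp
    show "\<theta> (\<psi> (z l)) = \<pi> (?X l)"
    proof (cases "l = j")
      case True
      have "\<theta> (\<psi> (z j)) = \<alpha> \<odot>\<^bsub>B\<^esub> \<theta> (z j) \<oplus>\<^bsub>B\<^esub> \<theta> f"
        unfolding \<psi>j using z_closed[OF j] fB \<alpha> h(5,6) by simp
      also have "\<dots> = \<pi> (\<alpha> \<odot>\<^bsub>A\<^esub> X j \<oplus>\<^bsub>A\<^esub> a)"
        using XA[OF j] a Gc[OF a(1)] \<alpha> \<pi>_ops(5,6) by simp
      finally show ?thesis using True by simp
    next
      case False
      thus ?thesis using XA(2)[OF l] \<psi>l[OF l] by simp
    qed
  qed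
  thus ?thesis by blast
qed

text \<open>Quantifying over \<open>\<theta>\<close> carries the induction through products:
  \<open>\<theta>\<close> composed with a product is handled by passing to
  \<open>\<theta> \<psi>1\<close> first and then precomposing with \<open>\<psi>2\<close>.\<close>

lemma tame_lifts:
  assumes "\<psi> \<in> tame_auts K u B n z"
  shows "\<psi> \<in> Bij (carrier B) \<and> hom_on K u B B \<psi> \<and>
    (\<forall>\<theta> X. hom_on K u B B \<theta> \<longrightarrow> lifts \<theta> X \<longrightarrow> (\<exists>X'. lifts (\<lambda>b. \<theta> (\<psi> b)) X'))"
  using assms unfolding tame_auts_def
proof (induction rule: generate.induct)
  case one
  have e: "\<one>\<^bsub>BijGroup (carrier B)\<^esub> = (\<lambda>b\<in>carrier B. b)" by (simp add: BijGroup_def)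
  have "hom_on K u B B (\<lambda>b\<in>carrier B. b)"
    unfolding hom_on_def linear_on_def mult_on_def using B_ident by (auto simp: B.m_closed has_identity_def)
  moreover have "lifts (\<lambda>b. \<theta> ((\<lambda>b\<in>carrier B. b) b)) X" if "lifts \<theta> X" for \<theta> X
    using that z_closed unfolding lifts_def by simp
  ultimately show ?case unfolding e using id_Bij by blast
next
  case (incl \<psi>)
  have "\<psi> \<in> alg_hom K u B B" "\<psi> \<in> Bij (carrier B)" using incl unfolding elementary_auts_def alg_aut_def by auto
  thus ?case using alg_hom_hom_on lifts_elementary[OF incl] by blast
next
  case (inv \<psi>)
  have "inv\<^bsub>BijGroup (carrier B)\<^esub> \<psi> \<in> elementary_auts K u B n z"
    by (rule elementary_inverse[OF field_axioms B.nonassoc_algebra_axioms B_ident z_closed inv])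
  note inv' = this
  have "inv\<^bsub>BijGroup (carrier B)\<^esub> \<psi> \<in> alg_hom K u B B" "inv\<^bsub>BijGroup (carrier B)\<^esub> \<psi> \<in> Bij (carrier B)"
    using inv' unfolding elementary_auts_def alg_aut_def by auto
  thus ?case using alg_hom_hom_on lifts_elementary[OF inv'] by blast
next
  case (eng \<psi>1 \<psi>2)
  have b: "\<psi>1 \<in> Bij (carrier B)" "\<psi>2 \<in> Bij (carrier B)" using eng by auto
  have e: "\<psi>1 \<otimes>\<^bsub>BijGroup (carrier B)\<^esub> \<psi>2 = compose (carrier B) \<psi>1 \<psi>2"
    using b by (simp add: BijGroup_def)
  have h: "hom_on K u B B \<psi>1" "hom_on K u B B \<psi>2" using eng by auto
  have "hom_on K u B B (compose (carrier B) \<psi>1 \<psi>2)"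
    using hom_on_comp[OF h(2,1)] B_ident
    unfolding hom_on_def linear_on_def mult_on_def compose_def by (auto simp: B.m_closed has_identity_def)
  moreover have "\<exists>X'. lifts (\<lambda>b. \<theta> (compose (carrier B) \<psi>1 \<psi>2 b)) X'" if \<theta>: "hom_on K u B B \<theta>" "lifts \<theta> X" for \<theta> X
  proof -
    obtain X1 where "lifts (\<lambda>b. \<theta> (\<psi>1 b)) X1" using eng \<theta> by blast
    moreover have "hom_on K u B B (\<lambda>b. \<theta> (\<psi>1 b))" by (rule hom_on_comp[OF h(1) \<theta>(1)])
    ultimately obtain X2 where "lifts (\<lambda>b. \<theta> (\<psi>1 (\<psi>2 b))) X2" using eng by blast
    hence "lifts (\<lambda>b. \<theta> (compose (carrier B) \<psi>1 \<psi>2 b)) X2"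
      using z_closed unfolding lifts_def by (simp add: compose_def)
    thus ?thesis by blast
  qed
  ultimately show ?case unfolding e using compose_Bij[OF b] by blast
qed

section \<open>The leading part, its derivation and the divergence\<close>

lemma leading_part_eq:
  assumes f: "f \<in> A_part (i + 1)" and g: "g \<in> A_ge (i + 2)"
    and e: "\<epsilon> (x j) = x j \<oplus>\<^bsub>A\<^esub> f \<oplus>\<^bsub>A\<^esub> g" and j: "j < n"
  shows "leading_part K u M n i \<epsilon> j = f"
  unfolding leading_part_def
proof (rule the_equality)
  show "f \<in> A_part (i + 1) \<and> (\<exists>g\<in>A_ge (i + 2). \<epsilon> (x j) = x j \<oplus>\<^bsub>A\<^esub> f \<oplus>\<^bsub>A\<^esub> g)"
    using f g e by blast
  fix f' assume "f' \<in> A_part (i + 1) \<and> (\<exists>g\<in>A_ge (i + 2). \<epsilon> (x j) = x j \<oplus>\<^bsub>A\<^esub> f' \<oplus>\<^bsub>A\<^esub> g)"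
  then obtain g' where f': "f' \<in> A_part (i + 1)" and g': "g' \<in> A_ge (i + 2)"
    and e': "\<epsilon> (x j) = x j \<oplus>\<^bsub>A\<^esub> f' \<oplus>\<^bsub>A\<^esub> g'" by blast
  note ff = degree_part_eigen[OF f] degree_part_eigen[OF f']
  have gg: "g \<in> carrier A" "g' \<in> carrier A" using A_deg.degree_ge_closed g g' by auto
  have "x j \<oplus>\<^bsub>A\<^esub> (f' \<oplus>\<^bsub>A\<^esub> g') = x j \<oplus>\<^bsub>A\<^esub> (f \<oplus>\<^bsub>A\<^esub> g)"
    using e e' ff gg j by (simp add: A.M.a_assoc del: A_closed)
  hence "f' \<oplus>\<^bsub>A\<^esub> g' = f \<oplus>\<^bsub>A\<^esub> g"
    using ff gg j A.M.add.right_cancel[of "x j" "f' \<oplus>\<^bsub>A\<^esub> g'" "f \<oplus>\<^bsub>A\<^esub> g"] by (simp add: A.M.a_comm)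
  hence "(f' \<oplus>\<^bsub>A\<^esub> g') \<ominus>\<^bsub>A\<^esub> (f \<oplus>\<^bsub>A\<^esub> g) = \<zero>\<^bsub>A\<^esub>" using ff gg by (simp add: A.M.minus_eq_zero_iff)
  \<comment> \<open>Two candidates for the leading part differ by an element of degree i + 1 that
    cancels against an element of degree at least i + 2; by independence of degrees it is
    zero.\<close>
  hence sum: "(f' \<ominus>\<^bsub>A\<^esub> f) \<oplus>\<^bsub>A\<^esub> (g' \<ominus>\<^bsub>A\<^esub> g) = \<zero>\<^bsub>A\<^esub>"
    using ff gg by (simp add: a_minus_def A.M.minus_add A.M.a_ac)
  have "f' \<ominus>\<^bsub>A\<^esub> f \<in> A_part (i + 1)"
    by (rule A.submodule_minus_closed[OF A_deg.degree_part_submodule f' f])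
  moreover have "g' \<ominus>\<^bsub>A\<^esub> g \<in> A_ge (i + 2)"
    by (rule A.submodule_minus_closed[OF A_deg.degree_ge_submodule g' g])
  moreover have "submodule {\<zero>\<^bsub>A\<^esub>} K A" by (rule A.submodule_criterion) auto
  ultimately have "f' \<ominus>\<^bsub>A\<^esub> f \<in> {\<zero>\<^bsub>A\<^esub>}"
    using component_in[of "{\<zero>\<^bsub>A\<^esub>}" "f' \<ominus>\<^bsub>A\<^esub> f" "i + 1" "g' \<ominus>\<^bsub>A\<^esub> g"] degree_part_eigen
      degree_ge_AF[of "i + 2"] sum by (auto simp: A_ops euler_ops)
  thus "f' = f" using ff by (simp add: A.M.minus_eq_zero_iff)
qed

text \<open>Existence and uniqueness together give the definite description in \<open>der_of\<close>
  its meaning.\<close>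

lemma der_of_gen:
  assumes f: "\<And>j. j < n \<Longrightarrow> f j \<in> carrier A" and j: "j < n"
  shows "der_of K u M n f (x j) = f j"
proof -
  have "\<forall>j. \<exists>t. j < n \<longrightarrow> t \<in> TX \<and> f j = cls t" using f A_carrierE by metis
  then obtain s where s: "\<And>j. j < n \<Longrightarrow> s j \<in> TX" "\<And>j. j < n \<Longrightarrow> f j = cls (s j)" by metis
  define \<sigma> where "\<sigma> v = (case v of XVar j \<Rightarrow> s j | YVar j \<Rightarrow> TZero)" for v
  have \<sigma>: "\<sigma> v \<in> TX" if "v \<in> XVar ` {..<n}" for v using that s by (auto simp: \<sigma>_def)
  have "\<exists>!D. D \<in> derivations K A \<and> (\<forall>j<n. D (x j) = f j)"
  proof (rule free_derivation_ex[OF \<sigma>])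
    fix D assume D: "D \<in> derivations K (free_algebra K u M (XVar ` {..<n}))"
      "\<And>v. v \<in> XVar ` {..<n} \<Longrightarrow> D (cls (TVar v)) = cls (\<sigma> v)"
    show ?thesis
    proof (rule ex1I[of _ D])
      show P: "D \<in> derivations K A \<and> (\<forall>j<n. D (x j) = f j)"
        using D s by (auto simp: alg_A_def gen_x_def \<sigma>_def)
      fix D' assume D': "D' \<in> derivations K A \<and> (\<forall>j<n. D' (x j) = f j)"
      show "D' = D"
        by (rule derivation_unique[of _ "XVar ` {..<n}"]) (use P D' in \<open>auto simp: alg_A_def gen_x_def\<close>)
    qed
  qed
  from theI'[OF this] show ?thesis using j unfolding der_of_def by blast
qed

text \<open>\<open>[U,U]\<close> is contained in the kernel \<open>[U,U] + R\<close>, and the coset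
  of an element of a subgroup is the subgroup itself.\<close>

lemma CU_divergence:
  assumes f: "\<And>j. j < n \<Longrightarrow> D (x j) = f j" "\<And>j. j < n \<Longrightarrow> f j \<in> carrier A"
    and CU: "(\<Oplus>\<^bsub>U\<^esub>j\<in>{..<n}. crd (univ_d (f j)) j) \<in> CU"
  shows "divergence K u M n D = div_kernel K u M n"
proof -
  let ?V = "\<Oplus>\<^bsub>U\<^esub>j\<in>{..<n}. crd (univ_d (f j)) j"
  have eq: "(\<Oplus>\<^bsub>U\<^esub>j\<in>{..<n}. fox_der K u M n (D (x j)) j) = ?V"
    by (rule U.M.finsum_cong') (use f in \<open>auto simp: fox_der_eq\<close>)
  have sub: "subgroup CU (add_monoid U)" using CU_submodule unfolding submodule_def by simp
  \<comment> \<open>The radical is cut out of \<open>U\<close> by maximal left ideals, all of which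
    are additive subgroups.\<close>
  have J: "additive_subgroup (jacobson_radical U) U"
  proof (rule additive_subgroupI, rule group.subgroupI[OF U.M.a_group])
    have l: "additive_subgroup J U" if "maximal_left_ideal J U" for J
      using that unfolding maximal_left_ideal_def left_ideal_def by simp
    show "jacobson_radical U \<subseteq> carrier (add_monoid U)" by (auto simp: jacobson_radical_def)
    have "\<zero>\<^bsub>U\<^esub> \<in> jacobson_radical U"
      using additive_subgroup.zero_closed[OF l] by (auto simp: jacobson_radical_def)
    thus "jacobson_radical U \<noteq> {}" by auto
    show "inv\<^bsub>add_monoid U\<^esub> a \<in> jacobson_radical U" if "a \<in> jacobson_radical U" for a
      using that additive_subgroup.a_inv_closed[OF l]
      unfolding a_inv_def[symmetric] jacobson_radical_def by auto
    show "a \<otimes>\<^bsub>add_monoid U\<^esub> b \<in> jacobson_radical U" if "a \<in> jacobson_radical U" "b \<in> jacobson_radical U" for a b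
      using that additive_subgroup.a_closed[OF l] by (auto simp: jacobson_radical_def)
  qed
  have "additive_subgroup (div_kernel K u M n) U"
    unfolding div_kernel_def by (rule U.M.add_additive_subgroups[OF additive_subgroupI[OF sub] J])
  hence K: "subgroup (div_kernel K u M n) (add_monoid U)" by (rule additive_subgroup.a_subgroup)
  have Vc: "?V \<in> carrier U" using CU U.submoduleE(1)[OF CU_submodule] by blast
  have "?V = ?V \<oplus>\<^bsub>U\<^esub> \<zero>\<^bsub>U\<^esub>" using Vc by simp
  hence "?V \<in> div_kernel K u M n"
    unfolding div_kernel_def set_add_def' using CU additive_subgroup.zero_closed[OF J] by blast
  thus ?thesis unfolding divergence_def eq using U.M.a_coset_join2[OF Vc K] by simp
qed

lemma approximately_tame_divergence:
  assumes i: "1 \<le> i" and \<epsilon>: "\<epsilon> \<in> IE K u M n i"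
    and \<phi>: "\<phi> \<in> alg_aut K u B" "\<And>a. a \<in> carrier A \<Longrightarrow> \<phi> (\<pi> a) = \<pi> (\<epsilon> a)"
    and I: "I \<inter> degree_le K u A n x (i + 1) \<subseteq> {\<zero>\<^bsub>A\<^esub>}"
    and tame: "approximately_tame K u B n z \<phi>"
  shows "divergence K u M n (T_der K u M n i \<epsilon>) = div_kernel K u M n"
proof -
  interpret BG: group "BijGroup (carrier B)" by (rule group_BijGroup)
  \<comment> \<open>Level i + 1 gives agreement up to terms of degree at least i + 2, just beyond
    the leading part.\<close>
  obtain \<psi> where \<psi>: "\<psi> \<in> tame_auts K u B n z"
    and IA: "\<phi> \<otimes>\<^bsub>BijGroup (carrier B)\<^esub> inv\<^bsub>BijGroup (carrier B)\<^esub> \<psi> \<in> IA K u B n z (i + 1)"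
    using tame unfolding approximately_tame_def by (meson le_add2)
  define \<theta> where "\<theta> = \<phi> \<otimes>\<^bsub>BijGroup (carrier B)\<^esub> inv\<^bsub>BijGroup (carrier B)\<^esub> \<psi>"
  note tl = tame_lifts[OF \<psi>]
  have \<psi>B: "\<psi> \<in> carrier (BijGroup (carrier B))" and \<phi>B: "\<phi> \<in> carrier (BijGroup (carrier B))"
    using tl \<phi>(1) unfolding alg_aut_def by (simp_all add: BijGroup_def)
  have \<theta>B: "\<theta> \<in> carrier (BijGroup (carrier B))" unfolding \<theta>_def using \<psi>B \<phi>B by simp
  have "\<theta> \<otimes>\<^bsub>BijGroup (carrier B)\<^esub> \<psi> = \<phi>" unfolding \<theta>_def using \<psi>B \<phi>B by (simp add: BG.m_assoc)
  hence "compose (carrier B) \<theta> \<psi> = \<phi>" using \<theta>B \<psi>B by (simp add: BijGroup_def)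
  hence \<phi>\<theta>: "\<phi> b = \<theta> (\<psi> b)" if "b \<in> carrier B" for b using that by (auto simp: compose_def)
  have \<theta>h: "hom_on K u B B \<theta>" and \<theta>univ_d: "\<And>j. j < n \<Longrightarrow> \<theta> (z j) \<ominus>\<^bsub>B\<^esub> z j \<in> degree_ge K u B n z (i + 2)"
    using IA unfolding \<theta>_def[symmetric] IA_def alg_aut_def by (auto intro: alg_hom_hom_on)
  have "hom_on K u B B (\<lambda>b. b)" unfolding hom_on_def linear_on_def mult_on_def by auto
  \<comment> \<open>The induction over tame automorphisms starts at the generators x, whose images
    under \<open>univ_d\<close> are the y.\<close>
  moreover have "lifts (\<lambda>b. b) x"
    unfolding lifts_def using log_traceless_cong[OF log_traceless_y, of "\<lambda>l. univ_d (x l)"] by (auto simp: z_eq univ_d_props)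
  ultimately obtain X where "lifts (\<lambda>b. \<psi> b) X" using tl by blast
  hence X: "X j \<in> carrier A" "\<psi> (z j) = \<pi> (X j)" and log_traceless: "log_traceless (\<lambda>l. univ_d (X l))" if "j < n" for j
    using that unfolding lifts_def by auto
  have log_traceless: "log_traceless (\<lambda>l. univ_d (X l))" using \<open>lifts (\<lambda>b. \<psi> b) X\<close> unfolding lifts_def by simp
  have IA2: "I \<subseteq> A_ge (i + 2)" by (rule I_degree_ge[OF I]) simp
  have \<epsilon>A: "\<epsilon> (x j) \<in> carrier A" if "j < n" for j
    using \<epsilon> that linear_onD(1)[of K A A \<epsilon>] unfolding IE_def alg_hom_iff by auto
  \<comment> \<open>In \<open>B\<close> one has
    \<open>\<pi>(\<epsilon> x_j) = \<phi> z_j = \<theta>(\<pi> X_j)\<close>, which agrees with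
    \<open>\<pi> X_j\<close> up to degree at least i + 2. The congruence passes to \<open>A\<close>
    because \<open>I\<close> itself starts in degree i + 2 or later.\<close>
  have diff: "\<epsilon> (x j) \<ominus>\<^bsub>A\<^esub> X j \<in> A_ge (i + 2)" if j: "j < n" for j
  proof -
    have "\<theta> (\<pi> (X j)) \<ominus>\<^bsub>B\<^esub> \<pi> (X j) \<in> degree_ge K u B n z (i + 2)"
      by (rule B.hom_diff_degree_ge[OF hom_onD(1,2,3)[OF \<theta>h] \<theta>univ_d]) (use X[OF j] \<pi>_ops(4) in simp_all)
    moreover have "\<theta> (\<pi> (X j)) = \<pi> (\<epsilon> (x j))"
      using \<phi>\<theta>[of "z j"] z_closed[OF j] X[OF j] \<phi>(2)[of "x j"] j unfolding z_eq by simp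
    ultimately have "\<pi> (\<epsilon> (x j) \<ominus>\<^bsub>A\<^esub> X j) \<in> degree_ge K u B n z (i + 2)"
      using \<pi>_minus[OF \<epsilon>A[OF j] X(1)[OF j]] by simp
    then obtain g where g: "g \<in> A_ge (i + 2)" "\<pi> (\<epsilon> (x j) \<ominus>\<^bsub>A\<^esub> X j) = \<pi> g"
      using B_degree_ge by blast
    have gA: "g \<in> carrier A" using g(1) A_deg.degree_ge_closed by blast
    have "(\<epsilon> (x j) \<ominus>\<^bsub>A\<^esub> X j) \<ominus>\<^bsub>A\<^esub> g \<in> A_ge (i + 2)"
      using g(2) \<pi>_eq_iff[of "\<epsilon> (x j) \<ominus>\<^bsub>A\<^esub> X j" g] \<epsilon>A[OF j] X(1)[OF j] gA IA2 by auto
    from A.submoduleE(5)[OF A_deg.degree_ge_submodule this g(1)] show ?thesis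
      using \<epsilon>A[OF j] X(1)[OF j] gA by (simp add: a_minus_def A.M.a_assoc A.M.l_neg)
  qed
  have "\<exists>f g. f \<in> A_part (i + 1) \<and> g \<in> A_ge (i + 2) \<and>
      \<epsilon> (x j) = x j \<oplus>\<^bsub>A\<^esub> f \<oplus>\<^bsub>A\<^esub> g" if j: "j < n" for j
  proof -
    have "\<epsilon> (x j) \<ominus>\<^bsub>A\<^esub> x j \<in> A_ge (i + 1)" using \<epsilon> j unfolding IE_def by auto
    then obtain f g where fg: "f \<in> A_part (i + 1)" "g \<in> A_ge (Suc (i + 1))"
      "\<epsilon> (x j) \<ominus>\<^bsub>A\<^esub> x j = f \<oplus>\<^bsub>A\<^esub> g" by (rule A_deg.degree_ge_split)
    have c: "f \<in> carrier A" "g \<in> carrier A" "x j \<in> carrier A"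
      using subsetD[OF A_deg.degree_part_closed fg(1)] subsetD[OF A_deg.degree_ge_closed fg(2)] j by auto
    have "\<epsilon> (x j) = (f \<oplus>\<^bsub>A\<^esub> g) \<oplus>\<^bsub>A\<^esub> x j"
      using fg(3) A.M.minus_eq_iff[OF \<epsilon>A[OF j] c(3), of "f \<oplus>\<^bsub>A\<^esub> g"] c A.M.a_closed[OF c(1,2)] by blast
    also have "\<dots> = x j \<oplus>\<^bsub>A\<^esub> f \<oplus>\<^bsub>A\<^esub> g" using c A.M.a_closed[OF c(1,2)] by (metis A.M.a_assoc A.M.a_comm)
    finally show ?thesis using fg by auto
  qed
  then obtain f g where f: "\<And>j. j < n \<Longrightarrow> f j \<in> A_part (i + 1)"
    and g: "\<And>j. j < n \<Longrightarrow> g j \<in> A_ge (i + 2)"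
    and e: "\<And>j. j < n \<Longrightarrow> \<epsilon> (x j) = x j \<oplus>\<^bsub>A\<^esub> f j \<oplus>\<^bsub>A\<^esub> g j" by metis
  have fA: "f j \<in> carrier A" "euler (f j) = nat_scalar K (Suc i) \<odot>\<^bsub>C\<^esub> f j" if "j < n" for j
    using degree_part_eigen[OF f[OF that]] by (simp_all add: A_ops)
  have gA: "g j \<in> carrier A" if "j < n" for j using g[OF that] A_deg.degree_ge_closed by blast
  \<comment> \<open>The correction turns the expansion of \<open>\<epsilon> x_j\<close> into one of
    X j with the same leading part \<open>f j\<close>.\<close>
  define h where "h j = g j \<ominus>\<^bsub>A\<^esub> (\<epsilon> (x j) \<ominus>\<^bsub>A\<^esub> X j)" for j
  have h: "h j \<in> A_ge (i + 2)" if "j < n" for j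
    unfolding h_def by (rule A.submodule_minus_closed[OF A_deg.degree_ge_submodule g[OF that] diff[OF that]])
  have Xh: "X j = x j \<oplus>\<^bsub>C\<^esub> f j \<oplus>\<^bsub>C\<^esub> h j" if j: "j < n" for j
  proof -
    let ?e = "\<epsilon> (x j)"
    have c: "x j \<oplus>\<^bsub>A\<^esub> f j \<in> carrier A" "g j \<in> carrier A" "?e \<in> carrier A" "X j \<in> carrier A"
      using A.M.a_closed[OF x_closed[OF j] fA(1)[OF j]] gA[OF j] \<epsilon>A[OF j] X(1)[OF j] by auto
    have "(x j \<oplus>\<^bsub>A\<^esub> f j) \<oplus>\<^bsub>A\<^esub> h j = ((x j \<oplus>\<^bsub>A\<^esub> f j) \<oplus>\<^bsub>A\<^esub> g j) \<oplus>\<^bsub>A\<^esub> (X j \<ominus>\<^bsub>A\<^esub> ?e)"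
      unfolding h_def using c by (simp add: a_minus_def A.M.minus_add A.M.a_ac)
    also have "\<dots> = ?e \<oplus>\<^bsub>A\<^esub> (X j \<ominus>\<^bsub>A\<^esub> ?e)" using e[OF j] by simp
    also have "\<dots> = X j" using c(3,4) by (simp add: a_minus_def A.M.a_lcomm A.M.r_neg)
    finally show ?thesis unfolding A_ops by simp
  qed
  have "(\<Oplus>\<^bsub>U\<^esub>j\<in>{..<n}. crd (univ_d (f j)) j) \<in> CU"
  proof (rule log_traceless_divergence[OF _ i fA])
    show "log_traceless (\<lambda>j. univ_d (x j \<oplus>\<^bsub>C\<^esub> f j \<oplus>\<^bsub>C\<^esub> h j))"
      by (rule log_traceless_cong[OF log_traceless]) (simp add: Xh)
    show "h j \<in> AF (Suc (Suc i))" if "j < n" for j using h[OF that] degree_ge_AF[of "i + 2"] by auto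
  qed
  moreover have lp: "leading_part K u M n i \<epsilon> j = f j" if "j < n" for j
    by (rule leading_part_eq[of "f j" i "g j" \<epsilon> j, OF f[OF that] g[OF that] e[OF that] that])
  have "T_der K u M n i \<epsilon> (x j) = f j" if "j < n" for j
    unfolding T_der_def using der_of_gen[of "leading_part K u M n i \<epsilon>"] lp fA(1) that by simp
  ultimately show ?thesis using fA(1) by (intro CU_divergence)
qed

end

theorem theorem5:
  fixes K :: "'k ring" and u :: bool and M N :: "('k, 'a) module set"
    and n i :: nat and \<epsilon> :: "'k elem \<Rightarrow> 'k elem" and \<phi> :: "'k elem set \<Rightarrow> 'k elem set"
  assumes "field K" and "char_zero K"
    and universe: "\<exists>e :: 'k \<Rightarrow> 'a. inj_on e (carrier K)"
    and "(infinite (UNIV :: 'v set) \<and> variety K u M \<and> nielsen_schreier TYPE('v) K u M)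
       \<or> M = associative_algebras K u
       \<or> M = comm_associative_algebras K u
       \<or> M = metabelian_lie_algebras K u"
    and "variety K u N" and "N \<subseteq> M"
    and "1 \<le> i" and "\<epsilon> \<in> IE K u M n i - IE K u M n (i + 1)"
    and "\<phi> \<in> alg_aut K u (alg_B K u M N n)"
    and "\<forall>a\<in>carrier (alg_A K u M n). \<phi> (to_B K u M N n a) = to_B K u M N n (\<epsilon> a)"
    and "ideal_I K u M N n \<inter> degree_le K u (alg_A K u M n) n (gen_x K u M) (i + 1)
       \<subseteq> {\<zero>\<^bsub>alg_A K u M n\<^esub>}"
    and "divergence K u M n (T_der K u M n i \<epsilon>) \<noteq> div_kernel K u M n"
  shows "absolutely_wild K u (alg_B K u M N n) n (gen_z K u M N n) \<phi>"
proof -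
  have "M \<subseteq> algebras K u"
    using assms(4) by (auto simp: variety_def associative_algebras_def comm_associative_algebras_def
        metabelian_lie_algebras_def lie_algebras_def)
  then interpret subvariety K u M n N
    using assms(1,2,6) by (intro subvariety.intro free_xy.intro relatively_free.intro char_zero_field.intro
        subvariety_axioms.intro relatively_free_axioms.intro char_zero_field_axioms.intro)
  show ?thesis
    unfolding absolutely_wild_def using assms(7-12) approximately_tame_divergence[of i \<epsilon> \<phi>] by blast
qed

end
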